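(* The degree of the hypersurface $\Gamma(\overline{\mathcal E})\subset\mathbb{P}^4$ associated with a spine curve $\overline{\mathcal E}\subset\mathbb{P}^4$ of general type is equal to $6n-4$, where $n=\deg\overline{\mathcal E}$.
   Context: The spine curve $\overline{\mathcal E}$ is the closed image of $t\mapsto(e_0(t):e_1(t):e_2(t):e_3(t):e_4(t))\in\mathbb{P}^4$ with $e_0,\dots,e_4\in\mathbb{R}[t]$, $\gcd(e_0,\dots,e_4)=1$, $n=\max_i\deg e_i$. Parameters $t$ are understood as points $(t:s)\in\mathbb{P}^1$ and polynomials as homogenized with respect to a new variable $s$; $'$ is the derivative with respect to $t$. Write $e=(e_1,e_2,e_3,e_4)$, $y=(y_1,y_2,y_3,y_4)$, $\langle v,w\rangle=v_1w_1+v_2w_2+v_3w_3-v_4w_4$. The lift of the spine curve is $\hat{\mathcal E}$, parametrized by $t\mapsto(\langle e,e\rangle:e_0^2:e_0e_1:e_0e_2:e_0e_3:e_0e_4)\in\mathbb{P}^5$. Put $E=\big(-\tfrac{e_0^2}{2},-\tfrac{\langle e,e\rangle}{2},e_0e_1,e_0e_2,e_0e_3,-e_0e_4\big)\in\mathbb{R}[t]^6$ and $E'=dE/dt$. Let $w_j=e_j'e_0-e_je_0'$, $j=1,2,3,4$. The curve $\overline{\mathcal E}$ is of general type if $\gcd(w_1,w_2,w_3,w_4)=\gcd(e_0,e_0')=\gcd(e_0,\langle e,e\rangle)=1$, $\deg\overline{\mathcal E}$ equals the degree of $e_0$ in $t$, and the parametrization $t\mapsto E\wedge E'\in\mathbb{P}^{14}$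 of the Plücker curve (where $E\wedge E'$ is the vector of $2\times2$ minors of the matrix with rows $E,E'$) has degree one, i.e. the fibre of a generic point of its image has cardinality one. Dual variety: let $M=\{aE+bE'\in\mathbb{R}[t]^6 : a,b\in\mathbb{R}(t)\}$ and $L(M,t_0)=\{x\in\mathbb{R}^6 : C(t_0)\cdot x=0\ \text{for all } C\in M\}$ with $C\cdot x=\sum_iC_ix_i$; then $\mathcal V(\hat{\mathcal E})$ is the hypersurface $\bigcup_t\mathbb{P}(L(M,t))\subset\mathbb{P}^5$, with implicit equation $G(u,y_0,y_1,y_2,y_3,y_4)=0$. The $\Gamma$-hypersurface is $\Gamma(\overline{\mathcal E})=\Phi(\mathcal V(\hat{\mathcal E})\cap\mathcal Q)$, where $\mathcal Q=\{uy_0=\langle y,y\rangle\}\subset\mathbb{P}^5$ is the Lie quadric and $\Phi(u:y_0:y_1:y_2:y_3:y_4)=(y_0:y_1:y_2:y_3:y_4)$. Its equation is obtained by eliminating $u$: $F(y_0,\dots,y_4)=y_0^{\kappa}\,G\big(\langle y,y\rangle/y_0,\,y_0,y_1,y_2,y_3,y_4\big)=0$, where $\kappa$ is the minimal integer such that $F$ is a polynomial. *)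

theory Defs
  imports
    "HOL-Analysis.Analysis"
    "HOL-Computational_Algebra.Computational_Algebra"
    "HOL-Computational_Algebra.Field_as_Ring"
    "HOL-Library.Poly_Mapping"
    "HOL-Library.Numeral_Type"
begin

text \<open>
  Coordinates on projective 4-space are indexed by the type 5 (values 0, 1, 2, 3, 4), and
  coordinates (u : y0 : ... : y4) on projective 5-space by the type 5 option, where None is
  the index of u and Some j the index of yj.  A subset of a projective space is
  represented by its set of nonzero representatives (closed under nonzero scalars); the point
  with representative x is the line \<open>vec.span {x}\<close>.  The coefficients of the
  spine curve are real, points are complex: this is what makes the degree of a curve, the
  cardinality of a generic fibre and the implicit equation of a hypersurface meaningful.
\<close>

section \<open>Polynomials in several variables and projective sets\<close>

type_synonym 'v mpoly = "('v \<Rightarrow>\<^sub>0 nat) \<Rightarrow>\<^sub>0 complex"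

definition meval :: "'v::finite mpoly \<Rightarrow> complex ^ 'v \<Rightarrow> complex" where
  "meval P x = (\<Sum>m \<in> Poly_Mapping.keys P.
     Poly_Mapping.lookup P m * (\<Prod>i\<in>UNIV. (x $ i) ^ Poly_Mapping.lookup m i))"

definition total_degree :: "'v::finite mpoly \<Rightarrow> nat" where
  "total_degree P =
     Max (insert 0 ((\<lambda>m. \<Sum>i\<in>UNIV. Poly_Mapping.lookup m i) ` Poly_Mapping.keys P))"

definition zero_locus :: "'v::finite mpoly \<Rightarrow> (complex ^ 'v) set" where
  "zero_locus P = {x. x \<noteq> 0 \<and> meval P x = 0}"

definition zariski_closure :: "(complex ^ 'v::finite) set \<Rightarrow> (complex ^ 'v) set" where
  "zariski_closure X =
     {x. x \<noteq> 0 \<and> (\<forall>P. (\<forall>y\<in>X. meval P y = 0) \<longrightarrow> meval P x = 0)}"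

text \<open>The implicit equation is the reduced one: it generates the ideal of the set.\<close>

definition implicit_equation :: "'v::finite mpoly \<Rightarrow> (complex ^ 'v) set \<Rightarrow> bool" where
  "implicit_equation G X \<longleftrightarrow> G \<noteq> 0 \<and> (\<forall>P. (\<forall>x\<in>X. meval P x = 0) \<longleftrightarrow> G dvd P)"

text \<open>The degree of a projective curve is the number of its points on a generic hyperplane.\<close>

definition has_curve_degree :: "(complex ^ 'v::finite) set \<Rightarrow> nat \<Rightarrow> bool" where
  "has_curve_degree X d \<longleftrightarrow>
     (\<exists>H. H \<noteq> 0 \<and> (\<forall>h. meval H h \<noteq> 0 \<longrightarrow>
        (let P = {vec.span {x} | x. x \<in> X \<and> (\<Sum>i\<in>UNIV. h $ i * x $ i) = 0}
         in finite P \<and> card P = d)))"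

section \<open>Homogenization\<close>

text \<open>
  The homogenization of p with respect to the degree d (at least the degree of p), as a
  polynomial in s with coefficients in R[t].
\<close>

definition homogenize :: "nat \<Rightarrow> real poly \<Rightarrow> real poly poly" where
  "homogenize d p = (\<Sum>i\<le>d. monom (monom (coeff p i) i) (d - i))"

text \<open>Its value at a parameter (t : s), represented by the vector q with entries t, s.\<close>

definition heval :: "nat \<Rightarrow> real poly \<Rightarrow> complex ^ 2 \<Rightarrow> complex" where
  "heval d p q = (\<Sum>i\<le>d. complex_of_real (coeff p i) * (q $ 1) ^ i * (q $ 2) ^ (d - i))"

definition vec_degree :: "real poly ^ 'i::finite \<Rightarrow> nat" where
  "vec_degree C = Max (range (\<lambda>i. degree (C $ i)))"

definition vec_heval :: "real poly ^ 'i::finite \<Rightarrow> complex ^ 2 \<Rightarrow> complex ^ 'i" where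
  "vec_heval C q = (\<chi> i. heval (vec_degree C) (C $ i) q)"

section \<open>The spine curve and its lift\<close>

definition lorentz :: "'a::comm_ring_1 ^ 5 \<Rightarrow> 'a ^ 5 \<Rightarrow> 'a" where
  "lorentz v w = v $ 1 * w $ 1 + v $ 2 * w $ 2 + v $ 3 * w $ 3 - v $ 4 * w $ 4"

definition spine_curve :: "real poly ^ 5 \<Rightarrow> (complex ^ 5) set" where
  "spine_curve e =
     zariski_closure {x. x \<noteq> 0 \<and> (\<exists>q c. q \<noteq> 0 \<and> x = c *s vec_heval e q)}"

definition E_vec :: "real poly ^ 5 \<Rightarrow> real poly ^ (5 option)" where
  "E_vec e = (\<chi> k. case k of
       None \<Rightarrow> smult (- 1 / 2) ((e $ 0)\<^sup>2)
     | Some j \<Rightarrow>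
         if j = 0 then smult (- 1 / 2) (lorentz e e)
         else if j = 4 then - (e $ 0 * e $ 4)
         else e $ 0 * e $ j)"

definition E_vec' :: "real poly ^ 5 \<Rightarrow> real poly ^ (5 option)" where
  "E_vec' e = (\<chi> k. pderiv (E_vec e $ k))"

definition w_poly :: "real poly ^ 5 \<Rightarrow> 5 \<Rightarrow> real poly" where
  "w_poly e j = pderiv (e $ j) * e $ 0 - e $ j * pderiv (e $ 0)"

text \<open>
  All pairs of indices are used instead of increasing ones only: the 15 Pluecker coordinates
  are then repeated up to sign, together with zeros, which does not change equality of points.
\<close>

definition plucker :: "real poly ^ 5 \<Rightarrow> real poly ^ (5 option \<times> 5 option)" where
  "plucker e =
     (\<chi> k. E_vec e $ fst k * E_vec' e $ snd k - E_vec e $ snd k * E_vec' e $ fst k)"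

text \<open>
  The generic points of the image are those outside a finite proper subset, because the image
  is an irreducible set of dimension at most one.
\<close>

definition plucker_degree_one :: "real poly ^ 5 \<Rightarrow> bool" where
  "plucker_degree_one e \<longleftrightarrow>
     (let dom = {q. q \<noteq> 0 \<and> vec_heval (plucker e) q \<noteq> 0};
          pt = (\<lambda>q. vec.span {vec_heval (plucker e) q})
      in \<exists>Z. finite Z \<and> Z \<subset> pt ` dom \<and>
           (\<forall>p \<in> pt ` dom - Z. card {vec.span {q} | q. q \<in> dom \<and> pt q = p} = 1))"

text \<open>
  All greatest common divisors are those of homogenizations, so that the parameter (1 : 0) is
  included.  If n is the largest degree of the components of e, then the terms of degree
  2n - 1 in e_j' e_0 - e_j e_0' cancel, and the homogenization of w_j has degree 2n - 2; in
  degree 2n - 1 all the w_j would be divisible by s for every curve.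
\<close>

definition general_type :: "real poly ^ 5 \<Rightarrow> bool" where
  "general_type e \<longleftrightarrow>
     (let n = vec_degree e in
        Gcd ((\<lambda>j. homogenize (2 * n - 2) (w_poly e j)) ` {1, 2, 3, 4}) = 1 \<and>
        gcd (homogenize n (e $ 0)) (homogenize (n - 1) (pderiv (e $ 0))) = 1 \<and>
        gcd (homogenize n (e $ 0)) (homogenize (2 * n) (lorentz e e)) = 1 \<and>
        has_curve_degree (spine_curve e) (degree (e $ 0)) \<and>
        plucker_degree_one e)"

section \<open>The dual variety\<close>

definition M_mod :: "real poly ^ 5 \<Rightarrow> (real poly ^ (5 option)) set" where
  "M_mod e = {C. \<exists>a b :: real poly fract.
      \<forall>k. to_fract (C $ k) = a * to_fract (E_vec e $ k) + b * to_fract (E_vec' e $ k)}"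

definition L_space ::
    "(real poly ^ 'i::finite) set \<Rightarrow> complex ^ 2 \<Rightarrow> (complex ^ 'i) set" where
  "L_space M q = {x. \<forall>C\<in>M. (\<Sum>k\<in>UNIV. vec_heval C q $ k * x $ k) = 0}"

definition dual_variety :: "real poly ^ 5 \<Rightarrow> (complex ^ (5 option)) set" where
  "dual_variety e = {x. x \<noteq> 0 \<and> (\<exists>q. q \<noteq> 0 \<and> x \<in> L_space (M_mod e) q)}"

section \<open>The Gamma-hypersurface and its equation\<close>

definition Phi :: "complex ^ (5 option) \<Rightarrow> complex ^ 5" where
  "Phi x = (\<chi> j. x $ Some j)"

definition lie_quadric :: "(complex ^ (5 option)) set" where
  "lie_quadric = {x. x \<noteq> 0 \<and> x $ None * x $ Some 0 = lorentz (Phi x) (Phi x)}"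

text \<open>
  The rational map Phi is undefined at (1 : 0 : 0 : 0 : 0 : 0), a point of the dual variety
  and of the Lie quadric; the image is therefore taken over the other points, and closed up.
\<close>

definition gamma_hypersurface :: "real poly ^ 5 \<Rightarrow> (complex ^ 5) set" where
  "gamma_hypersurface e =
     zariski_closure {Phi x | x. x \<in> dual_variety e \<inter> lie_quadric \<and> Phi x \<noteq> 0}"

definition eliminates_u :: "5 option mpoly \<Rightarrow> int \<Rightarrow> 5 mpoly \<Rightarrow> bool" where
  "eliminates_u G \<kappa> F \<longleftrightarrow>
     (\<forall>y. y $ 0 \<noteq> 0 \<longrightarrow>
        meval F y = (y $ 0) powi \<kappa> *
          meval G (\<chi> k. case k of None \<Rightarrow> lorentz y y / y $ 0 | Some j \<Rightarrow> y $ j))"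

definition gamma_equation :: "real poly ^ 5 \<Rightarrow> 5 mpoly \<Rightarrow> bool" where
  "gamma_equation e F \<longleftrightarrow>
     (\<exists>G \<kappa>. implicit_equation G (dual_variety e) \<and> eliminates_u G \<kappa> F \<and>
        (\<forall>\<kappa>' F'. eliminates_u G \<kappa>' F' \<longrightarrow> \<kappa> \<le> \<kappa>'))"

end

theory Submission
  imports Defs "Jordan_Normal_Form.Determinant"
begin

text \<open>
  Let \<open>n\<close> be the degree of \<open>e\<^sub>0\<close>, which is the degree of the spine curve.  For a point \<open>x = (u, y)\<close>
  let \<open>g\<^sub>x(t)\<close> be the product of the vectors \<open>E(t)\<close> and \<open>x\<close>, a binary form of degree \<open>2n\<close> in the
  parameter with coefficients linear in \<open>x\<close>.  The point \<open>x\<close> annihilates \<open>E(t)\<close> and \<open>E'(t)\<close>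
  exactly if \<open>t\<close> is a multiple root of \<open>g\<^sub>x\<close>, so the dual variety is the zero set of the discriminant \<open>D\<close>
  of \<open>g\<^sub>x\<close>, which is homogeneous of degree \<open>4n - 2\<close> in \<open>x\<close> (\<open>dual_variety_eq\<close>, \<open>D_scale\<close>).  Two things
  are left: \<open>D\<close> is the reduced equation, and \<open>2n - 2\<close> is the least power of \<open>y\<^sub>0\<close> that makes
  \<open>F = y\<^sub>0\<^bsup>2n-2\<^esup> D(<y,y>/y\<^sub>0, y)\<close> a polynomial.  The degree of \<open>F\<close> is then
  \<open>(4n - 2) + (2n - 2) = 6n - 4\<close>.

  As to the power of \<open>y\<^sub>0\<close>, the combination \<open>W\<^sub>y = g\<^sub>x' e\<^sub>0 - 2 g\<^sub>x e\<^sub>0'\<close> has degree \<open>3n - 2\<close> and does not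
  involve \<open>u\<close>; its roots are the critical points of \<open>g\<^sub>x/e\<^sub>0\<^sup>2\<close>.  Since resultants are multiplicative,
  \<open>y\<^sub>0\<^sup>n D\<close> is, up to constants and a power of the leading coefficient of \<open>W\<^sub>y\<close>, the product of the values
  of \<open>g\<^sub>x\<close> at the roots of \<open>W\<^sub>y\<close> (\<open>D_rprod\<close>).  Hence \<open>D\<close> has degree \<open>3n - 2\<close> in \<open>u\<close>, with a constant
  multiple of \<open>y\<^sub>0\<^sup>n\<close> as leading coefficient.  On the Lie quadric the values of \<open>g\<^sub>x\<close> at the roots of
  \<open>W\<^sub>y\<close> show all their factors \<open>y\<^sub>0\<close> (\<open>F1_sigma\<close>).  It follows that \<open>F\<close> is a polynomial, and that for \<open>y\<^sub>0 = 0\<close>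
  it is a nonzero constant times \<open><y,y>\<^bsup>2n-2\<^esup>\<close> times the product of
  \<open><e(r),e(r)> <y,y> - <e(r),y>\<^sup>2\<close> over the roots \<open>r\<close> of \<open>e\<^sub>0\<close>; this does not vanish identically
  (\<open>F_at_y0_zero\<close>, \<open>F_nonzero\<close>), so that no smaller power of \<open>y\<^sub>0\<close> suffices.

  As to reducedness, solving \<open>g\<^sub>x = 0\<close> for \<open>u\<close> gives a rational function of \<open>t\<close>; the roots of \<open>W\<^sub>y\<close> are its
  critical points, and for generic \<open>y\<close> the roots of \<open>D\<close> in \<open>u\<close> are its critical values.  By the envelope principle the
  derivative of such a critical value with respect to \<open>y\<close> is the point of the spine curve at the critical
  point.  A small change of \<open>y\<close> therefore separates all critical values, provided that distinct critical
  points give distinct points of the spine curve (\<open>generic_distinct_critical_values\<close>).  For generic \<open>y\<close> they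
  do: if infinitely many parameters shared their point with another parameter, then by a limit argument infinitely
  many would also share the tangent, against the hypothesis on the Pluecker curve (\<open>finite_double_points\<close>,
  \<open>finite_bitangents\<close>).  So \<open>D\<close> is squarefree in \<open>u\<close> for generic \<open>y\<close>, and division with remainder in
  \<open>u\<close> shows that \<open>D\<close> generates the ideal of the dual variety (\<open>D_generates_ideal\<close>).

  As to the point set, a point of \<open>F = 0\<close> with \<open>y\<^sub>0\<close> nonzero is the projection of a point of the dual variety on the
  Lie quadric, and those with \<open>y\<^sub>0 = 0\<close> are limits of such points, so that the closure of the projection is all
  of \<open>F = 0\<close> (\<open>F_closure\<close>).
\<close>

no_notation vec_index (infixl "$" 100)
no_notation fps_nth (infixl "$" 75)

hide_const (open) Module.smult

section \<open>Polynomials as functions\<close>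

definition mono_eval :: "('v::finite \<Rightarrow>\<^sub>0 nat) \<Rightarrow> complex ^ 'v \<Rightarrow> complex" where
  "mono_eval m x = (\<Prod>i\<in>UNIV. (x $ i) ^ Poly_Mapping.lookup m i)"

lemma meval_superset:
  assumes "finite S" "Poly_Mapping.keys P \<subseteq> S"
  shows "meval P x = (\<Sum>m\<in>S. Poly_Mapping.lookup P m * mono_eval m x)"
  unfolding meval_def mono_eval_def
  by (rule sum.mono_neutral_left) (use assms in \<open>auto simp: in_keys_iff\<close>)

lemma meval_add: "meval (P + Q) x = meval P x + meval Q x"
proof -
  let ?S = "Poly_Mapping.keys P \<union> Poly_Mapping.keys Q"
  have "meval (P + Q) x = (\<Sum>m\<in>?S. Poly_Mapping.lookup (P + Q) m * mono_eval m x)"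
    by (rule meval_superset) (use Poly_Mapping.keys_add[of P Q] in auto)
  also have "\<dots> = (\<Sum>m\<in>?S. Poly_Mapping.lookup P m * mono_eval m x) +
      (\<Sum>m\<in>?S. Poly_Mapping.lookup Q m * mono_eval m x)"
    by (simp add: lookup_add distrib_right sum.distrib)
  also have "\<dots> = meval P x + meval Q x"
    by (subst (1 2) meval_superset[of ?S]) auto
  finally show ?thesis .
qed

lemma meval_0 [simp]: "meval 0 x = 0"
  by (simp add: meval_def)

lemma meval_single: "meval (Poly_Mapping.single m c) x = c * mono_eval m x"
  by (cases "c = 0") (auto simp: meval_def mono_eval_def)

lemma meval_sum: "meval (sum f A) x = (\<Sum>a\<in>A. meval (f a) x)"
  by (induction A rule: infinite_finite_induct) (auto simp: meval_add)

lemma mono_eval_add: "mono_eval (m + n) x = mono_eval m x * mono_eval n x"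
  by (simp add: mono_eval_def lookup_add power_add prod.distrib)

lemma mono_eval_0 [simp]: "mono_eval 0 x = 1"
  by (simp add: mono_eval_def)

lemma meval_mult: "meval (P * Q) x = meval P x * meval Q x"
proof -
  have 1: "P = (\<Sum>m\<in>Poly_Mapping.keys P. Poly_Mapping.single m (Poly_Mapping.lookup P m))" for P :: "'a mpoly"
    by (rule poly_mapping_eqI) (auto simp: lookup_sum lookup_single when_def in_keys_iff)
  have "P * Q = (\<Sum>m\<in>Poly_Mapping.keys P. \<Sum>n\<in>Poly_Mapping.keys Q.
     Poly_Mapping.single (m + n) (Poly_Mapping.lookup P m * Poly_Mapping.lookup Q n))"
    by (subst 1[of P], subst 1[of Q]) (simp add: sum_product mult_single)
  then show ?thesis
    by (simp add: meval_sum meval_single mono_eval_add)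
       (simp add: meval_def sum_product mono_eval_def mult_ac)
qed

text \<open>The arguments below multiply, divide and compare values of polynomials, so they use polynomial
  functions; \<open>meval_inject\<close> leads back to formal polynomials at the end.\<close>

definition polyfun :: "(complex ^ 'v::finite \<Rightarrow> complex) \<Rightarrow> bool" where
  "polyfun f \<longleftrightarrow> (\<exists>P. \<forall>x. f x = meval P x)"

lemma polyfun_meval [intro, simp]: "polyfun (meval P)"
  by (auto simp: polyfun_def)

lemma polyfun_const [intro, simp]: "polyfun (\<lambda>_. c)"
  unfolding polyfun_def by (rule exI[of _ "Poly_Mapping.single 0 c"]) (simp add: meval_single)

lemma polyfun_add [intro]: "polyfun f \<Longrightarrow> polyfun g \<Longrightarrow> polyfun (\<lambda>x. f x + g x)"
  unfolding polyfun_def by (auto simp: meval_add[symmetric])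

lemma polyfun_mult [intro]: "polyfun f \<Longrightarrow> polyfun g \<Longrightarrow> polyfun (\<lambda>x. f x * g x)"
  unfolding polyfun_def by (auto simp: meval_mult[symmetric])

lemma polyfun_nth [intro, simp]: "polyfun (\<lambda>x. x $ i)"
proof -
  have "mono_eval (Poly_Mapping.single i 1) x = x $ i" for x :: "complex ^ 'a"
  proof -
    have "mono_eval (Poly_Mapping.single i 1) x = (\<Prod>j\<in>UNIV. if i = j then x $ j else 1)"
      unfolding mono_eval_def by (intro prod.cong) (auto simp: lookup_single when_def)
    then show ?thesis by (simp add: prod.delta')
  qed
  then show ?thesis
    unfolding polyfun_def by (intro exI[of _ "Poly_Mapping.single (Poly_Mapping.single i 1) 1"])
      (simp add: meval_single)
qed

lemma polyfun_uminus [intro]: "polyfun f \<Longrightarrow> polyfun (\<lambda>x. - f x)"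
  using polyfun_mult[of "\<lambda>_. -1" f] by simp

lemma polyfun_diff [intro]: "polyfun f \<Longrightarrow> polyfun g \<Longrightarrow> polyfun (\<lambda>x. f x - g x)"
  using polyfun_add[of f "\<lambda>x. - g x"] polyfun_uminus[of g] by simp

lemma polyfun_sum [intro]: "(\<And>a. a \<in> A \<Longrightarrow> polyfun (f a)) \<Longrightarrow> polyfun (\<lambda>x. \<Sum>a\<in>A. f a x)"
  by (induction A rule: infinite_finite_induct) auto

lemma polyfun_prod [intro]: "(\<And>a. a \<in> A \<Longrightarrow> polyfun (f a)) \<Longrightarrow> polyfun (\<lambda>x. \<Prod>a\<in>A. f a x)"
  by (induction A rule: infinite_finite_induct) auto

lemma polyfun_power [intro]: "polyfun f \<Longrightarrow> polyfun (\<lambda>x. f x ^ n)"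
  by (induction n) auto

lemma polyfun_prod_mset [intro]: "(\<And>a. polyfun (f a)) \<Longrightarrow> polyfun (\<lambda>x. \<Prod>a\<in>#A. f a x)"
  by (induction A) auto

lemma polyfun_If [intro]: "polyfun f \<Longrightarrow> polyfun g \<Longrightarrow> polyfun (\<lambda>x. if b then f x else g x)"
  by (cases b) auto

lemmas polyfun_intros = polyfun_const polyfun_nth polyfun_add polyfun_mult polyfun_uminus polyfun_diff
  polyfun_sum polyfun_prod polyfun_power polyfun_prod_mset polyfun_If

lemma polyfun_induct [consumes 1, case_names const nth add mult]:
  assumes "polyfun f"
    and "\<And>c. Q (\<lambda>_. c)" "\<And>i. Q (\<lambda>x. x $ i)"
    and add: "\<And>f g. polyfun f \<Longrightarrow> polyfun g \<Longrightarrow> Q f \<Longrightarrow> Q g \<Longrightarrow> Q (\<lambda>x. f x + g x)"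
    and mult: "\<And>f g. polyfun f \<Longrightarrow> polyfun g \<Longrightarrow> Q f \<Longrightarrow> Q g \<Longrightarrow> Q (\<lambda>x. f x * g x)"
  shows "Q f"
proof -
  have pow: "Q (\<lambda>x. f x ^ n)" if "polyfun f" "Q f" for f n
    by (induction n) (auto intro!: assms(2) mult that)
  have prod: "Q (\<lambda>x. \<Prod>a\<in>A. f a x)" if "\<And>a. polyfun (f a)" "\<And>a. Q (f a)" for f :: "'b \<Rightarrow> _" and A
    by (induction A rule: infinite_finite_induct) (auto intro!: assms(2) mult that)
  have sum: "Q (\<lambda>x. \<Sum>a\<in>A. f a x)" if "\<And>a. polyfun (f a)" "\<And>a. Q (f a)" for f :: "'c \<Rightarrow> _" and A
    by (induction A rule: infinite_finite_induct) (auto intro!: assms(2) add that)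
  obtain P where P: "f = meval P"
    using assms(1) unfolding polyfun_def by blast
  have "Q (\<lambda>x. \<Sum>m \<in> Poly_Mapping.keys P.
     Poly_Mapping.lookup P m * (\<Prod>i\<in>UNIV. (x $ i) ^ Poly_Mapping.lookup m i))"
    by (intro sum polyfun_mult mult polyfun_const assms(2) polyfun_prod prod polyfun_power pow
        polyfun_nth assms(3))
  then show ?thesis unfolding P by (simp add: meval_def[abs_def])
qed

lemma polyfun_compose:
  assumes "polyfun f" "\<And>i. polyfun (\<lambda>y. h y $ i)"
  shows "polyfun (\<lambda>y. f (h y))"
  using assms(1) by (induction rule: polyfun_induct) (auto intro: assms(2))

lemma polyfun_line:
  assumes "polyfun f"
  shows "\<exists>p. \<forall>z. f (a + z *s b) = poly p z"
  using assms
proof (induction rule: polyfun_induct)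
  case (const c)
  show ?case by (rule exI[of _ "[:c:]"]) simp
next
  case (nth i)
  show ?case by (rule exI[of _ "[:a $ i, b $ i:]"]) simp
next
  case (add f g)
  then show ?case by (metis poly_add)
next
  case (mult f g)
  then show ?case by (metis poly_mult)
qed

lemma polyfun_continuous:
  assumes "polyfun f"
  shows "continuous_on UNIV f"
  using assms by (induction rule: polyfun_induct) (auto intro!: continuous_intros)

lemma polyfun_tendsto:
  assumes "polyfun f" "(h \<longlongrightarrow> a) F"
  shows "((\<lambda>x. f (h x)) \<longlongrightarrow> f a) F"
  using polyfun_continuous[OF assms(1)] assms(2)
  by (auto simp: continuous_on_eq_continuous_at intro: isCont_tendsto_compose)

text \<open>On the line through \<open>x\<close> and \<open>y\<close> both functions are nonzero polynomials in one variable.  This is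
  how "generic" is used throughout: finitely many nonzero polynomial functions
  are nonzero at a common point, and identities need to be checked only where such a function does
  not vanish.\<close>

lemma polyfun_no_zero_divisors:
  assumes "polyfun f" "polyfun g" "f x \<noteq> 0" "g y \<noteq> 0"
  shows "\<exists>z. f z \<noteq> 0 \<and> g z \<noteq> 0"
proof -
  obtain p where p: "\<And>z. f (x + z *s (y - x)) = poly p z" using polyfun_line[OF assms(1)] by blast
  obtain q where q: "\<And>z. g (x + z *s (y - x)) = poly q z" using polyfun_line[OF assms(2)] by blast
  have "poly p 0 \<noteq> 0" "poly q 1 \<noteq> 0"
    using p[of 0] q[of 1] assms(3,4) by auto
  then have "p * q \<noteq> 0" by auto
  then obtain z where "poly (p * q) z \<noteq> 0"
    using poly_all_0_iff_0 by blast
  then show ?thesis using p[of z] q[of z] by (metis mult_eq_0_iff poly_mult)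
qed

lemma polyfun_eq_generic:
  assumes "polyfun f" "polyfun g" "polyfun h" "h z \<noteq> 0" "\<And>x. h x \<noteq> 0 \<Longrightarrow> f x = g x"
  shows "f x = g x"
proof (rule ccontr)
  assume "f x \<noteq> g x"
  then obtain y where "f y - g y \<noteq> 0" "h y \<noteq> 0"
    using polyfun_no_zero_divisors[of "\<lambda>x. f x - g x" h x z] assms(1-4) by auto
  then show False using assms(5) by auto
qed

lemma polyfun_finite_prod_nonzero:
  assumes "finite A" "\<And>a. a \<in> A \<Longrightarrow> polyfun (f a)" "\<And>a. a \<in> A \<Longrightarrow> \<exists>x. f a x \<noteq> 0"
  shows "\<exists>x. \<forall>a\<in>A. f a x \<noteq> 0"
proof -
  have "\<exists>x. (\<Prod>a\<in>A. f a x) \<noteq> 0"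
    using assms
  proof (induction A rule: finite_induct)
    case (insert a A)
    then obtain x y where "f a x \<noteq> 0" "(\<Prod>a\<in>A. f a y) \<noteq> 0" by (meson insertCI)
    then obtain z where "f a z \<noteq> 0" "(\<Prod>a\<in>A. f a z) \<noteq> 0"
      using polyfun_no_zero_divisors[of "f a" "\<lambda>x. \<Prod>a\<in>A. f a x" x y] insert by auto
    then show ?case using insert by auto
  qed auto
  then show ?thesis using assms(1) by auto
qed

definition zero_at :: "'v \<Rightarrow> complex ^ 'v::finite \<Rightarrow> complex ^ 'v" where
  "zero_at i x = (\<chi> j. if j = i then 0 else x $ j)"

lemma zero_at_nth: "zero_at i x $ j = (if j = i then 0 else x $ j)"
  by (simp add: zero_at_def)

lemma zero_at_id: "x $ i = 0 \<Longrightarrow> zero_at i x = x"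
  by (auto simp: zero_at_def Finite_Cartesian_Product.vec_eq_iff)

lemma polyfun_zero_at: "polyfun f \<Longrightarrow> polyfun (\<lambda>x. f (zero_at i x))"
  unfolding zero_at_def by (rule polyfun_compose) (auto intro!: polyfun_intros)

lemma polyfun_split_coordinate:
  assumes "polyfun f"
  shows "\<exists>h. polyfun h \<and> (\<forall>x. f x = f (zero_at i x) + x $ i * h x)"
  using assms
proof (induction rule: polyfun_induct)
  case (const c)
  show ?case by (rule exI[of _ "\<lambda>_. 0"]) auto
next
  case (nth j)
  show ?case by (rule exI[of _ "\<lambda>_. if j = i then 1 else 0"]) (auto simp: zero_at_nth)
next
  case (add f g)
  then obtain h k where hk: "polyfun h" "polyfun k" and f: "\<And>x. f x = f (zero_at i x) + x $ i * h x"
    and g: "\<And>x. g x = g (zero_at i x) + x $ i * k x" by blast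
  have "f x + g x = f (zero_at i x) + g (zero_at i x) + x $ i * (h x + k x)" for x
  proof -
    have "f x + g x = (f (zero_at i x) + x $ i * h x) + (g (zero_at i x) + x $ i * k x)"
      by (rule arg_cong2[OF f g])
    also have "\<dots> = f (zero_at i x) + g (zero_at i x) + x $ i * (h x + k x)"
      by (simp add: distrib_left)
    finally show ?thesis .
  qed
  then show ?case
    by (intro exI[of _ "\<lambda>x. h x + k x"] conjI allI polyfun_intros hk)
next
  case (mult f g)
  then obtain h k where hk: "polyfun h" "polyfun k" and f: "\<And>x. f x = f (zero_at i x) + x $ i * h x"
    and g: "\<And>x. g x = g (zero_at i x) + x $ i * k x" by blast
  have "f x * g x = f (zero_at i x) * g (zero_at i x) +
     x $ i * (h x * g x + f (zero_at i x) * k x)" for x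
  proof -
    have "f x * g x = f (zero_at i x) * g x + x $ i * h x * g x"
      by (subst f) (rule distrib_right)
    also have "f (zero_at i x) * g x = f (zero_at i x) * g (zero_at i x) + f (zero_at i x) * (x $ i * k x)"
      by (subst g) (rule distrib_left)
    finally show ?thesis by (simp add: distrib_left mult_ac add_ac)
  qed
  then show ?case
    by (intro exI[of _ "\<lambda>x. h x * g x + f (zero_at i x) * k x"] conjI allI polyfun_intros
        hk mult(1,2) polyfun_zero_at[OF mult(1)])
qed

text \<open>Since \<open>a\<close> does not vanish identically on the hyperplane, the coordinate is
  coprime to \<open>a\<close> and all its powers must divide \<open>f\<close>.\<close>

lemma polyfun_divide_coordinate:
  assumes f: "polyfun f" and a: "polyfun a" and b: "polyfun b"
    and z: "a z \<noteq> 0" "z $ i = 0"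
    and eq: "\<And>x. f x * a x = (x $ i) ^ k * b x"
  shows "\<exists>h. polyfun h \<and> (\<forall>x. f x = (x $ i) ^ k * h x) \<and> (\<forall>x. h x * a x = b x)"
  using f b eq
proof (induction k arbitrary: f b)
  case 0
  then show ?case by (intro exI[of _ f]) auto
next
  case (Suc k)
  have "f (zero_at i x) = 0" for x
  proof (rule ccontr)
    assume "f (zero_at i x) \<noteq> 0"
    then obtain y where "f (zero_at i y) \<noteq> 0" "a (zero_at i y) \<noteq> 0"
      using polyfun_no_zero_divisors[OF polyfun_zero_at[OF Suc.prems(1)] polyfun_zero_at[OF a], of i x i z] z
      by (auto simp: zero_at_id)
    then show False using Suc.prems(3)[of "zero_at i y"] by (auto simp: zero_at_nth)
  qed
  then obtain h where h: "polyfun h" "\<And>x. f x = x $ i * h x"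
    using polyfun_split_coordinate[OF Suc.prems(1), of i] by auto
  have "h x * a x = (x $ i) ^ k * b x" for x
  proof (rule polyfun_eq_generic[where h = "\<lambda>x. x $ i" and z = "\<chi> i. 1"])
    show "polyfun (\<lambda>x. h x * a x)" "polyfun (\<lambda>x. (x $ i) ^ k * b x)"
      by (intro polyfun_intros h a Suc.prems(2))+
    fix x :: "complex ^ 'a" assume "x $ i \<noteq> 0"
    moreover have "x $ i * (h x * a x) = x $ i * ((x $ i) ^ k * b x)"
      using Suc.prems(3)[of x] h(2)[of x] by (simp add: mult_ac)
    ultimately show "h x * a x = (x $ i) ^ k * b x" by simp
  qed auto
  from Suc.IH[OF h(1) Suc.prems(2) this] obtain h' where
    h': "polyfun h'" "\<And>x. h x = (x $ i) ^ k * h' x" "\<And>x. h' x * a x = b x" by blast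
  then show ?case using h by (intro exI[of _ h']) (auto simp: mult_ac)
qed

lemma mono_eval_mult: "mono_eval m (\<chi> i. x $ i * y $ i) = mono_eval m x * mono_eval m y"
  by (simp add: mono_eval_def power_mult_distrib prod.distrib)

lemma mono_eval_separates:
  assumes "m \<noteq> n"
  shows "\<exists>x. mono_eval m x \<noteq> mono_eval n x"
proof -
  obtain i where i: "Poly_Mapping.lookup m i \<noteq> Poly_Mapping.lookup n i"
    using assms by (meson poly_mapping_eqI)
  have "mono_eval k (\<chi> j. if j = i then 2 else 1) = 2 ^ Poly_Mapping.lookup k i" for k
  proof -
    have "mono_eval k (\<chi> j. if j = i then 2 else 1) =
      (\<Prod>j\<in>UNIV. if j = i then 2 ^ Poly_Mapping.lookup k j else 1)"
      unfolding mono_eval_def by (intro prod.cong) auto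
    then show ?thesis by simp
  qed
  moreover have "(2::complex) ^ Poly_Mapping.lookup m i \<noteq> 2 ^ Poly_Mapping.lookup n i"
  proof
    assume "(2::complex) ^ Poly_Mapping.lookup m i = 2 ^ Poly_Mapping.lookup n i"
    then have "norm ((2::complex) ^ Poly_Mapping.lookup m i) = norm ((2::complex) ^ Poly_Mapping.lookup n i)"
      by simp
    then show False using i by (simp add: norm_power)
  qed
  ultimately show ?thesis by metis
qed

text \<open>Distinct monomials are distinct multiplicative characters; this is Dedekind's argument.\<close>

lemma mono_eval_independent:
  assumes "finite S" "\<And>x. (\<Sum>m\<in>S. c m * mono_eval m x) = 0" "m \<in> S"
  shows "c m = 0"
  using assms
proof (induction S arbitrary: c m rule: finite_induct)
  case (insert a S)
  have S0: "c b = 0" if b: "b \<in> S" for b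
  proof -
    have "a \<noteq> b" using b insert.hyps by auto
    then obtain z where z: "mono_eval a z \<noteq> mono_eval b z" using mono_eval_separates by blast
    have "(\<Sum>m\<in>S. (c m * (mono_eval m z - mono_eval a z)) * mono_eval m x) = 0" for x
    proof -
      have "(\<Sum>m\<in>insert a S. c m * mono_eval m (\<chi> i. z $ i * x $ i)) -
          mono_eval a z * (\<Sum>m\<in>insert a S. c m * mono_eval m x) = 0"
        by (simp only: insert.prems(1) mult_zero_right diff_self)
      then show ?thesis using insert.hyps
        by (simp add: mono_eval_mult algebra_simps sum_subtractf sum_distrib_left)
    qed
    then have "c b * (mono_eval b z - mono_eval a z) = 0"
      by (rule insert.IH) (rule b)
    then show ?thesis using z by auto
  qed
  moreover have "c a = 0"
    using insert.prems(1)[of "\<chi> i. 1"] insert.hyps S0 by (simp add: mono_eval_def)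
  ultimately show ?case using insert.prems(2) by auto
qed auto

lemma meval_inject:
  assumes "\<And>x. meval P x = meval Q x"
  shows "P = Q"
proof (rule poly_mapping_eqI)
  fix m
  let ?S = "insert m (Poly_Mapping.keys P \<union> Poly_Mapping.keys Q)"
  have "(\<Sum>m\<in>?S. (Poly_Mapping.lookup P m - Poly_Mapping.lookup Q m) * mono_eval m x) = 0" for x
  proof -
    have "(\<Sum>m\<in>?S. (Poly_Mapping.lookup P m - Poly_Mapping.lookup Q m) * mono_eval m x) = meval P x - meval Q x"
      by (subst (1 2) meval_superset[of ?S]) (auto simp: sum_subtractf left_diff_distrib)
    then show ?thesis using assms by simp
  qed
  from mono_eval_independent[OF _ this] show "Poly_Mapping.lookup P m = Poly_Mapping.lookup Q m" by auto
qed

lemma mpoly_nonzero_iff: "P \<noteq> 0 \<longleftrightarrow> (\<exists>x. meval P x \<noteq> 0)"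
  using meval_inject[of P 0] by auto

lemma mpoly_dvd_iff: "D dvd P \<longleftrightarrow> (\<exists>S. polyfun S \<and> (\<forall>x. meval P x = meval D x * S x))"
proof
  assume "D dvd P"
  then show "\<exists>S. polyfun S \<and> (\<forall>x. meval P x = meval D x * S x)"
    by (metis dvdE meval_mult polyfun_meval)
next
  assume "\<exists>S. polyfun S \<and> (\<forall>x. meval P x = meval D x * S x)"
  then obtain S where "\<And>x. meval P x = meval (D * S) x"
    unfolding polyfun_def by (metis meval_mult)
  then show "D dvd P" using meval_inject by (metis dvdI)
qed

text \<open>Comparing \<open>P(2x)\<close> with \<open>2\<^sup>d P(x)\<close>, the independence of monomials forces every monomial of \<open>P\<close>
  to have degree \<open>d\<close>.\<close>

lemma total_degree_homogeneous:
  assumes hom: "\<And>c x. meval P (c *s x) = c ^ d * meval P x" and P: "P \<noteq> 0"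
  shows "total_degree P = d"
proof -
  have "(\<Sum>i\<in>UNIV. Poly_Mapping.lookup m i) = d" if m: "m \<in> Poly_Mapping.keys P" for m
  proof -
    let ?s = "\<lambda>m. \<Sum>i\<in>UNIV. Poly_Mapping.lookup m i"
    have "(\<Sum>m\<in>Poly_Mapping.keys P. (Poly_Mapping.lookup P m * (2 ^ ?s m - 2 ^ d)) * mono_eval m x) = 0" for x
    proof -
      have "mono_eval m (2 *s x) = 2 ^ ?s m * mono_eval m x" for m
        by (simp add: mono_eval_def power_mult_distrib prod.distrib power_sum)
      then have "meval P (2 *s x) = (\<Sum>m\<in>Poly_Mapping.keys P. Poly_Mapping.lookup P m * 2 ^ ?s m * mono_eval m x)"
        by (subst meval_superset[of "Poly_Mapping.keys P"]) (auto simp: mult_ac)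
      moreover have "meval P x = (\<Sum>m\<in>Poly_Mapping.keys P. Poly_Mapping.lookup P m * mono_eval m x)"
        by (subst meval_superset[of "Poly_Mapping.keys P"]) auto
      ultimately show ?thesis using hom[of 2 x]
        by (simp add: algebra_simps sum_subtractf sum_distrib_left)
    qed
    from mono_eval_independent[OF _ this m] have "(2::complex) ^ ?s m = 2 ^ d"
      using m by (auto simp: in_keys_iff)
    then have "norm ((2::complex) ^ ?s m) = norm ((2::complex) ^ d)" by simp
    then show ?thesis by (simp add: norm_power)
  qed
  moreover have "Poly_Mapping.keys P \<noteq> {}" using P by simp
  ultimately have "(\<lambda>m. \<Sum>i\<in>UNIV. Poly_Mapping.lookup m i) ` Poly_Mapping.keys P = {d}"
    by (metis (no_types, lifting) image_cong image_constant_conv)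
  then show ?thesis unfolding total_degree_def by simp
qed

section \<open>Families of univariate polynomials\<close>

text \<open>Coefficientwise, so that no uniform bound on the degrees is built in; evaluation needs such a bound in addition
  (\<open>polyfam_poly\<close>).\<close>

definition polyfam :: "(complex ^ 'v::finite \<Rightarrow> complex poly) \<Rightarrow> bool" where
  "polyfam p \<longleftrightarrow> (\<forall>k. polyfun (\<lambda>y. coeff (p y) k))"

lemma polyfam_const [intro, simp]: "polyfam (\<lambda>_. p)"
  by (auto simp: polyfam_def)

lemma polyfam_add [intro]: "polyfam p \<Longrightarrow> polyfam q \<Longrightarrow> polyfam (\<lambda>y. p y + q y)"
  by (auto simp: polyfam_def)

lemma polyfam_diff [intro]: "polyfam p \<Longrightarrow> polyfam q \<Longrightarrow> polyfam (\<lambda>y. p y - q y)"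
  by (auto simp: polyfam_def)

lemma polyfam_mult [intro]: "polyfam p \<Longrightarrow> polyfam q \<Longrightarrow> polyfam (\<lambda>y. p y * q y)"
  unfolding polyfam_def coeff_mult by (intro allI polyfun_intros) auto

lemma polyfam_smult [intro]: "polyfun c \<Longrightarrow> polyfam q \<Longrightarrow> polyfam (\<lambda>y. smult (c y) (q y))"
  by (auto simp: polyfam_def)

lemma polyfam_pderiv [intro]: "polyfam p \<Longrightarrow> polyfam (\<lambda>y. pderiv (p y))"
  by (auto simp: polyfam_def coeff_pderiv)

lemma polyfam_power [intro]: "polyfam p \<Longrightarrow> polyfam (\<lambda>y. p y ^ n)"
  by (induction n) auto

lemma polyfam_coeff [intro]: "polyfam p \<Longrightarrow> polyfun (\<lambda>y. coeff (p y) k)"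
  by (auto simp: polyfam_def)

lemma poly_eq_sum:
  fixes p :: "'a::comm_semiring_1 poly"
  assumes "degree p \<le> K"
  shows "poly p x = (\<Sum>k\<le>K. coeff p k * x ^ k)"
proof -
  have "poly (\<Sum>k\<le>K. monom (coeff p k) k) x = (\<Sum>k\<le>K. coeff p k * x ^ k)"
    by (simp add: poly_sum poly_monom)
  then show ?thesis using poly_as_sum_of_monoms'[OF assms] by simp
qed

lemma polyfam_poly:
  assumes "polyfam p" "\<And>y. degree (p y) \<le> K" "polyfun c"
  shows "polyfun (\<lambda>y. poly (p y) (c y))"
proof -
  have "polyfun (\<lambda>y. \<Sum>k\<le>K. coeff (p y) k * c y ^ k)"
    using assms(1) by (intro polyfun_intros assms(3)) (auto simp: polyfam_def)
  then show ?thesis using poly_eq_sum[OF assms(2)] by simp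
qed

text \<open>A polynomial in \<open>(u, y)\<close> is a polynomial in \<open>u\<close> with coefficients in \<open>y\<close>.\<close>

lemma polyfun_expand_None:
  fixes f :: "complex ^ (5 option) \<Rightarrow> complex"
  assumes "polyfun f"
  shows "\<exists>p K. polyfam p \<and> (\<forall>y. degree (p y) \<le> K) \<and> (\<forall>x. f x = poly (p (Phi x)) (x $ None))"
  using assms
proof (induction rule: polyfun_induct)
  case (const c)
  show ?case by (rule exI[of _ "\<lambda>_. [:c:]"]) auto
next
  case (nth i)
  show ?case
  proof (cases i)
    case None
    then show ?thesis by (intro exI[of _ "\<lambda>_. [:0,1:]"] exI[of _ 1]) auto
  next
    case (Some j)
    have "polyfam (\<lambda>y. smult (y $ j) 1)" by (rule polyfam_smult) auto
    then show ?thesis using Some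
      by (intro exI[of _ "\<lambda>y. smult (y $ j) 1"] exI[of _ 0]) (auto simp: Phi_def)
  qed
next
  case (add f g)
  then obtain p K q L where "polyfam p" "\<And>y. degree (p y) \<le> K" "\<And>x. f x = poly (p (Phi x)) (x $ None)"
    "polyfam q" "\<And>y. degree (q y) \<le> L" "\<And>x. g x = poly (q (Phi x)) (x $ None)" by blast
  then show ?case
    by (intro exI[of _ "\<lambda>y. p y + q y"] exI[of _ "max K L"])
       (auto intro!: degree_add_le intro: max.coboundedI1 max.coboundedI2)
next
  case (mult f g)
  then obtain p K q L where "polyfam p" "\<And>y. degree (p y) \<le> K" "\<And>x. f x = poly (p (Phi x)) (x $ None)"
    "polyfam q" "\<And>y. degree (q y) \<le> L" "\<And>x. g x = poly (q (Phi x)) (x $ None)" by blast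
  then show ?case
    by (intro exI[of _ "\<lambda>y. p y * q y"] exI[of _ "K + L"])
       (auto intro: order.trans[OF degree_mult_le add_mono])
qed

section \<open>Resultants of complex polynomials\<close>

text \<open>The degrees are formal ones: \<open>d\<close> for \<open>f\<close> and \<open>m\<close> for \<open>g\<close>, so that the determinant is a polynomial
  in the coefficients also where the actual degrees drop.  The rows of \<open>g\<close> come first, which
  makes the product formula free of signs.\<close>

definition sylv :: "nat \<Rightarrow> nat \<Rightarrow> complex poly \<Rightarrow> complex poly \<Rightarrow> complex mat" where
  "sylv d m f g = Matrix.mat (d + m) (d + m) (\<lambda>(i, c).
     if i < d then coeff (monom 1 i * g) c else coeff (monom 1 (i - d) * f) c)"

definition res :: "nat \<Rightarrow> nat \<Rightarrow> complex poly \<Rightarrow> complex poly \<Rightarrow> complex" where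
  "res d m f g = Determinant.det (sylv d m f g)"

text \<open>Up to a power of the leading coefficient of \<open>f\<close> this is the resultant.  It is multiplicative in both
  arguments and depends on \<open>g\<close> only modulo \<open>f\<close>, which is what the computations need.\<close>

definition rprod :: "complex poly \<Rightarrow> complex poly \<Rightarrow> complex" where
  "rprod f g = (\<Prod>x\<in>#proots f. poly g x)"

subsection \<open>Products over roots\<close>

lemma rprod_mult_right: "rprod f (g * h) = rprod f g * rprod f h"
  by (simp add: rprod_def prod_mset.distrib)

lemma rprod_power_right: "rprod f (g ^ n) = rprod f g ^ n"
  by (induction n) (simp_all add: rprod_mult_right, simp add: rprod_def)

lemma rprod_mult_left: "f \<noteq> 0 \<Longrightarrow> h \<noteq> 0 \<Longrightarrow> rprod (f * h) g = rprod f g * rprod h g"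
  by (simp add: rprod_def proots_mult)

lemma rprod_const: "rprod f [:c:] = c ^ degree f"
  by (simp add: rprod_def size_proots_complex)

lemma rprod_smult_right: "rprod f (smult c g) = c ^ degree f * rprod f g"
  using rprod_mult_right[of f "[:c:]" g] by (simp add: rprod_const)

lemma rprod_smult_left: "c \<noteq> 0 \<Longrightarrow> rprod (smult c f) g = rprod f g"
  by (simp add: rprod_def)

lemma rprod_cong:
  assumes "f \<noteq> 0" "\<And>t. poly f t = 0 \<Longrightarrow> poly g t = poly h t"
  shows "rprod f g = rprod f h"
  unfolding rprod_def using assms by (intro arg_cong[of _ _ prod_mset] image_mset_cong) auto

lemma rprod_eq_0_iff:
  assumes "f \<noteq> 0"
  shows "rprod f g = 0 \<longleftrightarrow> (\<exists>t. poly f t = 0 \<and> poly g t = 0)"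
  unfolding rprod_def using assms by (auto simp: prod_mset_zero_iff image_iff)

lemma poly_eq_prod_roots: "poly (g :: complex poly) x = lead_coeff g * (\<Prod>b\<in>#proots g. x - b)"
proof -
  have "poly g x = poly (smult (lead_coeff g) (\<Prod>b\<in>#proots g. [:-b, 1:])) x"
    by (simp only: complex_poly_decompose_multiset)
  moreover have "poly (\<Prod>b\<in>#A. [:-b, 1:]) x = (\<Prod>b\<in>#A. x - b)" for A
    by (induction A) (auto simp: algebra_simps)
  ultimately show ?thesis by simp
qed

text \<open>Both sides are the product of all differences of a root of \<open>f\<close> and a root of \<open>g\<close>, up to sign.\<close>

lemma rprod_swap:
  "lead_coeff f ^ degree g * rprod f g = (- 1) ^ (degree f * degree g) * lead_coeff g ^ degree f * rprod g f"
proof -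
  have 1: "rprod f g = lead_coeff g ^ degree f * (\<Prod>x\<in>#proots f. \<Prod>b\<in>#proots g. x - b)" for f g
  proof -
    have "rprod f g = (\<Prod>x\<in>#proots f. lead_coeff g * (\<Prod>b\<in>#proots g. x - b))"
      unfolding rprod_def by (intro arg_cong[of _ _ prod_mset] image_mset_cong) (rule poly_eq_prod_roots)
    then show ?thesis by (simp add: prod_mset.distrib size_proots_complex)
  qed
  have "(\<Prod>x\<in>#proots f. \<Prod>b\<in>#proots g. x - b) = (\<Prod>b\<in>#proots g. \<Prod>x\<in>#proots f. x - b)"
    by (rule prod_mset.swap)
  also have "\<dots> = (\<Prod>b\<in>#proots g. \<Prod>x\<in>#proots f. - 1 * (b - x))" by simp
  also have "\<dots> = (- 1) ^ (degree f * degree g) * (\<Prod>b\<in>#proots g. \<Prod>x\<in>#proots f. b - x)"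
    by (subst prod_mset.distrib, subst prod_mset.distrib)
       (simp only: prod_mset_constant size_proots_complex power_mult)
  finally show ?thesis by (simp add: 1[of f g] 1[of g f])
qed

lemma card_roots_squarefree:
  fixes p :: "complex poly"
  assumes "p \<noteq> 0" "\<And>t. poly p t = 0 \<Longrightarrow> poly (pderiv p) t \<noteq> 0"
  shows "card {t. poly p t = 0} = degree p"
proof -
  have "order t p = 1" if "poly p t = 0" for t
  proof -
    have "order t p \<noteq> 0" using that assms(1) by (simp add: order_root)
    moreover have "order t (pderiv p) = 0" using assms(2)[OF that] by (simp add: order_0I)
    moreover have "pderiv p \<noteq> 0" using assms(2)[OF that] by auto
    ultimately show ?thesis using order_pderiv[OF assms(1) that] by simp
  qed
  then have "size (proots p) = (\<Sum>t\<in>{t. poly p t = 0}. 1)"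
    unfolding size_multiset_overloaded_eq using assms(1) by (intro sum.cong) auto
  then show ?thesis by (simp add: size_proots_complex)
qed

text \<open>The value at \<open>z\<close> is the leading coefficient times the product of the distances to the roots, and
  the nearest root has the least distance.\<close>

lemma near_root:
  fixes p :: "complex poly"
  assumes "degree p > 0"
  shows "\<exists>r. poly p r = 0 \<and> norm (lead_coeff p) * norm (r - z) ^ degree p \<le> norm (poly p z)"
proof -
  have "p \<noteq> 0" using assms by auto
  let ?R = "{t. poly p t = 0}"
  have fin: "finite ?R" using \<open>p \<noteq> 0\<close> by (rule poly_roots_finite)
  have ne: "?R \<noteq> {}"
    using assms fundamental_theorem_of_algebra[of p] by (auto simp: constant_degree)
  define r where "r = arg_min_on (\<lambda>t. norm (t - z)) ?R"
  have r: "poly p r = 0" "\<And>t. poly p t = 0 \<Longrightarrow> norm (r - z) \<le> norm (t - z)"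
    using arg_min_if_finite(1)[OF fin ne, of "\<lambda>t. norm (t - z)"]
      arg_min_least[OF fin ne, of _ "\<lambda>t. norm (t - z)"] by (auto simp: r_def)
  have "norm (r - z) ^ size A \<le> norm (\<Prod>b\<in>#A. z - b)" if "set_mset A \<subseteq> ?R" for A
    using that
  proof (induction A)
    case (add x A)
    then have "norm (r - z) * norm (r - z) ^ size A \<le> norm (z - x) * norm (\<Prod>b\<in>#A. z - b)"
      using r(2)[of x] by (intro mult_mono) (auto simp: norm_minus_commute)
    then show ?case by (simp add: norm_mult)
  qed auto
  from this[of "proots p"] have "norm (r - z) ^ degree p \<le> norm (\<Prod>b\<in>#proots p. z - b)"
    using \<open>p \<noteq> 0\<close> by (simp add: size_proots_complex)
  then show ?thesis using r(1)
    by (intro exI[of _ r]) (simp add: poly_eq_prod_roots[of p z] norm_mult mult_left_mono)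
qed

text \<open>Continuity of roots, in the only form needed: a root follows a polynomial whose degree stays fixed.\<close>

lemma root_tendsto:
  fixes p :: "'a \<Rightarrow> complex poly"
  assumes deg: "\<forall>\<^sub>F e in F. degree (p e) = d" and d: "d > 0"
    and lc: "((\<lambda>e. coeff (p e) d) \<longlongrightarrow> L) F" "L \<noteq> 0"
    and lim: "((\<lambda>e. poly (p e) z) \<longlongrightarrow> 0) F"
  shows "\<exists>r. (\<forall>\<^sub>F e in F. poly (p e) (r e) = 0) \<and> (r \<longlongrightarrow> z) F"
proof -
  define r where "r e = (SOME r. poly (p e) r = 0 \<and>
     norm (lead_coeff (p e)) * norm (r - z) ^ degree (p e) \<le> norm (poly (p e) z))" for e
  have ev: "\<forall>\<^sub>F e in F. poly (p e) (r e) = 0 \<and> norm (coeff (p e) d) * norm (r e - z) ^ d \<le> norm (poly (p e) z)"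
    using deg
  proof eventually_elim
    case (elim e)
    have "poly (p e) (r e) = 0 \<and>
      norm (lead_coeff (p e)) * norm (r e - z) ^ degree (p e) \<le> norm (poly (p e) z)"
      unfolding r_def by (rule someI_ex, rule near_root) (use elim d in auto)
    then show ?case using elim by simp
  qed
  have q: "((\<lambda>e. norm (poly (p e) z) / norm (coeff (p e) d)) \<longlongrightarrow> 0) F"
    using tendsto_divide[OF tendsto_norm[OF lim] tendsto_norm[OF lc(1)]] lc(2) by simp
  have "(r \<longlongrightarrow> z) F"
  proof (rule tendstoI)
    fix \<epsilon> :: real assume "\<epsilon> > 0"
    then have "\<forall>\<^sub>F e in F. norm (poly (p e) z) / norm (coeff (p e) d) < \<epsilon> ^ d"
      by (intro order_tendstoD(2)[OF q]) auto
    moreover have "\<forall>\<^sub>F e in F. coeff (p e) d \<noteq> 0"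
      using tendsto_imp_eventually_ne[OF lc(1,2)] .
    ultimately show "\<forall>\<^sub>F e in F. dist (r e) z < \<epsilon>"
      using ev
    proof eventually_elim
      case (elim e)
      then have "norm (r e - z) ^ d \<le> norm (poly (p e) z) / norm (coeff (p e) d)"
        by (simp add: field_simps)
      then have "norm (r e - z) ^ d < \<epsilon> ^ d" using elim by linarith
      then show ?case using \<open>\<epsilon> > 0\<close> by (simp add: dist_norm power_less_imp_less_base)
    qed
  qed
  then show ?thesis using ev by (intro exI[of _ r]) (auto elim: eventually_mono)
qed

subsection \<open>The Sylvester determinant\<close>

lemma sylv_carrier [simp]: "sylv d m f g \<in> carrier_mat (d + m) (d + m)"
  by (simp add: sylv_def)

lemma polyfun_det:
  assumes "\<And>y. A y \<in> carrier_mat n n" "\<And>i j. i < n \<Longrightarrow> j < n \<Longrightarrow> polyfun (\<lambda>y. A y $$ (i, j))"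
  shows "polyfun (\<lambda>y. Determinant.det (A y))"
proof -
  have "polyfun (\<lambda>y. \<Sum> p \<in> {p. p permutes {0 ..< n}}. signof p * (\<Prod> i = 0 ..< n. A y $$ (i, p i)))"
    by (intro polyfun_intros assms(2)) (auto simp: permutes_in_image)
  then show ?thesis by (simp add: det_def'[OF assms(1)])
qed

lemma polyfun_res:
  assumes "polyfam f" "polyfam g"
  shows "polyfun (\<lambda>y. res d m (f y) (g y))"
  unfolding res_def
proof (rule polyfun_det)
  fix i j assume "i < d + m" "j < d + m"
  then show "polyfun (\<lambda>y. sylv d m (f y) (g y) $$ (i, j))"
    using assms by (auto simp: sylv_def coeff_monom_mult polyfam_def intro!: polyfun_intros)
qed auto

lemma res_smult: "res d m (smult c f) (smult c g) = c ^ (d + m) * res d m f g"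
proof -
  have "sylv d m (smult c f) (smult c g) = c \<cdot>\<^sub>m sylv d m f g"
    by (rule eq_matI) (auto simp: sylv_def coeff_monom_mult)
  then show ?thesis by (simp add: res_def sylv_def)
qed

lemma det_tendsto:
  fixes A :: "'a \<Rightarrow> complex mat"
  assumes "\<And>y. A y \<in> carrier_mat n n" "B \<in> carrier_mat n n"
    "\<And>i j. i < n \<Longrightarrow> j < n \<Longrightarrow> ((\<lambda>y. A y $$ (i, j)) \<longlongrightarrow> B $$ (i, j)) F"
  shows "((\<lambda>y. Determinant.det (A y)) \<longlongrightarrow> Determinant.det B) F"
  unfolding det_def'[OF assms(1)] det_def'[OF assms(2)]
  by (intro tendsto_sum tendsto_mult tendsto_prod tendsto_const assms(3)) (auto simp: permutes_in_image)

lemma poly_eq_sum_less: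
  fixes p :: "'a::comm_semiring_1 poly"
  assumes "degree p < n"
  shows "poly p x = (\<Sum>k<n. coeff p k * x ^ k)"
  using poly_eq_sum[of p "n - 1" x] assms by (cases n) (auto simp: lessThan_Suc_atMost)

lemma degree_monom_mult_less:
  fixes g :: "complex poly"
  assumes "degree g \<le> m" "i < d"
  shows "degree (monom 1 i * g) < d + m"
  using degree_mult_le[of "monom 1 i" g] degree_monom_le[of "1::complex" i] assms by linarith

text \<open>Sylvester rows, evaluated at enough points, form a block triangular matrix as soon as the
  first points are the roots of \<open>f\<close>; comparing \<open>g\<close> with 1 avoids all Vandermonde determinants.\<close>

lemma res_distinct_roots:
  assumes f: "f = smult c (\<Prod>i<d. [:-a i, 1:])" and inj: "inj_on a {..<d}" and g: "degree g \<le> m"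
  shows "res d m f g = c ^ m * (\<Prod>i<d. poly g (a i))"
proof -
  have degp: "degree (\<Prod>i<d. [:-a i, 1:]) = d"
    by (subst degree_prod_eq_sum_degree) auto
  have "lead_coeff (\<Prod>i<d. [:-a i, 1:]) = 1"
    unfolding lead_coeff_prod by (rule prod.neutral) auto
  then have degf: "degree f \<le> d" and lcf: "coeff f d = c"
    using degp by (auto simp: f)
  have rootf: "poly f (a i) = 0" if "i < d" for i
    using that by (auto simp: f poly_prod)
  \<comment> \<open>\<open>m\<close> further points, to make the evaluation matrix \<open>V\<close> square and invertible\<close>
  have "infinite (UNIV - a ` {..<d} :: complex set)"
    by (intro Diff_infinite_finite) (auto simp: infinite_UNIV_char_0)
  then obtain b :: "nat \<Rightarrow> complex" where b: "inj b" "range b \<subseteq> UNIV - a ` {..<d}"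
    using infinite_countable_subset by blast
  define pt where "pt l = (if l < d then a l else b (l - d))" for l
  have inj_pt: "inj_on pt {..<d + m}"
  proof (rule inj_onI)
    fix k l assume "k \<in> {..<d + m}" "l \<in> {..<d + m}" "pt k = pt l"
    moreover have "a k \<noteq> b l" "b l \<noteq> a k" if "k < d" for k l
    proof -
      have "b l \<in> UNIV - a ` {..<d}" using b(2) by auto
      moreover have "a k \<in> a ` {..<d}" using that by simp
      ultimately show "a k \<noteq> b l" "b l \<noteq> a k" by auto
    qed
    ultimately show "k = l"
      using inj by (auto simp: pt_def inj_on_def split: if_splits dest!: injD[OF b(1)])
  qed
  define V where "V = Matrix.mat (d + m) (d + m) (\<lambda>(k, l). pt l ^ k)"
  define C where "C g = Matrix.mat d d (\<lambda>(i, l). a l ^ i * poly g (a l))" for g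
  define D where "D g = Matrix.mat d m (\<lambda>(i, l). b l ^ i * poly g (b l))" for g
  define B where "B = Matrix.mat m m (\<lambda>(i, l). b l ^ i * poly f (b l))"
  have V: "V \<in> carrier_mat (d + m) (d + m)" by (simp add: V_def)
  have detV: "Determinant.det V \<noteq> 0"
  proof
    assume "Determinant.det V = 0"
    then have "Determinant.det (transpose_mat V) = 0" using det_transpose[OF V] by simp
    then obtain v where v: "v \<in> carrier_vec (d + m)" "v \<noteq> 0\<^sub>v (d + m)"
      "transpose_mat V *\<^sub>v v = 0\<^sub>v (d + m)"
      using det_0_iff_vec_prod_zero[of "transpose_mat V" "d + m"] V by auto
    define p where "p = (\<Sum>k<d + m. monom (vec_index v k) k)"
    have cp: "coeff p k = (if k < d + m then vec_index v k else 0)" for k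
      by (simp add: p_def coeff_sum)
    have "poly p (pt l) = 0" if l: "l < d + m" for l
    proof -
      have "vec_index (transpose_mat V *\<^sub>v v) l = (\<Sum>k<d + m. pt l ^ k * vec_index v k)"
        using l v(1) V by (auto simp: scalar_prod_def V_def lessThan_atLeast0 intro!: sum.cong)
      then show ?thesis using v(3) l by (simp add: p_def poly_sum poly_monom mult.commute)
    qed
    then have "pt ` {..<d + m} \<subseteq> {x. poly p x = 0}" by auto
    moreover have "card (pt ` {..<d + m}) = d + m" using card_image[OF inj_pt] by simp
    moreover have pne: "p \<noteq> 0"
    proof
      assume "p = 0"
      then have "vec_index v k = 0" if "k < d + m" for k using cp[of k] that by simp
      then have "v = 0\<^sub>v (d + m)" using v(1) by (intro eq_vecI) auto
      then show False using v(2) by simp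
    qed
    ultimately have "d + m \<le> degree p"
      using card_poly_roots_bound[OF pne] card_mono[OF poly_roots_finite[OF pne]]
      by (metis le_trans)
    moreover have "coeff p (degree p) \<noteq> 0" using pne by simp
    ultimately show False using cp[of "degree p"] by simp
  qed
  have main: "res d m f g * Determinant.det V = (\<Prod>i<d. poly g (a i)) * (Determinant.det (C 1) * Determinant.det B)"
    if g: "degree g \<le> m" for g
  proof -
    have "sylv d m f g * V = four_block_mat (C g) (D g) (0\<^sub>m m d) B"
    proof (rule eq_matI)
      fix i l assume "i < dim_row (four_block_mat (C g) (D g) (0\<^sub>m m d) B)"
        "l < dim_col (four_block_mat (C g) (D g) (0\<^sub>m m d) B)"
      then have il: "i < d + m" "l < d + m" by (auto simp: C_def B_def)
      define h where "h = (if i < d then monom 1 i * g else monom 1 (i - d) * f)"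
      have "degree h < d + m"
        using degree_monom_mult_less[OF g, of i d] degree_monom_mult_less[OF degf, of "i - d" m] il
        by (cases "i < d") (simp_all add: h_def add.commute)
      have "(sylv d m f g * V) $$ (i, l) = (\<Sum>k<d + m. coeff h k * pt l ^ k)"
        using il by (auto simp: sylv_def V_def scalar_prod_def h_def lessThan_atLeast0 intro!: sum.cong)
      also have "\<dots> = poly h (pt l)"
        using poly_eq_sum_less[OF \<open>degree h < d + m\<close>] by simp
      also have "\<dots> = four_block_mat (C g) (D g) (0\<^sub>m m d) B $$ (i, l)"
        using il rootf by (auto simp: h_def pt_def C_def D_def B_def poly_monom)
      finally show "(sylv d m f g * V) $$ (i, l) = four_block_mat (C g) (D g) (0\<^sub>m m d) B $$ (i, l)" .
    qed (auto simp: sylv_def V_def C_def B_def)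
    then have "Determinant.det (sylv d m f g * V) = Determinant.det (C g) * Determinant.det B"
      by (simp, subst det_four_block_mat_lower_left_zero[of _ d _ m]) (auto simp: C_def D_def B_def)
    moreover have "Determinant.det (C g) = (\<Prod>i<d. poly g (a i)) * Determinant.det (C 1)"
    proof -
      have cc: "C h \<in> carrier_mat d d" for h by (simp add: C_def)
      have "(\<Prod>i = 0..<d. C g $$ (i, p i)) = (\<Prod>i<d. poly g (a i)) * (\<Prod>i = 0..<d. C 1 $$ (i, p i))"
        if p: "p permutes {0..<d}" for p
      proof -
        have "(\<Prod>i = 0..<d. C g $$ (i, p i)) = (\<Prod>i = 0..<d. poly g (a (p i)) * C 1 $$ (i, p i))"
          using p by (intro prod.cong) (auto simp: C_def permutes_in_image[OF p])
        also have "\<dots> = (\<Prod>i = 0..<d. poly g (a (p i))) * (\<Prod>i = 0..<d. C 1 $$ (i, p i))"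
          by (rule prod.distrib)
        also have "(\<Prod>i = 0..<d. poly g (a (p i))) = (\<Prod>i = 0..<d. poly g (a i))"
          using prod.permute[OF p, of "\<lambda>i. poly g (a i)"] by (simp add: o_def)
        finally show ?thesis by (simp add: lessThan_atLeast0)
      qed
      then show ?thesis
        unfolding det_def'[OF cc] by (simp add: sum_distrib_left mult_ac)
    qed
    ultimately show ?thesis
      using det_mult[OF sylv_carrier V, of f g] by (simp add: res_def)
  qed
  have "res d m f 1 = c ^ m"
  proof -
    have "Determinant.det (sylv d m f 1) = prod_list (diag_mat (sylv d m f 1))"
    proof (rule det_lower_triangular[of "d + m"])
      fix i j assume ij: "i < j" "j < d + m"
      then have "coeff f (j - (i - d)) = 0" if "\<not> i < d"
        using that by (intro coeff_eq_0) (use degf in linarith)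
      then show "sylv d m f 1 $$ (i, j) = 0"
        using ij by (auto simp: sylv_def coeff_monom_mult)
    qed auto
    also have "\<dots> = (\<Prod>i = 0..<d + m. sylv d m f 1 $$ (i, i))"
      by (simp add: prod_list_diag_prod sylv_def)
    also have "\<dots> = (\<Prod>i = 0..<d + m. if i < d then 1 else c)"
      by (intro prod.cong) (auto simp: sylv_def coeff_monom_mult lcf)
    also have "\<dots> = (\<Prod>i = 0..<d. if i < d then 1 else c) * (\<Prod>i = d..<d + m. if i < d then 1 else c)"
      by (rule prod.atLeastLessThan_concat[symmetric]) auto
    also have "\<dots> = c ^ m" by simp
    finally show ?thesis by (simp add: res_def)
  qed
  then have "Determinant.det (C 1) * Determinant.det B = c ^ m * Determinant.det V"
    using main[of 1] by simp
  then show ?thesis using main[OF g] detV by (simp add: mult_ac)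
qed

text \<open>Multiple roots are moved apart to \<open>a i + e * i\<close>; both sides are continuous in \<open>e\<close>.\<close>

lemma res_roots:
  assumes f: "f = smult c (\<Prod>i<d. [:-a i, 1:])" and g: "degree g \<le> m"
  shows "res d m f g = c ^ m * (\<Prod>i<d. poly g (a i))"
proof -
  define al where "al e i = a i + e * of_nat i" for e :: complex and i :: nat
  define fe where "fe e = smult c (\<Prod>i<d. [:-al e i, 1:])" for e
  have "\<forall>\<^sub>F e in at 0. inj_on (al e) {..<d}"
  proof -
    have "\<forall>\<^sub>F e in at 0. al e i \<noteq> al e j" if "i \<noteq> j" for i j
    proof -
      have "al e i \<noteq> al e j" if "e \<noteq> (a j - a i) / (of_nat i - of_nat j)" for e
        using that \<open>i \<noteq> j\<close> by (auto simp: al_def field_simps)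
      then have "eventually (\<lambda>e. e \<noteq> (a j - a i) / (of_nat i - of_nat j)) (at 0) \<Longrightarrow> ?thesis"
        by (auto elim!: eventually_mono)
      then show ?thesis using eventually_neq_at_within[of "(a j - a i) / (of_nat i - of_nat j)" 0 UNIV] by blast
    qed
    then have "\<forall>\<^sub>F e in at 0. \<forall>i\<in>{..<d}. \<forall>j\<in>{..<d}. i \<noteq> j \<longrightarrow> al e i \<noteq> al e j"
    proof (intro eventually_ball_finite ballI finite_lessThan)
      fix i j
      show "\<forall>\<^sub>F e in at 0. i \<noteq> j \<longrightarrow> al e i \<noteq> al e j"
        by (cases "i = j") (use \<open>\<And>i j. i \<noteq> j \<Longrightarrow> \<forall>\<^sub>F e in at 0. al e i \<noteq> al e j\<close> in auto)
    qed
    then show ?thesis by eventually_elim (auto simp: inj_on_def)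
  qed
  then have ev: "\<forall>\<^sub>F e in at 0. res d m (fe e) g = c ^ m * (\<Prod>i<d. poly g (al e i))"
    by eventually_elim (rule res_distinct_roots[OF _ _ g], simp_all add: fe_def)
  have al: "((\<lambda>e. al e i) \<longlongrightarrow> a i) (at 0)" for i
    unfolding al_def by (auto intro!: tendsto_eq_intros)
  have co: "((\<lambda>e. coeff (\<Prod>i<n. [:-al e i, 1:]) k) \<longlongrightarrow> coeff (\<Prod>i<n. [:-a i, 1:]) k) (at 0)" for n k
  proof (induction n arbitrary: k)
    case (Suc n)
    then show ?case
      by (cases k) (auto simp: mult_pCons_right intro!: tendsto_intros al)
  qed auto
  have "((\<lambda>e. res d m (fe e) g) \<longlongrightarrow> res d m f g) (at 0)"
    unfolding res_def
  proof (rule det_tendsto)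
    fix i j assume "i < d + m" "j < d + m"
    then show "((\<lambda>e. sylv d m (fe e) g $$ (i, j)) \<longlongrightarrow> sylv d m f g $$ (i, j)) (at 0)"
      by (auto simp: sylv_def coeff_monom_mult fe_def f intro!: tendsto_intros co)
  qed auto
  moreover have "((\<lambda>e. res d m (fe e) g) \<longlongrightarrow> c ^ m * (\<Prod>i<d. poly g (a i))) (at 0)"
    by (subst tendsto_cong[OF ev]) (intro tendsto_intros al)
  ultimately show ?thesis by (rule tendsto_unique[rotated]) simp
qed

lemma res_eq_rprod:
  assumes d: "degree f = d" and g: "degree g \<le> m" and "f \<noteq> 0"
  shows "res d m f g = lead_coeff f ^ m * rprod f g"
proof -
  obtain a where a: "smult (lead_coeff f) (\<Prod>i<d. [:-a i, 1:]) = f"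
    using complex_poly_decompose'[of f] d by auto
  have "rprod (\<Prod>i<n. [:-a i, 1:]) g = (\<Prod>i<n. poly g (a i))" for n
  proof (induction n)
    case (Suc n)
    have "(\<Prod>i<n. [:-a i, 1:]) \<noteq> 0" by auto
    then have "rprod (\<Prod>i<Suc n. [:-a i, 1:]) g = rprod (\<Prod>i<n. [:-a i, 1:]) g * rprod [:-a n, 1:] g"
      unfolding prod.lessThan_Suc by (intro rprod_mult_left) auto
    then show ?case using Suc by (simp add: rprod_def)
  qed (simp add: rprod_def)
  then have "rprod f g = (\<Prod>i<d. poly g (a i))"
    using rprod_smult_left[of "lead_coeff f" "\<Prod>i<d. [:-a i, 1:]" g] \<open>f \<noteq> 0\<close> by (subst a[symmetric]) (simp only: , simp)
  then show ?thesis using res_roots[OF a[symmetric] g] by simp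
qed

lemma coprime_complex_polyI:
  fixes f g :: "complex poly"
  assumes "\<And>z. poly f z = 0 \<Longrightarrow> poly g z \<noteq> 0"
  shows "coprime f g"
proof (rule coprimeI)
  fix h assume h: "h dvd f" "h dvd g"
  have "f \<noteq> 0 \<or> g \<noteq> 0" using assms[of 0] by auto
  then have "h \<noteq> 0" using h by auto
  moreover have "degree h = 0"
  proof (rule ccontr)
    assume "degree h \<noteq> 0"
    then obtain z where "poly h z = 0"
      using fundamental_theorem_of_algebra[of h] by (auto simp: constant_degree)
    then have "poly f z = 0" "poly g z = 0" using h by (auto elim!: dvdE)
    then show False using assms by auto
  qed
  ultimately show "is_unit h" by (simp add: is_unit_iff_degree)
qed

text \<open>The second alternative is a common zero at infinity.  A kernel vector of the transposed matrix is a
  relation \<open>a g + b f = 0\<close> with \<open>deg a < d\<close> and \<open>deg b < m\<close>, impossible for coprime forms;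
  conversely the powers of a common root, or the last unit vector, are in the kernel.\<close>

lemma res_eq_0_iff:
  assumes f: "degree f \<le> d" and g: "degree g \<le> m" and dm: "d + m > 0"
  shows "res d m f g = 0 \<longleftrightarrow> (\<exists>z. poly f z = 0 \<and> poly g z = 0) \<or> (coeff f d = 0 \<and> coeff g m = 0)"
proof
  define row where "row i = (if i < d then monom 1 i * g else monom 1 (i - d) * f)" for i
  have row: "sylv d m f g $$ (i, c) = coeff (row i) c" if "i < d + m" "c < d + m" for i c
    using that by (auto simp: sylv_def row_def)
  assume "res d m f g = 0"
  then have "Determinant.det (transpose_mat (sylv d m f g)) = 0"
    using det_transpose[OF sylv_carrier] by (simp add: res_def)
  then obtain v where v: "v \<in> carrier_vec (d + m)" "v \<noteq> 0\<^sub>v (d + m)"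
    "transpose_mat (sylv d m f g) *\<^sub>v v = 0\<^sub>v (d + m)"
    using det_0_iff_vec_prod_zero[of "transpose_mat (sylv d m f g)" "d + m"] by auto
  define a where "a = (\<Sum>i<d. monom (vec_index v i) i)"
  define b where "b = (\<Sum>i<m. monom (vec_index v (d + i)) i)"
  have ca: "coeff a k = (if k < d then vec_index v k else 0)" for k by (simp add: a_def coeff_sum)
  have cb: "coeff b k = (if k < m then vec_index v (d + k) else 0)" for k by (simp add: b_def coeff_sum)
  have da: "a = 0 \<or> degree a < d" using ca[of "degree a"] by (auto split: if_splits)
  have db: "b = 0 \<or> degree b < m" using cb[of "degree b"] by (auto split: if_splits)
  have ab: "a * g + b * f = 0"
  proof (rule poly_eqI)
    fix c
    show "coeff (a * g + b * f) c = coeff 0 c"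
    proof (cases "c < d + m")
      case True
      have "vec_index (transpose_mat (sylv d m f g) *\<^sub>v v) c = (\<Sum>i<d + m. coeff (row i) c * vec_index v i)"
        using True v(1) row by (auto simp: scalar_prod_def lessThan_atLeast0 sylv_def row_def intro!: sum.cong)
      then have "0 = (\<Sum>i\<in>{..<d + m}. coeff (row i) c * vec_index v i)" using v(3) True by simp
      also have "{..<d + m} = {..<d} \<union> (\<lambda>i. d + i) ` {..<m}"
        by (auto simp: image_iff) (metis add_diff_inverse_nat less_diff_conv2 linorder_not_less add.commute lessThan_iff)
      also have "(\<Sum>i\<in>{..<d} \<union> (\<lambda>i. d + i) ` {..<m}. coeff (row i) c * vec_index v i) =
        (\<Sum>i<d. coeff (row i) c * vec_index v i) + (\<Sum>i<m. coeff (row (d + i)) c * vec_index v (d + i))"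
        by (subst sum.union_disjoint) (auto simp: sum.reindex)
      also have "(\<Sum>i<d. coeff (row i) c * vec_index v i) = coeff (a * g) c"
        unfolding a_def sum_distrib_right coeff_sum
        by (intro sum.cong) (auto simp: row_def coeff_monom_mult)
      also have "(\<Sum>i<m. coeff (row (d + i)) c * vec_index v (d + i)) = coeff (b * f) c"
        unfolding b_def sum_distrib_right coeff_sum
        by (intro sum.cong) (auto simp: row_def coeff_monom_mult)
      finally show ?thesis by simp
    next
      case False
      have "coeff (a * g) c = 0"
        using da degree_mult_le[of a g] g False by (cases "a = 0") (auto intro!: coeff_eq_0)
      moreover have "coeff (b * f) c = 0"
        using db degree_mult_le[of b f] f False by (cases "b = 0") (auto intro!: coeff_eq_0)
      ultimately show ?thesis by simp
    qed
  qed
  show "(\<exists>z. poly f z = 0 \<and> poly g z = 0) \<or> (coeff f d = 0 \<and> coeff g m = 0)"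
  proof (rule ccontr)
    assume neg: "\<not> ?thesis"
    then have cop: "coprime f g" by (intro coprime_complex_polyI) auto
    have "a * g = f * (- b)" "b * f = g * (- a)" using ab by (simp_all add: algebra_simps eq_neg_iff_add_eq_0)
    then have "f dvd a * g" "g dvd b * f" by (metis dvd_triv_left)+
    then have fa: "f dvd a" and gb: "g dvd b" using cop by (simp_all add: coprime_dvd_mult_left_iff coprime_commute)
    have "a = 0 \<and> b = 0"
    proof (cases "coeff f d = 0")
      case False
      then have "degree f = d" using f le_degree[of f d] by auto
      then have "a = 0" using da dvd_imp_degree_le[OF fa] by (cases "a = 0") auto
      moreover have "f \<noteq> 0" using False by auto
      ultimately show ?thesis using ab by auto
    next
      case True
      then have nz: "coeff g m \<noteq> 0" using neg by auto
      then have "degree g = m" using g le_degree[of g m] by auto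
      then have "b = 0" using db dvd_imp_degree_le[OF gb] by (cases "b = 0") auto
      moreover have "g \<noteq> 0" using nz by auto
      ultimately show ?thesis using ab by auto
    qed
    then have "vec_index v i = 0" if "i < d + m" for i
    proof (cases "i < d")
      case False
      then have "i - d < m" "d + (i - d) = i" using that by auto
      then show ?thesis using cb[of "i - d"] \<open>a = 0 \<and> b = 0\<close> by simp
    qed (use ca[of i] \<open>a = 0 \<and> b = 0\<close> in simp)
    then have "v = 0\<^sub>v (d + m)" using v(1) by (intro eq_vecI) auto
    then show False using v(2) by simp
  qed
next
  define row where "row i = (if i < d then monom 1 i * g else monom 1 (i - d) * f)" for i
  have row: "sylv d m f g $$ (i, c) = coeff (row i) c" if "i < d + m" "c < d + m" for i c
    using that by (auto simp: sylv_def row_def)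
  have degrow: "degree (row i) < d + m" if "i < d + m" for i
    using degree_monom_mult_less[OF g, of i d] degree_monom_mult_less[OF f, of "i - d" m] that
    by (auto simp: row_def add.commute)
  assume "(\<exists>z. poly f z = 0 \<and> poly g z = 0) \<or> (coeff f d = 0 \<and> coeff g m = 0)"
  then have "\<exists>v. v \<in> carrier_vec (d + m) \<and> v \<noteq> 0\<^sub>v (d + m) \<and> sylv d m f g *\<^sub>v v = 0\<^sub>v (d + m)"
  proof (elim disjE exE conjE)
    fix z assume z: "poly f z = 0" "poly g z = 0"
    define v where "v = Matrix.vec (d + m) (\<lambda>k. z ^ k)"
    have "vec_index (sylv d m f g *\<^sub>v v) i = 0" if i: "i < d + m" for i
    proof -
      have "vec_index (sylv d m f g *\<^sub>v v) i = (\<Sum>k<d + m. coeff (row i) k * z ^ k)"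
        using i row by (auto simp: scalar_prod_def v_def lessThan_atLeast0 sylv_def row_def intro!: sum.cong)
      also have "\<dots> = poly (row i) z" using poly_eq_sum_less[OF degrow[OF i]] by simp
      also have "\<dots> = 0" using z by (simp add: row_def)
      finally show ?thesis .
    qed
    moreover have "v \<noteq> 0\<^sub>v (d + m)"
    proof
      assume "v = 0\<^sub>v (d + m)"
      then have "vec_index v 0 = 0" using dm by simp
      then show False using dm by (simp add: v_def)
    qed
    ultimately show ?thesis
      by (intro exI[of _ v]) (auto simp: v_def sylv_def)
  next
    assume z: "coeff f d = 0" "coeff g m = 0"
    define v where "v = (unit_vec (d + m) (d + m - 1) :: complex Matrix.vec)"
    have "vec_index (sylv d m f g *\<^sub>v v) i = 0" if i: "i < d + m" for i
    proof -
      have "vec_index (sylv d m f g *\<^sub>v v) i = sylv d m f g $$ (i, d + m - 1)"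
        using i dm by (simp add: v_def sylv_def)
      also have "\<dots> = coeff (row i) (d + m - 1)" using row i dm by simp
      also have "\<dots> = 0"
      proof (cases "i < d")
        case True
        then have "d + m - 1 - i = m \<or> d + m - 1 - i > m" by linarith
        then show ?thesis using True z(2) g by (elim disjE) (simp_all add: row_def coeff_monom_mult coeff_eq_0)
      next
        case False
        then have "d + m - 1 - (i - d) = d \<or> d + m - 1 - (i - d) > d" using i by linarith
        then show ?thesis using False z(1) f by (elim disjE) (simp_all add: row_def coeff_monom_mult coeff_eq_0)
      qed
      finally show ?thesis .
    qed
    moreover have "v \<noteq> 0\<^sub>v (d + m)"
    proof
      assume "v = 0\<^sub>v (d + m)"
      then have "vec_index v (d + m - 1) = 0" using dm by simp
      then show False using dm by (simp add: v_def)
    qed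
    ultimately show ?thesis
      by (intro exI[of _ v]) (auto simp: v_def sylv_def)
  qed
  then show "res d m f g = 0"
    unfolding res_def using det_0_iff_vec_prod_zero[OF sylv_carrier] by blast
qed

section \<open>Degrees and top coefficients\<close>

lemma coeff_mult_top:
  fixes p q :: "'a::comm_semiring_1 poly"
  assumes "degree p \<le> a" "degree q \<le> b"
  shows "coeff (p * q) (a + b) = coeff p a * coeff q b"
proof -
  have "coeff (p * q) (a + b) = (\<Sum>i\<le>a + b. coeff p i * coeff q (a + b - i))"
    by (rule coeff_mult)
  also have "\<dots> = (\<Sum>i\<in>{a}. coeff p i * coeff q (a + b - i))"
  proof (rule sum.mono_neutral_right)
    show "\<forall>i\<in>{..a + b} - {a}. coeff p i * coeff q (a + b - i) = 0"
    proof
      fix i assume "i \<in> {..a + b} - {a}"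
      then have "i > a \<or> a + b - i > b" by auto
      then have "coeff p i = 0 \<or> coeff q (a + b - i) = 0"
        using assms by (metis coeff_eq_0 order.strict_trans1)
      then show "coeff p i * coeff q (a + b - i) = 0" by auto
    qed
  qed auto
  finally show ?thesis by simp
qed

lemma degree_lorentz_le:
  fixes v w :: "'a::comm_ring_1 poly ^ 5"
  assumes "\<And>i. degree (v $ i) \<le> a" "\<And>i. degree (w $ i) \<le> b"
  shows "degree (lorentz v w) \<le> a + b"
  unfolding lorentz_def
  by (intro degree_add_le degree_diff_le order.trans[OF degree_mult_le] add_mono assms)

text \<open>The two terms of degree \<open>2n - 1\<close> cancel.\<close>

lemma degree_wronskian_le:
  fixes p q :: "'a::{idom,semiring_char_0} poly"
  assumes "degree p \<le> n" "degree q \<le> n" "n \<ge> 1"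
  shows "degree (pderiv p * q - p * pderiv q) \<le> 2 * n - 2"
proof (rule degree_le, intro allI impI)
  fix i assume i: "2 * n - 2 < i"
  have dp: "degree (pderiv p) \<le> n - 1" "degree (pderiv q) \<le> n - 1"
    using assms by (auto simp: degree_pderiv)
  have d: "degree (pderiv p * q) \<le> (n - 1) + n" "degree (p * pderiv q) \<le> n + (n - 1)"
    by (intro order.trans[OF degree_mult_le] add_mono dp assms)+
  show "coeff (pderiv p * q - p * pderiv q) i = 0"
  proof (cases "i = 2 * n - 1")
    case True
    then have i2: "i = (n - 1) + n" "i = n + (n - 1)" using assms(3) by auto
    have "coeff (pderiv p * q) i = coeff (pderiv p) (n - 1) * coeff q n"
      unfolding i2(1) by (rule coeff_mult_top[OF dp(1) assms(2)])
    moreover have "coeff (p * pderiv q) i = coeff p n * coeff (pderiv q) (n - 1)"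
      unfolding i2(2) by (rule coeff_mult_top[OF assms(1) dp(2)])
    ultimately show ?thesis using assms(3) by (simp add: coeff_pderiv)
  next
    case False
    then have "degree (pderiv p * q) < i" "degree (p * pderiv q) < i" using i d by linarith+
    then show ?thesis by (simp add: coeff_eq_0)
  qed
qed

lemma poly_eqI_cofinite:
  fixes p q :: "complex poly"
  assumes "\<And>u. u \<noteq> u0 \<Longrightarrow> poly p u = poly q u"
  shows "p = q"
proof -
  have "poly ([:-u0, 1:] * (p - q)) u = 0" for u
    using assms[of u] by (cases "u = u0") auto
  then have "[:-u0, 1:] * (p - q) = 0" using poly_all_0_iff_0 by blast
  then have "p - q = 0" by (simp only: mult_eq_0_iff pCons_eq_0_iff) simp
  then show ?thesis by simp
qed

lemma poly_eqI_poly: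
  fixes p q :: "complex poly"
  assumes "\<And>u. poly p u = poly q u"
  shows "p = q"
  using assms poly_eqI_cofinite by blast

lemma prod_linear_top:
  fixes a b :: "'b \<Rightarrow> complex"
  shows "degree (\<Prod>t\<in>#A. [:a t, b t:]) \<le> size A \<and> coeff (\<Prod>t\<in>#A. [:a t, b t:]) (size A) = (\<Prod>t\<in>#A. b t)"
proof (induction A)
  case (add x A)
  have "degree [:a x, b x:] \<le> 1" by simp
  moreover have "degree (\<Prod>t\<in>#A. [:a t, b t:]) \<le> size A" using add by blast
  ultimately show ?case
    using coeff_mult_top[of "[:a x, b x:]" 1 "\<Prod>t\<in>#A. [:a t, b t:]" "size A"]
      degree_mult_le[of "[:a x, b x:]" "\<Prod>t\<in>#A. [:a t, b t:]"] add by simp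
qed auto

section \<open>The discriminant of the tangency condition\<close>

definition wvec :: "complex poly ^ 5 \<Rightarrow> complex poly ^ 5" where
  "wvec e = (\<chi> j. pderiv (e $ j) * e $ 0 - e $ j * pderiv (e $ 0))"

text \<open>General type, apart from the condition on the Pluecker curve, in terms of zeros
  in the complex projective line.  Since \<open>e\<^sub>0\<close> has exact degree \<open>N\<close>, it does not vanish at infinity;
  this already settles the two conditions on \<open>e\<^sub>0\<close> at that parameter.\<close>

locale spine =
  fixes e :: "complex poly ^ 5" and N :: nat
  assumes N: "N \<ge> 1" and degree_e0: "degree (e $ 0) = N" and degree_e: "\<And>i. degree (e $ i) \<le> N"
    and e0_simple: "\<And>t. poly (e $ 0) t = 0 \<Longrightarrow> poly (pderiv (e $ 0)) t \<noteq> 0"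
    and e0_norm: "\<And>t. poly (e $ 0) t = 0 \<Longrightarrow> poly (lorentz e e) t \<noteq> 0"
    and immersed: "\<And>t. \<exists>j\<in>{1,2,3,4}. poly (wvec e $ j) t \<noteq> 0"
    and immersed_infinity: "\<exists>j\<in>{1,2,3,4}. coeff (wvec e $ j) (2 * N - 2) \<noteq> 0"
begin

abbreviation e0 :: "complex poly" where "e0 \<equiv> e $ 0"
abbreviation w :: "complex poly ^ 5" where "w \<equiv> wvec e"

text \<open>The Lorentz products of \<open>e\<close> and \<open>w\<close> with the constant vector \<open>y\<close>, expanded so that the linear dependence on
  \<open>y\<close> is visible.\<close>

definition lam :: "complex ^ 5 \<Rightarrow> complex poly" where
  "lam y = smult (y $ 1) (e $ 1) + smult (y $ 2) (e $ 2) + smult (y $ 3) (e $ 3) - smult (y $ 4) (e $ 4)"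

definition om :: "complex ^ 5 \<Rightarrow> complex poly" where
  "om y = smult (y $ 1) (w $ 1) + smult (y $ 2) (w $ 2) + smult (y $ 3) (w $ 3) - smult (y $ 4) (w $ 4)"

definition eta :: "complex poly" where "eta = lorentz e w"

definition gam :: "complex poly" where "gam = lorentz e e"

text \<open>The polynomial \<open>g' e\<^sub>0 - 2 g e\<^sub>0'\<close>, written so that its independence of \<open>u\<close> is visible
  (\<open>W_eq\<close>).\<close>

definition W :: "complex ^ 5 \<Rightarrow> complex poly" where
  "W y = e0 * om y - smult (y $ 0) eta"

definition g :: "complex ^ (5 option) \<Rightarrow> complex poly" where
  "g x = smult (- (x $ None) / 2) (e0\<^sup>2) + e0 * lam (Phi x) - smult (x $ Some 0 / 2) gam"

text \<open>At the roots of \<open>W\<close> one has \<open>e\<^sub>0 = y\<^sub>0 eta/om\<close>; substituting this in \<open>g\<close> on the Lie quadric gives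
  \<open>- y\<^sub>0 S/(2 om\<^sup>2)\<close>.\<close>

definition S :: "complex ^ 5 \<Rightarrow> complex poly" where
  "S y = smult (lorentz y y) (eta\<^sup>2) - smult 2 (lam y * eta * om y) + gam * (om y)\<^sup>2"

text \<open>The resultant of the two partial derivatives of the homogenization of \<open>g\<close>, after setting \<open>s = 1\<close>:
  the derivative with respect to \<open>s\<close> is \<open>2N g - t g'\<close> by Euler's relation.\<close>

definition D :: "complex ^ (5 option) \<Rightarrow> complex" where
  "D x = res (2 * N - 1) (2 * N - 1) (pderiv (g x))
     (smult (of_nat (2 * N)) (g x) - [:0, 1:] * pderiv (g x))"

lemma e0_nz: "e0 \<noteq> 0" using degree_e0 N by auto

lemma eta_at_root: "poly e0 t = 0 \<Longrightarrow> poly eta t = - poly gam t * poly (pderiv e0) t"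
  by (simp add: eta_def gam_def lorentz_def wvec_def algebra_simps)

lemma om_at_root: "poly e0 t = 0 \<Longrightarrow> poly (om y) t = - poly (lam y) t * poly (pderiv e0) t"
  by (simp add: om_def lam_def wvec_def algebra_simps)

lemma W_eq: "W (Phi x) = pderiv (g x) * e0 - smult 2 (g x * pderiv e0)"
proof (rule poly_eqI_poly)
  fix t
  obtain u v where "x $ None = 2 * u" "x $ Some 0 = 2 * v"
    using that[of "x $ None / 2" "x $ Some 0 / 2"] by simp
  then show "poly (W (Phi x)) t = poly (pderiv (g x) * e0 - smult 2 (g x * pderiv e0)) t"
    by (simp add: W_def g_def om_def lam_def eta_def gam_def lorentz_def wvec_def Phi_def
        pderiv_mult pderiv_add pderiv_diff pderiv_smult power2_eq_square ring_distribs)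
qed

lemma degree_w: "degree (w $ j) \<le> 2 * N - 2"
  unfolding wvec_def using degree_wronskian_le[OF degree_e[of j] degree_e[of 0] N] by simp

lemma degree_lam: "degree (lam y) \<le> N"
  unfolding lam_def by (intro degree_add_le degree_diff_le order.trans[OF degree_smult_le] degree_e)

lemma degree_om: "degree (om y) \<le> 2 * N - 2"
  unfolding om_def by (intro degree_add_le degree_diff_le order.trans[OF degree_smult_le] degree_w)

lemma degree_eta: "degree eta \<le> 3 * N - 2"
  unfolding eta_def using degree_lorentz_le[of e N w "2 * N - 2"] degree_e degree_w N by simp

lemma degree_gam: "degree gam \<le> 2 * N"
  unfolding gam_def using degree_lorentz_le[of e N e N] degree_e by simp

lemma degree_W: "degree (W y) \<le> 3 * N - 2"
proof -
  have "degree (e0 * om y) \<le> 3 * N - 2"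
    using degree_mult_le[of e0 "om y"] degree_e0 degree_om[of y] N by linarith
  then show ?thesis unfolding W_def
    by (intro degree_diff_le order.trans[OF degree_smult_le] degree_eta)
qed

lemma degree_g: "degree (g x) \<le> 2 * N"
proof -
  have "degree (e0\<^sup>2) \<le> 2 * N"
    using degree_e0 by (metis degree_power_le mult.commute order_refl)
  moreover have "degree (e0 * lam (Phi x)) \<le> 2 * N"
    using degree_mult_le[of e0 "lam (Phi x)"] degree_e0 degree_lam[of "Phi x"] by linarith
  ultimately show ?thesis unfolding g_def
    by (intro degree_add_le degree_diff_le order.trans[OF degree_smult_le] degree_gam) auto
qed

lemma degree_S: "degree (S y) \<le> 6 * N - 4"
proof -
  have e2: "degree (eta\<^sup>2) \<le> 6 * N - 4"
    using degree_power_le[of eta 2] degree_eta N by linarith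
  have "degree (lam y * eta * om y) \<le> 6 * N - 4"
    using degree_mult_le[of "lam y * eta" "om y"] degree_mult_le[of "lam y" eta]
      degree_lam[of y] degree_eta degree_om[of y] N by linarith
  moreover have "degree (gam * (om y)\<^sup>2) \<le> 6 * N - 4"
    using degree_mult_le[of gam "(om y)\<^sup>2"] degree_power_le[of "om y" 2] degree_gam degree_om[of y] N by linarith
  ultimately show ?thesis unfolding S_def
    by (intro degree_add_le degree_diff_le order.trans[OF degree_smult_le] e2)
qed

lemma coeff_W: "coeff (W y) (3 * N - 2) = coeff e0 N * coeff (om y) (2 * N - 2) - y $ 0 * coeff eta (3 * N - 2)"
proof -
  have "3 * N - 2 = N + (2 * N - 2)" using N by simp
  then have "coeff (e0 * om y) (3 * N - 2) = coeff e0 N * coeff (om y) (2 * N - 2)"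
    using coeff_mult_top[of e0 N "om y" "2 * N - 2"] degree_e0 degree_om by simp
  then show ?thesis by (simp add: W_def)
qed

lemma coeff_e0: "coeff e0 N \<noteq> 0"
  using e0_nz degree_e0 by (metis leading_coeff_0_iff)

lemma om_axis: "j \<in> {1,2,3,4} \<Longrightarrow> om (axis j 1) = w $ j \<or> om (axis j 1) = - (w $ j)"
  by (auto simp: om_def axis_def)

lemma axis_0: "j \<in> {1,2,3,4} \<Longrightarrow> (axis j 1 :: complex ^ 5) $ 0 = 0"
  by (auto simp: axis_def)

text \<open>Where \<open>e\<^sub>0\<close> does not vanish this is immersedness; at a root of \<open>e\<^sub>0\<close> one has
  \<open>w = - e e\<^sub>0'\<close>, hence \<open>eta = - gam e\<^sub>0'\<close>.\<close>

lemma W_base_point_free: "\<exists>y. poly (W y) t \<noteq> 0"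
proof (cases "poly e0 t = 0")
  case True
  have "om (axis 0 1) = 0" by (simp add: om_def axis_def)
  then have "poly (W (axis 0 1)) t = - poly eta t" by (simp add: W_def)
  then show ?thesis
    using eta_at_root[OF True] e0_norm[OF True] e0_simple[OF True]
    by (intro exI[of _ "axis 0 1"]) (simp add: gam_def)
next
  case False
  obtain j where j: "j \<in> {1,2,3,4}" "poly (w $ j) t \<noteq> 0" using immersed by blast
  then have "poly (W (axis j 1)) t \<noteq> 0"
    using om_axis[OF j(1)] axis_0[OF j(1)] False by (auto simp: W_def)
  then show ?thesis by blast
qed

lemma om_top_nonzero: "\<exists>y. y $ 0 = 0 \<and> coeff (om y) (2 * N - 2) \<noteq> 0"
proof -
  obtain j where j: "j \<in> {1,2,3,4}" "coeff (w $ j) (2 * N - 2) \<noteq> 0" using immersed_infinity by blast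
  then show ?thesis using om_axis[OF j(1)] axis_0[OF j(1)] by (intro exI[of _ "axis j 1"]) auto
qed

lemma W_top_nonzero: "\<exists>y. coeff (W y) (3 * N - 2) \<noteq> 0"
proof -
  obtain y where "y $ 0 = 0" "coeff (om y) (2 * N - 2) \<noteq> 0" using om_top_nonzero by blast
  then show ?thesis using coeff_e0 by (intro exI[of _ y]) (simp add: coeff_W)
qed

lemma polyfam_lam [intro]: "polyfam lam"
  unfolding lam_def by (intro polyfam_add polyfam_diff polyfam_smult polyfam_const polyfun_nth)

lemma polyfam_om [intro]: "polyfam om"
  unfolding om_def by (intro polyfam_add polyfam_diff polyfam_smult polyfam_const polyfun_nth)

lemma polyfam_W [intro]: "polyfam W"
  unfolding W_def by (intro polyfam_diff polyfam_mult polyfam_smult polyfam_const polyfun_nth polyfam_om)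

lemma polyfun_lorentz [intro]: "polyfun (\<lambda>y. lorentz y y)"
  unfolding lorentz_def by (intro polyfun_intros)

lemma polyfam_S [intro]: "polyfam S"
  unfolding S_def
  by (intro polyfam_add polyfam_diff polyfam_mult polyfam_smult polyfam_power polyfam_const polyfun_nth
      polyfam_om polyfam_lam polyfun_lorentz polyfun_const)

lemma polyfam_g [intro]: "polyfam g"
proof -
  have "polyfam (\<lambda>x. lam (Phi x))"
    unfolding lam_def Phi_def
    by (simp, intro polyfam_add polyfam_diff polyfam_smult polyfam_const polyfun_nth)
  moreover have "polyfun (\<lambda>x :: complex ^ (5 option). - (x $ None) / 2)" "polyfun (\<lambda>x :: complex ^ (5 option). x $ Some 0 / 2)"
    using polyfun_mult[OF polyfun_const[of "-1/2"] polyfun_nth[of None]]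
      polyfun_mult[OF polyfun_const[of "1/2"] polyfun_nth[of "Some 0"]] by simp_all
  ultimately show ?thesis
    unfolding g_def by (intro polyfam_add polyfam_diff polyfam_mult polyfam_smult polyfam_const)
qed

lemma polyfun_D [intro]: "polyfun D"
  unfolding D_def
  by (intro polyfun_res polyfam_diff polyfam_mult polyfam_smult polyfam_const polyfam_pderiv polyfam_g polyfun_const)

lemma g_scale: "g (c *s x) = smult c (g x)"
proof (rule poly_eqI_poly)
  fix t show "poly (g (c *s x)) t = poly (smult c (g x)) t"
    by (simp add: g_def Phi_def lam_def algebra_simps)
qed

lemma D_scale: "D (c *s x) = c ^ (4 * N - 2) * D x"
proof -
  have "smult (of_nat (2 * N)) (smult c (g x)) - [:0, 1:] * pderiv (smult c (g x)) =
     smult c (smult (of_nat (2 * N)) (g x) - [:0, 1:] * pderiv (g x))"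
    by (simp add: pderiv_smult smult_diff_right mult.commute)
  moreover have "(2 * N - 1) + (2 * N - 1) = 4 * N - 2" using N by simp
  ultimately show ?thesis
    unfolding D_def g_scale by (simp only: pderiv_smult res_smult)
qed

lemma coeff_euler:
  "coeff (smult (of_nat (2 * N)) (g x) - [:0, 1:] * pderiv (g x)) k = (of_nat (2 * N) - of_nat k) * coeff (g x) k"
  by (cases k) (simp_all add: coeff_pderiv algebra_simps)

lemma degree_euler: "degree (smult (of_nat (2 * N)) (g x) - [:0, 1:] * pderiv (g x)) \<le> 2 * N - 1"
proof (rule degree_le, intro allI impI)
  fix k assume "2 * N - 1 < k"
  then have "k = 2 * N \<or> k > degree (g x)" using degree_g[of x] by linarith
  then show "coeff (smult (of_nat (2 * N)) (g x) - [:0, 1:] * pderiv (g x)) k = 0"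
    unfolding coeff_euler by (auto simp: coeff_eq_0)
qed

lemma degree_pderiv_g: "degree (pderiv (g x)) \<le> 2 * N - 1"
  using degree_g[of x] by (simp add: degree_pderiv)

text \<open>The second alternative is a double root at infinity: the top coefficients of the two partial derivatives are
  multiples of the two top coefficients of \<open>g\<close>.\<close>

lemma D_eq_0_iff:
  "D x = 0 \<longleftrightarrow> (\<exists>t. poly (g x) t = 0 \<and> poly (pderiv (g x)) t = 0) \<or>
     (coeff (g x) (2 * N) = 0 \<and> coeff (g x) (2 * N - 1) = 0)"
proof -
  have 1: "coeff (pderiv (g x)) (2 * N - 1) = 0 \<longleftrightarrow> coeff (g x) (2 * N) = 0"
    using N by (simp add: coeff_pderiv)
  have 2: "coeff (smult (of_nat (2 * N)) (g x) - [:0, 1:] * pderiv (g x)) (2 * N - 1) = coeff (g x) (2 * N - 1)"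
    unfolding coeff_euler using N by (simp add: of_nat_diff)
  show ?thesis
    unfolding D_def using N
    by (subst res_eq_0_iff[OF degree_pderiv_g degree_euler]) (auto simp: 1[simplified] 2[simplified])
qed

definition disc_const :: complex where
  "disc_const = of_nat (2 * N) * coeff e0 N ^ (2 * N) * (- 1 / 2) ^ N * rprod e0 gam / of_nat (2 * N) ^ (2 * N - 1)"

lemma disc_const_nz: "disc_const \<noteq> 0"
proof -
  have "rprod e0 gam \<noteq> 0" using rprod_eq_0_iff[OF e0_nz] e0_norm by (auto simp: gam_def)
  then show ?thesis using N coeff_e0 by (simp add: disc_const_def)
qed

lemma rprod_e0_g: "rprod e0 (g x) = (- (x $ Some 0) / 2) ^ N * rprod e0 gam"
proof -
  have "rprod e0 (g x) = rprod e0 (smult (- (x $ Some 0) / 2) gam)"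
    by (rule rprod_cong[OF e0_nz]) (simp add: g_def)
  then show ?thesis by (simp only: rprod_smult_right degree_e0)
qed

lemma rprod_e0_W: "rprod e0 (W y) = (- (y $ 0)) ^ N * rprod e0 eta"
proof -
  have "rprod e0 (W y) = rprod e0 (smult (- (y $ 0)) eta)"
    by (rule rprod_cong[OF e0_nz]) (simp add: W_def)
  then show ?thesis by (simp only: rprod_smult_right degree_e0)
qed

text \<open>With products over roots in place of resultants, the chain is \<open>D \<sim> (g', g) \<sim> (g, g')\<close>,
  \<open>(g, g') (g, e\<^sub>0) = (g, g' e\<^sub>0) = (g, W) \<sim> (W, g)\<close> and \<open>(g, e\<^sub>0) \<sim> (e\<^sub>0, g) \<sim> y\<^sub>0\<^sup>N\<close>, the
  last one because \<open>g = - y\<^sub>0 gam/2\<close> at the roots of \<open>e\<^sub>0\<close>.  All powers of the leading coefficient of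
  \<open>g\<close> cancel, so that \<open>u\<close> occurs on the right-hand side only in the values of \<open>g\<close>.\<close>

lemma D_rprod_generic:
  assumes L: "coeff (g x) (2 * N) \<noteq> 0" and k: "coeff (W (Phi x)) (3 * N - 2) \<noteq> 0"
  shows "disc_const * (x $ Some 0) ^ N * D x = coeff (W (Phi x)) (3 * N - 2) ^ (2 * N) * rprod (W (Phi x)) (g x)"
proof -
  let ?g = "g x" and ?g' = "pderiv (g x)" and ?W = "W (Phi x)" and ?y0 = "x $ Some 0"
  define L where "L = coeff ?g (2 * N)"
  define \<kappa> where "\<kappa> = coeff ?W (3 * N - 2)"
  define M where "M = (of_nat (2 * N) :: complex)"
  have nz: "L \<noteq> 0" "\<kappa> \<noteq> 0" "M \<noteq> 0" using L k N by (auto simp: L_def \<kappa>_def M_def)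
  have dg: "degree ?g = 2 * N" using le_degree[OF L] degree_g[of x] by simp
  have dg': "degree ?g' = 2 * N - 1" by (simp add: degree_pderiv dg)
  have dW: "degree ?W = 3 * N - 2" using le_degree[OF k] degree_W[of "Phi x"] by simp
  have g'nz: "?g' \<noteq> 0" using dg N by (simp add: pderiv_eq_0_iff)
  have gnz: "?g \<noteq> 0" using L by auto
  have lcg': "coeff ?g' (2 * N - 1) = M * L"
    using N by (simp add: coeff_pderiv L_def M_def)
  have ev: "even ((2 * N - 1) * (2 * N))" "even (2 * N * N)" "even (2 * N * (3 * N - 2))" by auto
  have "D x = (M * L) ^ (2 * N - 1) * rprod ?g' (smult M ?g - [:0, 1:] * ?g')"
    unfolding D_def M_def[symmetric]
    using res_eq_rprod[OF dg' degree_euler g'nz] lcg' by (simp add: dg' M_def)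
  also have "rprod ?g' (smult M ?g - [:0, 1:] * ?g') = rprod ?g' (smult M ?g)"
    by (rule rprod_cong[OF g'nz]) simp
  finally have D: "D x = (M * L) ^ (2 * N - 1) * M ^ (2 * N - 1) * rprod ?g' ?g"
    by (simp add: rprod_smult_right dg')
  have s1: "(M * L) ^ (2 * N) * rprod ?g' ?g = L ^ (2 * N - 1) * rprod ?g ?g'"
    using rprod_swap[of ?g' ?g] ev by (simp only: dg dg' L_def[symmetric] lcg') simp
  have s2: "L ^ N * rprod ?g e0 = coeff e0 N ^ (2 * N) * rprod e0 ?g"
    using rprod_swap[of ?g e0] ev by (simp only: dg degree_e0 L_def[symmetric]) simp
  have s3: "L ^ (3 * N - 2) * rprod ?g ?W = \<kappa> ^ (2 * N) * rprod ?W ?g"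
    using rprod_swap[of ?g ?W] ev by (simp only: dg dW L_def[symmetric] \<kappa>_def[symmetric]) simp
  have "rprod ?g ?W = rprod ?g (?g' * e0)"
    by (rule rprod_cong[OF gnz]) (simp add: W_eq)
  then have s4: "rprod ?g ?W = rprod ?g ?g' * rprod ?g e0" by (simp add: rprod_mult_right)
  have p1: "L ^ (3 * N - 2) = L ^ (2 * N - 2) * L ^ N" using N by (simp add: power_add[symmetric])
  have p2: "L ^ (2 * N - 1) = L * L ^ (2 * N - 2)" using N by (cases N) simp_all
  have p3: "(M * L) ^ (2 * N) = (M * L) * (M * L) ^ (2 * N - 1)" using N by (cases N) simp_all
  have "L * (M * D x) = M ^ (2 * N - 1) * ((M * L) ^ (2 * N) * rprod ?g' ?g)"
    unfolding D p3 by simp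
  also have "\<dots> = L * (M ^ (2 * N - 1) * (L ^ (2 * N - 2) * rprod ?g ?g'))"
    unfolding s1 p2 by simp
  finally have MD: "M * D x = M ^ (2 * N - 1) * (L ^ (2 * N - 2) * rprod ?g ?g')" using nz by simp
  have "\<kappa> ^ (2 * N) * rprod ?W ?g = (L ^ (2 * N - 2) * rprod ?g ?g') * (L ^ N * rprod ?g e0)"
    unfolding s3[symmetric] s4 p1 by simp
  also have "L ^ (2 * N - 2) * rprod ?g ?g' = M * D x / M ^ (2 * N - 1)" using MD nz by simp
  also have "L ^ N * rprod ?g e0 = coeff e0 N ^ (2 * N) * ((- 1 / 2) ^ N * ?y0 ^ N * rprod e0 gam)"
    unfolding s2 rprod_e0_g by (simp add: power_mult_distrib[symmetric])
  finally show ?thesis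
    unfolding disc_const_def M_def[symmetric] \<kappa>_def[symmetric] by (simp add: mult_ac)
qed

end

section \<open>The discriminant as a polynomial in u, and the elimination of u\<close>

definition with_u :: "complex \<Rightarrow> complex ^ 5 \<Rightarrow> complex ^ (5 option)" where
  "with_u u y = (\<chi> k. case k of None \<Rightarrow> u | Some j \<Rightarrow> y $ j)"

lemma with_u_nth [simp]: "with_u u y $ None = u" "with_u u y $ Some j = y $ j"
  by (simp_all add: with_u_def)

lemma Phi_with_u [simp]: "Phi (with_u u y) = y"
  by (simp add: Phi_def with_u_def Finite_Cartesian_Product.vec_eq_iff)

lemma with_u_Phi: "with_u (x $ None) (Phi x) = x"
  by (auto simp: Phi_def with_u_def Finite_Cartesian_Product.vec_eq_iff split: option.split)

lemma with_u_scale: "with_u (c * u) (c *s y) = c *s with_u u y"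
  by (auto simp: with_u_def Finite_Cartesian_Product.vec_eq_iff split: option.split)

context spine
begin

text \<open>The discriminant as a polynomial in \<open>u\<close>.\<close>

definition Du :: "complex ^ 5 \<Rightarrow> complex poly" where
  "Du = (SOME p. polyfam p \<and> (\<forall>x. D x = poly (p (Phi x)) (x $ None)))"

lemma polyfam_Du [intro]: "polyfam Du" and D_Du: "D x = poly (Du (Phi x)) (x $ None)"
proof -
  have "\<exists>p. polyfam p \<and> (\<forall>x. D x = poly (p (Phi x)) (x $ None))"
    using polyfun_expand_None[OF polyfun_D] by blast
  then have "polyfam Du \<and> (\<forall>x. D x = poly (Du (Phi x)) (x $ None))"
    unfolding Du_def by (rule someI_ex)
  then show "polyfam Du" "D x = poly (Du (Phi x)) (x $ None)" by auto
qed

text \<open>The top coefficients; they do not vanish for generic \<open>y\<close>, and then \<open>W y\<close> and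
  \<open>om y\<close> have exact degree.\<close>

definition kap :: "complex ^ 5 \<Rightarrow> complex" where "kap y = coeff (W y) (3 * N - 2)"
definition kap' :: "complex ^ 5 \<Rightarrow> complex" where "kap' y = coeff (om y) (2 * N - 2)"

lemma polyfun_kap [intro]: "polyfun kap" and polyfun_kap' [intro]: "polyfun kap'"
  unfolding kap_def kap'_def by auto

lemma degree_W_exact: "kap y \<noteq> 0 \<Longrightarrow> degree (W y) = 3 * N - 2"
  using degree_W[of y] le_degree[of "W y" "3 * N - 2"] by (simp add: kap_def)

lemma degree_om_exact: "kap' y \<noteq> 0 \<Longrightarrow> degree (om y) = 2 * N - 2"
  using degree_om[of y] le_degree[of "om y" "2 * N - 2"] by (simp add: kap'_def)

lemma W_nz: "kap y \<noteq> 0 \<Longrightarrow> W y \<noteq> 0" by (auto simp: kap_def)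
lemma om_nz: "kap' y \<noteq> 0 \<Longrightarrow> om y \<noteq> 0" by (auto simp: kap'_def)

lemma g_with_u: "g (with_u u y) = g (with_u 0 y) + smult (- u / 2) (e0\<^sup>2)"
  by (simp add: g_def)

lemma poly_prod_g_roots:
  "poly (\<Prod>t\<in>#proots p. [:poly (g (with_u 0 y)) t, - (poly e0 t)\<^sup>2 / 2:]) u = rprod p (g (with_u u y))"
proof -
  have "poly (\<Prod>t\<in>#A. [:poly (g (with_u 0 y)) t, - (poly e0 t)\<^sup>2 / 2:]) u = (\<Prod>t\<in>#A. poly (g (with_u u y)) t)" for A
    by (induction A) (simp_all add: g_with_u[of u] left_diff_distrib)
  then show ?thesis by (simp add: rprod_def)
qed

text \<open>The product formula holds for all \<open>u\<close> except the one where \<open>g\<close> drops in degree; two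
  polynomials in \<open>u\<close> that agree there agree everywhere.\<close>

lemma Du_roots:
  assumes k: "kap y \<noteq> 0"
  shows "smult (disc_const * (y $ 0) ^ N) (Du y) =
    smult (kap y ^ (2 * N)) (\<Prod>t\<in>#proots (W y). [:poly (g (with_u 0 y)) t, - (poly e0 t)\<^sup>2 / 2:])"
proof (rule poly_eqI_cofinite)
  define L where "L = coeff (g (with_u 0 y)) (2 * N)"
  have "coeff (e0\<^sup>2) (2 * N) = (coeff e0 N)\<^sup>2"
    using coeff_mult_top[of e0 N e0 N] degree_e0 by (simp add: power2_eq_square mult_2)
  then have L: "coeff (g (with_u u y)) (2 * N) = L - u / 2 * (coeff e0 N)\<^sup>2" for u
    by (subst g_with_u) (simp add: L_def)
  fix u assume u: "u \<noteq> 2 * L / (coeff e0 N)\<^sup>2"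
  have "coeff (g (with_u u y)) (2 * N) \<noteq> 0"
  proof
    assume "coeff (g (with_u u y)) (2 * N) = 0"
    then have "u * (coeff e0 N)\<^sup>2 = 2 * L" unfolding L by (simp add: field_simps)
    then show False using u coeff_e0 by (simp add: field_simps)
  qed
  then have "disc_const * (y $ 0) ^ N * D (with_u u y) = kap y ^ (2 * N) * rprod (W y) (g (with_u u y))"
    using D_rprod_generic[of "with_u u y"] k by (simp add: kap_def)
  then show "poly (smult (disc_const * (y $ 0) ^ N) (Du y)) u =
    poly (smult (kap y ^ (2 * N)) (\<Prod>t\<in>#proots (W y). [:poly (g (with_u 0 y)) t, - (poly e0 t)\<^sup>2 / 2:])) u"
    unfolding poly_smult poly_prod_g_roots by (simp add: D_Du)
qed

lemma D_rprod:
  assumes k: "kap y \<noteq> 0"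
  shows "disc_const * (y $ 0) ^ N * D (with_u u y) = kap y ^ (2 * N) * rprod (W y) (g (with_u u y))"
  using arg_cong[OF Du_roots[OF k], of "\<lambda>p. poly p u"] by (simp only: poly_smult poly_prod_g_roots D_Du Phi_with_u with_u_nth)

lemma kap_y0_nonzero: "\<exists>y. kap y * y $ 0 \<noteq> 0"
proof -
  obtain x where "kap x \<noteq> 0" using W_top_nonzero by (auto simp: kap_def)
  then show ?thesis
    using polyfun_no_zero_divisors[OF polyfun_kap polyfun_nth[of 0], of x "axis 0 1"] by (auto simp: axis_def)
qed

definition lead_const :: complex where
  "lead_const = (- 1 / 2) ^ (3 * N - 2) * coeff e0 N ^ (2 * (3 * N - 2)) * (rprod e0 eta)\<^sup>2 / disc_const"

lemma rprod_e0_eta_nz: "rprod e0 eta \<noteq> 0"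
  using rprod_eq_0_iff[OF e0_nz, of eta] eta_at_root e0_norm e0_simple by (auto simp: gam_def)

lemma lead_const_nz: "lead_const \<noteq> 0"
  using disc_const_nz coeff_e0 rprod_e0_eta_nz by (simp add: lead_const_def)

lemma kap_rprod_W_e0:
  assumes k: "kap y \<noteq> 0"
  shows "(kap y ^ N * rprod (W y) e0)\<^sup>2 = coeff e0 N ^ (2 * (3 * N - 2)) * (y $ 0) ^ (2 * N) * (rprod e0 eta)\<^sup>2"
proof -
  have "kap y ^ N * rprod (W y) e0 = (- 1) ^ ((3 * N - 2) * N) * coeff e0 N ^ (3 * N - 2) * ((- (y $ 0)) ^ N * rprod e0 eta)"
    using rprod_swap[of "W y" e0] by (simp only: degree_W_exact[OF k] degree_e0 kap_def[symmetric] rprod_e0_W)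
  then show ?thesis
    by (simp add: power_mult_distrib power_mult[symmetric] mult.commute[of _ 2])
qed

lemma Du_coeffs_generic:
  assumes k: "kap y \<noteq> 0" "y $ 0 \<noteq> 0"
  shows "degree (Du y) \<le> 3 * N - 2 \<and> coeff (Du y) (3 * N - 2) = lead_const * (y $ 0) ^ N"
proof -
  let ?R = "\<Prod>t\<in>#proots (W y). [:poly (g (with_u 0 y)) t, - (poly e0 t)\<^sup>2 / 2:]"
  have R: "degree ?R \<le> 3 * N - 2" "coeff ?R (3 * N - 2) = (\<Prod>t\<in>#proots (W y). - (poly e0 t)\<^sup>2 / 2)"
    using prod_linear_top[of "\<lambda>t. poly (g (with_u 0 y)) t" "\<lambda>t. - (poly e0 t)\<^sup>2 / 2" "proots (W y)"]
    by (simp_all only: size_proots_complex degree_W_exact[OF k(1)])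
  have "(\<Prod>t\<in>#proots (W y). - (poly e0 t)\<^sup>2 / 2) = rprod (W y) (smult (- 1 / 2) (e0\<^sup>2))"
    unfolding rprod_def by (intro arg_cong[of _ _ prod_mset] image_mset_cong) simp
  also have "\<dots> = (- 1 / 2) ^ (3 * N - 2) * (rprod (W y) e0)\<^sup>2"
    by (simp only: rprod_smult_right rprod_power_right degree_W_exact[OF k(1)])
  finally have top: "coeff ?R (3 * N - 2) = (- 1 / 2) ^ (3 * N - 2) * (rprod (W y) e0)\<^sup>2"
    using R(2) by simp
  have nz: "disc_const * (y $ 0) ^ N \<noteq> 0" using disc_const_nz k by simp
  have "degree (Du y) = degree (smult (disc_const * (y $ 0) ^ N) (Du y))"
    using nz by (simp only: degree_smult_eq if_False)
  also have "\<dots> \<le> 3 * N - 2"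
    unfolding Du_roots[OF k(1)] by (rule order.trans[OF degree_smult_le R(1)])
  finally have "degree (Du y) \<le> 3 * N - 2" .
  moreover have "coeff (Du y) (3 * N - 2) = lead_const * (y $ 0) ^ N"
  proof -
    have "disc_const * (y $ 0) ^ N * coeff (Du y) (3 * N - 2) = kap y ^ (2 * N) * coeff ?R (3 * N - 2)"
      using arg_cong[OF Du_roots[OF k(1)], of "\<lambda>p. coeff p (3 * N - 2)"] by simp
    also have "\<dots> = (- 1 / 2) ^ (3 * N - 2) * (kap y ^ N * rprod (W y) e0)\<^sup>2"
      unfolding top by (simp add: power_mult_distrib power_mult[symmetric] mult.commute[of _ 2])
    also have "\<dots> = disc_const * (y $ 0) ^ N * (lead_const * (y $ 0) ^ N)"
      unfolding kap_rprod_W_e0[OF k(1)] lead_const_def using disc_const_nz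
      by (simp add: power_mult power2_eq_square power_mult_distrib mult_ac)
    finally show ?thesis using nz by (metis mult_left_cancel)
  qed
  ultimately show ?thesis by blast
qed

lemma coeff_Du_top: "coeff (Du y) (3 * N - 2) = lead_const * (y $ 0) ^ N"
proof -
  obtain z where z: "kap z * z $ 0 \<noteq> 0" using kap_y0_nonzero by blast
  show ?thesis
  proof (rule polyfun_eq_generic[where h = "\<lambda>y. kap y * y $ 0", OF _ _ _ z])
    show "polyfun (\<lambda>y. coeff (Du y) (3 * N - 2))" by auto
    show "polyfun (\<lambda>y. lead_const * (y $ 0) ^ N)" "polyfun (\<lambda>y. kap y * y $ 0)"
      by (intro polyfun_intros polyfun_kap)+
  qed (use Du_coeffs_generic in auto)
qed

lemma degree_Du: "degree (Du y) \<le> 3 * N - 2"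
proof (rule degree_le, intro allI impI)
  fix k assume k: "3 * N - 2 < k"
  obtain z where z: "kap z * z $ 0 \<noteq> 0" using kap_y0_nonzero by blast
  show "coeff (Du y) k = 0"
  proof (rule polyfun_eq_generic[where h = "\<lambda>y. kap y * y $ 0" and g = "\<lambda>_. 0", OF _ _ _ z])
    show "polyfun (\<lambda>y. coeff (Du y) k)" by auto
    show "polyfun (\<lambda>y. kap y * y $ 0)"
      by (intro polyfun_intros polyfun_kap)
    fix x assume "kap x * x $ 0 \<noteq> 0"
    then have "degree (Du x) < k" using Du_coeffs_generic[of x] k by auto
    then show "coeff (Du x) k = 0" by (rule coeff_eq_0)
  qed auto
qed

text \<open>The discriminant with \<open>u = <y, y>/y\<^sub>0\<close>, with the denominator cleared by the full power of \<open>y\<^sub>0\<close>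
  that the degree in \<open>u\<close> suggests; this is too much by exactly \<open>y\<^sub>0\<^sup>N\<close>.\<close>

definition F1 :: "complex ^ 5 \<Rightarrow> complex" where
  "F1 y = (\<Sum>k\<le>3 * N - 2. coeff (Du y) k * (lorentz y y) ^ k * (y $ 0) ^ (3 * N - 2 - k))"

definition lift :: "complex ^ 5 \<Rightarrow> complex ^ (5 option)" where
  "lift y = with_u (lorentz y y / y $ 0) y"

lemma F1_D:
  assumes "y $ 0 \<noteq> 0"
  shows "F1 y = (y $ 0) ^ (3 * N - 2) * D (lift y)"
proof -
  have "D (lift y) = (\<Sum>k\<le>3 * N - 2. coeff (Du y) k * (lorentz y y / y $ 0) ^ k)"
    unfolding D_Du lift_def using poly_eq_sum[OF degree_Du] by simp
  then show ?thesis
    unfolding F1_def sum_distrib_left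
  proof (simp only: sum_distrib_left, intro sum.cong refl)
    fix k assume "k \<in> {..3 * N - 2}"
    then have "(y $ 0) ^ (3 * N - 2) = (y $ 0) ^ (3 * N - 2 - k) * (y $ 0) ^ k"
      by (simp only: power_add[symmetric] le_add_diff_inverse2 atMost_iff)
    then show "coeff (Du y) k * lorentz y y ^ k * (y $ 0) ^ (3 * N - 2 - k) =
        (y $ 0) ^ (3 * N - 2) * (coeff (Du y) k * (lorentz y y / y $ 0) ^ k)"
      using assms by (simp only: power_divide) simp
  qed
qed

lemma polyfun_F1 [intro]: "polyfun F1"
  unfolding F1_def by (intro polyfun_intros polyfun_lorentz polyfam_coeff polyfam_Du)

definition rho :: "complex ^ 5 \<Rightarrow> complex" where
  "rho y = res (2 * N - 2) (3 * N - 2) (om y) eta"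

definition sigma :: "complex ^ 5 \<Rightarrow> complex" where
  "sigma y = res (3 * N - 2) (6 * N - 4) (W y) (S y)"

lemma polyfun_rho [intro]: "polyfun rho"
  unfolding rho_def by (intro polyfun_res polyfam_om polyfam_const)

lemma polyfun_sigma [intro]: "polyfun sigma"
  unfolding sigma_def by (intro polyfun_res polyfam_W polyfam_S)

lemma rho_eq: "kap' y \<noteq> 0 \<Longrightarrow> rho y = kap' y ^ (3 * N - 2) * rprod (om y) eta"
  unfolding rho_def
  using res_eq_rprod[OF degree_om_exact degree_eta om_nz] by (simp add: degree_om_exact kap'_def)

lemma sigma_eq: "kap y \<noteq> 0 \<Longrightarrow> sigma y = kap y ^ (6 * N - 4) * rprod (W y) (S y)"
  unfolding sigma_def
  using res_eq_rprod[OF degree_W_exact degree_S W_nz] by (simp add: degree_W_exact kap_def)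

text \<open>By \<open>D_rprod\<close> this is a computation of the product of \<open>g\<close> over the roots of \<open>W\<close>, where
  \<open>om\<^sup>2 g = - y\<^sub>0 S/2\<close>.  The product of \<open>om\<close> over the roots of \<open>W\<close> is, by symmetry, that of
  \<open>W = - y\<^sub>0 eta\<close> over the roots of \<open>om\<close>, hence a power of \<open>y\<^sub>0\<close> times \<open>rho\<close>.\<close>

lemma F1_sigma_generic:
  assumes y0: "y $ 0 \<noteq> 0" and k: "kap y \<noteq> 0" and k': "kap' y \<noteq> 0"
  shows "F1 y * (rho y)\<^sup>2 = (y $ 0) ^ N * ((- 1 / 2) ^ (3 * N - 2) / disc_const * sigma y)"
proof -
  let ?y0 = "y $ 0" and ?W = "W y" and ?g = "g (lift y)" and ?c = "(- 1 / 2 :: complex) ^ (3 * N - 2)"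
  have Phi: "Phi (lift y) = y" by (simp add: lift_def)
  have "rprod ?W ((om y)\<^sup>2 * ?g) = rprod ?W (smult (- ?y0 / 2) (S y))"
  proof (rule rprod_cong[OF W_nz[OF k]])
    fix t assume "poly ?W t = 0"
    then have eq: "poly e0 t * poly (om y) t = ?y0 * poly eta t" by (simp add: W_def)
    obtain v where v: "lorentz y y = ?y0 * v" using y0 by (metis nonzero_mult_div_cancel_left times_divide_eq_right)
    have "2 * ((poly (om y) t)\<^sup>2 * poly ?g t) = - (poly (om y) t)\<^sup>2 * (v * (poly e0 t)\<^sup>2 - 2 * poly e0 t * poly (lam y) t + ?y0 * poly gam t)"
      unfolding g_def Phi using v y0 by (simp add: lift_def algebra_simps)
    also have "\<dots> = - (v * (poly e0 t * poly (om y) t)\<^sup>2 - 2 * (poly e0 t * poly (om y) t) * poly (om y) t * poly (lam y) t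
        + ?y0 * poly gam t * (poly (om y) t)\<^sup>2)"
      by (simp add: algebra_simps power2_eq_square)
    also have "\<dots> = - ?y0 * poly (S y) t"
      unfolding eq by (simp add: S_def v algebra_simps power2_eq_square)
    finally have "(poly (om y) t)\<^sup>2 * poly ?g t = (- ?y0 * poly (S y) t) / 2"
      by (metis nonzero_mult_div_cancel_left zero_neq_numeral)
    then show "poly ((om y)\<^sup>2 * ?g) t = poly (smult (- ?y0 / 2) (S y)) t" by simp
  qed
  then have A: "(rprod ?W (om y))\<^sup>2 * rprod ?W ?g = (- ?y0 / 2) ^ (3 * N - 2) * rprod ?W (S y)"
    by (simp only: rprod_mult_right rprod_power_right rprod_smult_right degree_W_exact[OF k])
  have "rprod (om y) ?W = rprod (om y) (smult (- ?y0) eta)"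
    by (rule rprod_cong[OF om_nz[OF k']]) (simp add: W_def)
  then have omW: "rprod (om y) ?W = (- ?y0) ^ (2 * N - 2) * rprod (om y) eta"
    by (simp only: rprod_smult_right degree_om_exact[OF k'])
  have "kap y ^ (2 * N - 2) * rprod ?W (om y) = (- 1) ^ ((3 * N - 2) * (2 * N - 2)) * kap' y ^ (3 * N - 2) * ((- ?y0) ^ (2 * N - 2) * rprod (om y) eta)"
    using rprod_swap[of ?W "om y"]
    by (simp only: degree_W_exact[OF k] degree_om_exact[OF k'] kap_def[symmetric] kap'_def[symmetric] omW)
  moreover have "even ((3 * N - 2) * (2 * N - 2))" "even (2 * N - 2)" by auto
  ultimately have B: "kap y ^ (2 * N - 2) * rprod ?W (om y) = ?y0 ^ (2 * N - 2) * rho y"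
    unfolding rho_eq[OF k'] by simp
  have "disc_const * ?y0 ^ N * D (lift y) * (?y0 ^ (2 * N - 2) * rho y)\<^sup>2 =
      kap y ^ (2 * N) * rprod ?W ?g * (kap y ^ (2 * N - 2) * rprod ?W (om y))\<^sup>2"
    unfolding B lift_def using D_rprod[OF k] by simp
  also have "\<dots> = (kap y ^ (2 * N) * (kap y ^ (2 * N - 2))\<^sup>2) * ((rprod ?W (om y))\<^sup>2 * rprod ?W ?g)"
    by (simp add: power_mult_distrib mult_ac)
  also have "kap y ^ (2 * N) * (kap y ^ (2 * N - 2))\<^sup>2 = kap y ^ (6 * N - 4)"
    using N by (simp add: power_mult[symmetric] power_add[symmetric] algebra_simps)
  also have "\<dots> * ((rprod ?W (om y))\<^sup>2 * rprod ?W ?g) = (- ?y0 / 2) ^ (3 * N - 2) * sigma y"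
    unfolding A sigma_eq[OF k] by simp
  also have "(- ?y0 / 2) ^ (3 * N - 2) = ?c * ?y0 ^ (3 * N - 2)"
    by (simp add: power_mult_distrib[symmetric])
  finally have "(?y0 ^ (3 * N - 2) * ?y0 ^ (N + 2 * (2 * N - 2))) * (disc_const * D (lift y) * (rho y)\<^sup>2) =
     ?y0 ^ (3 * N - 2) * (?c * ?y0 ^ (3 * N - 2) * sigma y)"
    by (simp add: power_add power_mult_distrib power_mult[symmetric] mult_ac)
  then have E: "?y0 ^ (N + 2 * (2 * N - 2)) * (disc_const * F1 y * (rho y)\<^sup>2) =
     ?y0 ^ (3 * N - 2) * (?y0 ^ (3 * N - 2) * (?c * sigma y))"
    unfolding F1_D[OF y0] by (simp add: mult_ac)
  have "?y0 ^ (3 * N - 2) * (?y0 ^ (3 * N - 2) * (?c * sigma y)) = ?y0 ^ (N + 2 * (2 * N - 2)) * (?y0 ^ N * (?c * sigma y))"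
  proof -
    have "(3 * N - 2) + (3 * N - 2) = (N + 2 * (2 * N - 2)) + N" using N by simp
    then have "?y0 ^ (3 * N - 2) * ?y0 ^ (3 * N - 2) = ?y0 ^ (N + 2 * (2 * N - 2)) * ?y0 ^ N"
      by (simp only: power_add[symmetric])
    then show ?thesis by (simp only: mult.assoc[symmetric])
  qed
  with E have "?y0 ^ (N + 2 * (2 * N - 2)) * (disc_const * F1 y * (rho y)\<^sup>2) = ?y0 ^ (N + 2 * (2 * N - 2)) * (?y0 ^ N * (?c * sigma y))"
    by simp
  then have "disc_const * F1 y * (rho y)\<^sup>2 = ?y0 ^ N * (?c * sigma y)"
    using y0 by simp
  then show ?thesis using disc_const_nz by (simp add: field_simps)
qed

lemma om_zero_at [simp]: "om (zero_at 0 y) = om y"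
  by (simp add: om_def zero_at_nth)

lemma eta_nz: "eta \<noteq> 0"
proof -
  have "\<not> constant (poly e0)" using degree_e0 N constant_degree[of e0] by auto
  then obtain t where "poly e0 t = 0" using fundamental_theorem_of_algebra by blast
  then have "poly eta t \<noteq> 0" using eta_at_root e0_norm e0_simple by (auto simp: gam_def)
  then show ?thesis by auto
qed

text \<open>As \<open>rho\<close> does not involve \<open>y\<^sub>0\<close>, it is coprime to \<open>y\<^sub>0\<close> once it is nonzero somewhere; for that \<open>y\<close> has to be
  chosen such that \<open>om y\<close> is nonzero at the finitely many roots of \<open>eta\<close>.\<close>

lemma rho_nonzero: "\<exists>y. y $ 0 = 0 \<and> kap' y \<noteq> 0 \<and> rho y \<noteq> 0"
proof -
  let ?f = "\<lambda>a y. case a of None \<Rightarrow> kap' y | Some t \<Rightarrow> poly (om y) t"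
  have "\<exists>y. \<forall>a\<in>insert None (Some ` {t. poly eta t = 0}). ?f a y \<noteq> 0"
  proof (rule polyfun_finite_prod_nonzero)
    show "finite (insert None (Some ` {t. poly eta t = 0}))"
      using poly_roots_finite[OF eta_nz] by simp
    show "polyfun (?f a)" for a
      by (cases a) (auto intro!: polyfam_poly[where K = "2 * N - 2"] degree_om)
    show "\<exists>y. ?f a y \<noteq> 0" for a
    proof (cases a)
      case None
      then show ?thesis using om_top_nonzero by (auto simp: kap'_def)
    next
      case (Some t)
      obtain j where j: "j \<in> {1,2,3,4}" "poly (w $ j) t \<noteq> 0" using immersed by blast
      then show ?thesis using om_axis[OF j(1)] Some by (intro exI[of _ "axis j 1"]) auto
    qed
  qed
  then obtain y where y: "kap' y \<noteq> 0" "\<And>t. poly eta t = 0 \<Longrightarrow> poly (om y) t \<noteq> 0" by auto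
  have "rprod (om y) eta \<noteq> 0" using rprod_eq_0_iff[OF om_nz[OF y(1)]] y(2) by blast
  then have "rho y \<noteq> 0" using rho_eq[OF y(1)] y(1) by simp
  then show ?thesis using y(1)
    by (intro exI[of _ "zero_at 0 y"]) (auto simp: zero_at_nth kap'_def rho_def)
qed

lemma F1_sigma: "F1 y * (rho y)\<^sup>2 = (y $ 0) ^ N * ((- 1 / 2) ^ (3 * N - 2) / disc_const * sigma y)"
proof -
  obtain z where z: "kap z * z $ 0 \<noteq> 0" using kap_y0_nonzero by blast
  obtain z' where z': "kap' z' \<noteq> 0" using rho_nonzero by blast
  have 1: "polyfun (\<lambda>y. kap y * y $ 0)" by (intro polyfun_intros polyfun_kap)
  obtain v where v: "kap v * v $ 0 * kap' v \<noteq> 0"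
    using polyfun_no_zero_divisors[OF 1 polyfun_kap' z z'] by auto
  show ?thesis
  proof (rule polyfun_eq_generic[where h = "\<lambda>y. kap y * y $ 0 * kap' y", OF _ _ _ v])
    show "polyfun (\<lambda>y. F1 y * (rho y)\<^sup>2)"
      by (intro polyfun_intros polyfun_F1 polyfun_rho)
    show "polyfun (\<lambda>y. (y $ 0) ^ N * ((- 1 / 2) ^ (3 * N - 2) / disc_const * sigma y))"
      by (intro polyfun_intros polyfun_sigma)
    show "polyfun (\<lambda>y. kap y * y $ 0 * kap' y)"
      by (intro polyfun_intros polyfun_kap polyfun_kap')
  qed (use F1_sigma_generic in auto)
qed

text \<open>The quotient of \<open>F1\<close> by \<open>y\<^sub>0\<^sup>N\<close>, which exists by \<open>F1_sigma\<close> since \<open>rho\<close> is coprime to \<open>y\<^sub>0\<close>.\<close>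

definition F :: "complex ^ 5 \<Rightarrow> complex" where
  "F = (SOME F. polyfun F \<and> (\<forall>y. F1 y = (y $ 0) ^ N * F y) \<and>
      (\<forall>y. F y * (rho y)\<^sup>2 = (- 1 / 2) ^ (3 * N - 2) / disc_const * sigma y))"

lemma polyfun_F [intro]: "polyfun F" and F1_F: "F1 y = (y $ 0) ^ N * F y"
  and F_sigma: "F y * (rho y)\<^sup>2 = (- 1 / 2) ^ (3 * N - 2) / disc_const * sigma y"
proof -
  obtain z where z: "z $ 0 = 0" "rho z \<noteq> 0" using rho_nonzero by blast
  have "\<exists>F. polyfun F \<and> (\<forall>y. F1 y = (y $ 0) ^ N * F y) \<and>
      (\<forall>y. F y * (rho y)\<^sup>2 = (- 1 / 2) ^ (3 * N - 2) / disc_const * sigma y)"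
  proof (rule polyfun_divide_coordinate[where z = z])
    show "polyfun (\<lambda>y. (rho y)\<^sup>2)" "polyfun (\<lambda>y. (- 1 / 2) ^ (3 * N - 2) / disc_const * sigma y)"
      by (intro polyfun_intros polyfun_rho polyfun_sigma)+
    show "(rho z)\<^sup>2 \<noteq> 0" using z by simp
  qed (use z in \<open>simp_all only: F1_sigma polyfun_F1\<close>)
  then have *: "polyfun F \<and> (\<forall>y. F1 y = (y $ 0) ^ N * F y) \<and>
      (\<forall>y. F y * (rho y)\<^sup>2 = (- 1 / 2) ^ (3 * N - 2) / disc_const * sigma y)"
    unfolding F_def by (rule someI_ex)
  then show "polyfun F" "F1 y = (y $ 0) ^ N * F y" "F y * (rho y)\<^sup>2 = (- 1 / 2) ^ (3 * N - 2) / disc_const * sigma y"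
    by auto
qed

lemma F_D:
  assumes "y $ 0 \<noteq> 0"
  shows "F y = (y $ 0) ^ (2 * N - 2) * D (lift y)"
proof -
  have "3 * N - 2 = N + (2 * N - 2)" using N by simp
  then have "(y $ 0) ^ N * F y = (y $ 0) ^ N * ((y $ 0) ^ (2 * N - 2) * D (lift y))"
    using F1_D[OF assms] F1_F[of y] by (simp add: power_add)
  then show ?thesis using assms by simp
qed

lemma F_scale: "F (c *s y) = c ^ (6 * N - 4) * F y"
proof -
  have *: "F (c *s y) = c ^ (6 * N - 4) * F y" if c: "c \<noteq> 0" for c y
  proof (rule polyfun_eq_generic[where h = "\<lambda>y. y $ 0" and z = "axis 0 1"])
    show "polyfun (\<lambda>y. F (c *s y))"
      by (rule polyfun_compose[OF polyfun_F]) (auto intro!: polyfun_intros)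
    show "polyfun (\<lambda>y. c ^ (6 * N - 4) * F y)" by (intro polyfun_intros polyfun_F)
    fix x :: "complex ^ 5" assume x: "x $ 0 \<noteq> 0"
    have "lift (c *s x) = c *s lift x"
    proof -
      have "lorentz (c *s x) (c *s x) / (c *s x) $ 0 = c * (lorentz x x / x $ 0)"
        using c x by (simp add: lorentz_def field_simps)
      then show ?thesis unfolding lift_def by (simp only: with_u_scale)
    qed
    then have "F (c *s x) = (c ^ (2 * N - 2) * c ^ (4 * N - 2)) * ((x $ 0) ^ (2 * N - 2) * D (lift x))"
      using F_D[of "c *s x"] c x by (simp add: D_scale power_mult_distrib)
    also have "c ^ (2 * N - 2) * c ^ (4 * N - 2) = c ^ (6 * N - 4)"
      using N by (simp add: power_add[symmetric])
    finally show "F (c *s x) = c ^ (6 * N - 4) * F x" using F_D[OF x] by simp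
  qed (auto simp: axis_def)
  show ?thesis
  proof (cases "c = 0")
    case True
    \<comment> \<open>\<open>F 0 = 0\<close>, from the case \<open>c = 2\<close>\<close>
    have "2 ^ (6 * N - 4) \<noteq> (1::complex)"
    proof
      assume "2 ^ (6 * N - 4) = (1::complex)"
      then have "norm ((2::complex) ^ (6 * N - 4)) = 1" by simp
      then have "(2::real) ^ (6 * N - 4) = 2 ^ 0" by (simp add: norm_power)
      then have "6 * N - 4 = 0" by (subst (asm) power_inject_exp) auto
      then show False using N by simp
    qed
    moreover have "F 0 = 2 ^ (6 * N - 4) * F 0" using *[of 2 0] by simp
    ultimately have "F 0 = 0" by (metis mult_cancel_right2)
    then show ?thesis using True N by simp
  qed (rule *)
qed

definition infinity_const :: complex where
  "infinity_const = (- 1 / 2) ^ (3 * N - 2) / disc_const * coeff e0 N ^ (6 * N - 4) * (\<Prod>r\<in>#proots e0. poly gam r * (poly (pderiv e0) r)\<^sup>2)"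

lemma infinity_const_nz: "infinity_const \<noteq> 0"
  using disc_const_nz coeff_e0 e0_nz e0_norm e0_simple
  by (auto simp: infinity_const_def prod_mset_zero_iff gam_def image_iff)

text \<open>For \<open>y\<^sub>0 = 0\<close> the form \<open>W\<close> splits as \<open>e\<^sub>0 om\<close>.  Over the roots of \<open>om\<close>, \<open>S\<close> is
  \<open><y, y> eta\<^sup>2\<close>, which contributes the square of \<open>rho\<close>; over the roots of \<open>e\<^sub>0\<close> it is
  \<open>gam e\<^sub>0'\<^sup>2 (gam <y, y> - lam\<^sup>2)\<close>.\<close>

lemma F_at_y0_zero:
  assumes "y $ 0 = 0"
  shows "F y = infinity_const * lorentz y y ^ (2 * N - 2) *
     (\<Prod>r\<in>#proots e0. poly gam r * lorentz y y - (poly (lam y) r)\<^sup>2)"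
proof -
  let ?R = "\<lambda>y. infinity_const * lorentz y y ^ (2 * N - 2) * (\<Prod>r\<in>#proots e0. poly gam r * lorentz y y - (poly (lam y) r)\<^sup>2)"
  obtain z where z: "z $ 0 = 0" "kap' z \<noteq> 0" "rho z \<noteq> 0" using rho_nonzero by blast
  have "F (zero_at 0 y) = ?R (zero_at 0 y)"
  proof (rule polyfun_eq_generic[where f = "\<lambda>y. F (zero_at 0 y)" and g = "\<lambda>y. ?R (zero_at 0 y)"
        and h = "\<lambda>y. kap' (zero_at 0 y) * rho (zero_at 0 y)" and x = y and z = z])
    show "polyfun (\<lambda>y. F (zero_at 0 y))" by (rule polyfun_zero_at[OF polyfun_F])
    have "polyfun ?R"
      by (intro polyfun_intros polyfun_lorentz polyfam_poly[where K = N] degree_lam polyfam_lam)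
    then show "polyfun (\<lambda>y. ?R (zero_at 0 y))" by (rule polyfun_zero_at)
    show "polyfun (\<lambda>y. kap' (zero_at 0 y) * rho (zero_at 0 y))"
      by (intro polyfun_intros polyfun_zero_at polyfun_kap' polyfun_rho)
    show "kap' (zero_at 0 z) * rho (zero_at 0 z) \<noteq> 0" using z by (simp add: zero_at_id)
    fix x assume x: "kap' (zero_at 0 x) * rho (zero_at 0 x) \<noteq> 0"
    define v where "v = zero_at 0 x"
    have v: "v $ 0 = 0" "kap' v \<noteq> 0" "rho v \<noteq> 0" using x by (auto simp: v_def zero_at_nth)
    have W: "W v = e0 * om v" using v by (simp add: W_def)
    have kv: "kap v = coeff e0 N * kap' v" using v by (simp add: kap_def kap'_def coeff_W)
    then have k: "kap v \<noteq> 0" using v coeff_e0 by simp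
    have 1: "rprod (om v) (S v) = lorentz v v ^ (2 * N - 2) * (rprod (om v) eta)\<^sup>2"
    proof -
      have "rprod (om v) (S v) = rprod (om v) (smult (lorentz v v) (eta\<^sup>2))"
        by (rule rprod_cong[OF om_nz[OF v(2)]]) (simp add: S_def)
      then show ?thesis by (simp only: rprod_smult_right rprod_power_right degree_om_exact[OF v(2)])
    qed
    have 2: "rprod e0 (S v) = (\<Prod>r\<in>#proots e0. poly gam r * (poly (pderiv e0) r)\<^sup>2) *
       (\<Prod>r\<in>#proots e0. poly gam r * lorentz v v - (poly (lam v) r)\<^sup>2)"
    proof -
      have "poly (S v) r = poly gam r * (poly (pderiv e0) r)\<^sup>2 * (poly gam r * lorentz v v - (poly (lam v) r)\<^sup>2)"
        if r: "poly e0 r = 0" for r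
        by (simp add: S_def eta_at_root[OF r] om_at_root[OF r] algebra_simps power2_eq_square)
      then have "rprod e0 (S v) = (\<Prod>r\<in>#proots e0. poly gam r * (poly (pderiv e0) r)\<^sup>2 *
          (poly gam r * lorentz v v - (poly (lam v) r)\<^sup>2))"
        unfolding rprod_def by (intro arg_cong[of _ _ prod_mset] image_mset_cong) (use e0_nz in auto)
      then show ?thesis by (simp only: prod_mset.distrib)
    qed
    have "sigma v = kap v ^ (6 * N - 4) * (rprod e0 (S v) * rprod (om v) (S v))"
      unfolding sigma_eq[OF k] W by (subst rprod_mult_left[OF e0_nz om_nz[OF v(2)]]) simp
    also have "\<dots> = coeff e0 N ^ (6 * N - 4) * rprod e0 (S v) * lorentz v v ^ (2 * N - 2) *
        (kap' v ^ (6 * N - 4) * (rprod (om v) eta)\<^sup>2)"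
      unfolding 1 kv by (simp add: power_mult_distrib mult_ac)
    also have "kap' v ^ (6 * N - 4) * (rprod (om v) eta)\<^sup>2 = (rho v)\<^sup>2"
    proof -
      have "6 * N - 4 = (3 * N - 2) * 2" using N by simp
      then show ?thesis unfolding rho_eq[OF v(2)] by (simp add: power_mult_distrib power_mult)
    qed
    finally have "F v * (rho v)\<^sup>2 = ?R v * (rho v)\<^sup>2"
      using F_sigma[of v] by (simp add: infinity_const_def 2 mult_ac)
    then show "F (zero_at 0 x) = ?R (zero_at 0 x)" using v by (simp add: v_def)
  qed
  then show ?thesis using assms by (simp add: zero_at_id)
qed

text \<open>A nonzero multiple of \<open><y, y>\<close> is not the square of a linear form: two orthogonal unit vectors
  and their sum suffice to see it.\<close>

lemma quadratic_factor_nonzero: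
  assumes r: "poly e0 r = 0"
  shows "\<exists>y. poly gam r * lorentz y y - (poly (lam y) r)\<^sup>2 \<noteq> 0"
proof (rule ccontr)
  assume "\<not> ?thesis"
  then have z: "poly gam r * lorentz y y = (poly (lam y) r)\<^sup>2" for y by auto
  let ?a = "axis 1 1 :: complex ^ 5" and ?b = "axis 2 1 :: complex ^ 5"
  have "poly gam r = (poly (e $ 1) r)\<^sup>2" using z[of ?a] by (simp add: lorentz_def lam_def axis_def)
  moreover have "poly gam r = (poly (e $ 2) r)\<^sup>2" using z[of ?b] by (simp add: lorentz_def lam_def axis_def)
  moreover have "poly gam r * 2 = (poly (e $ 1) r + poly (e $ 2) r)\<^sup>2"
    using z[of "?a + ?b"] by (simp add: lorentz_def lam_def axis_def)
  ultimately have "poly (e $ 1) r * poly (e $ 2) r = 0" by (simp add: power2_sum)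
  then have "poly gam r = 0"
    using \<open>poly gam r = (poly (e $ 1) r)\<^sup>2\<close> \<open>poly gam r = (poly (e $ 2) r)\<^sup>2\<close> by auto
  then show False using e0_norm[OF r] by (simp add: gam_def)
qed

lemma F_nonzero: "\<exists>y. y $ 0 = 0 \<and> F y \<noteq> 0"
proof -
  let ?f = "\<lambda>a y. case a of None \<Rightarrow> lorentz y y | Some r \<Rightarrow> poly gam r * lorentz y y - (poly (lam y) r)\<^sup>2"
  have "\<exists>y. \<forall>a\<in>insert None (Some ` {t. poly e0 t = 0}). ?f a y \<noteq> 0"
  proof (rule polyfun_finite_prod_nonzero)
    show "finite (insert None (Some ` {t. poly e0 t = 0}))"
      using poly_roots_finite[OF e0_nz] by simp
    show "polyfun (?f a)" for a
      by (cases a) (auto intro!: polyfun_intros polyfun_lorentz polyfam_poly[where K = N] degree_lam)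
    show "\<exists>y. ?f a y \<noteq> 0" if "a \<in> insert None (Some ` {t. poly e0 t = 0})" for a
    proof (cases a)
      case None
      then show ?thesis by (intro exI[of _ "axis 1 1"]) (simp add: lorentz_def axis_def)
    next
      case (Some t)
      then show ?thesis using that quadratic_factor_nonzero[of t] by auto
    qed
  qed
  then obtain y where y: "lorentz y y \<noteq> 0"
    "\<And>r. poly e0 r = 0 \<Longrightarrow> poly gam r * lorentz y y - (poly (lam y) r)\<^sup>2 \<noteq> 0" by auto
  have z: "lorentz (zero_at 0 y) (zero_at 0 y) = lorentz y y" "lam (zero_at 0 y) = lam y"
    by (simp_all add: lorentz_def lam_def zero_at_nth)
  have "F (zero_at 0 y) \<noteq> 0"
    by (subst F_at_y0_zero) (use y e0_nz infinity_const_nz in \<open>auto simp: z zero_at_nth prod_mset_zero_iff image_iff\<close>)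
  then show ?thesis by (intro exI[of _ "zero_at 0 y"]) (simp add: zero_at_nth)
qed

text \<open>For \<open>N > 1\<close> the factor \<open><y, y>\<close> of \<open>F_at_y0_zero\<close> vanishes.  For \<open>N = 1\<close> this factor is absent, but
  then \<open>Du\<close> has degree at most 1, and on this set both \<open>F\<close> and \<open>D\<close> reduce to its constant coefficient.\<close>

lemma F_at_quadric_infinity:
  assumes D: "D x = 0" and x0: "x $ Some 0 = 0" and q: "lorentz (Phi x) (Phi x) = 0"
  shows "F (Phi x) = 0"
proof (cases "N = 1")
  case False
  have P0: "Phi x $ 0 = 0" using x0 by (simp add: Phi_def)
  show ?thesis using F_at_y0_zero[OF P0] q False N by simp
next
  case True
  have F: "F y = coeff (Du y) 0 + lead_const * lorentz y y" for y
  proof (rule polyfun_eq_generic[where h = "\<lambda>y. y $ 0" and z = "axis 0 1"])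
    show "polyfun (\<lambda>y. coeff (Du y) 0 + lead_const * lorentz y y)"
      by (intro polyfun_intros polyfun_lorentz polyfam_coeff polyfam_Du)
    fix y :: "complex ^ 5" assume y: "y $ 0 \<noteq> 0"
    have "D (lift y) = (\<Sum>k\<le>1. coeff (Du y) k * (lorentz y y / y $ 0) ^ k)"
      unfolding D_Du lift_def using poly_eq_sum[OF degree_Du] True by simp
    then show "F y = coeff (Du y) 0 + lead_const * lorentz y y"
      using F_D[OF y] coeff_Du_top[of y] True y by simp
  qed (auto simp: axis_def)
  have "D x = (\<Sum>k\<le>1. coeff (Du (Phi x)) k * (x $ None) ^ k)"
    unfolding D_Du using poly_eq_sum[OF degree_Du] True by simp
  then show ?thesis
    using F[of "Phi x"] coeff_Du_top[of "Phi x"] True x0 q D by (simp add: Phi_def)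
qed

end

section \<open>Bivariate polynomials\<close>

text \<open>A polynomial in two variables is a polynomial in \<open>s\<close> (outer) over the polynomials in \<open>t\<close>
  (inner); this fixes \<open>t\<close>.\<close>

definition at_outer :: "complex \<Rightarrow> complex poly poly \<Rightarrow> complex poly" where
  "at_outer t P = map_poly (\<lambda>c. poly c t) P"

lemma poly_at_outer: "poly (poly P q) t = poly (at_outer t P) (poly q t)"
  unfolding at_outer_def by (induction P) (simp_all add: map_poly_pCons)

lemma at_outer_eq: "poly (at_outer t P) s = poly (poly P [:s:]) t"
  using poly_at_outer[of P "[:s:]" t] by simp

lemma coeff_at_outer: "coeff (at_outer t P) k = poly (coeff P k) t"
  by (simp add: at_outer_def coeff_map_poly)

lemma degree_at_outer:
  assumes "poly (lead_coeff P) t \<noteq> 0"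
  shows "degree (at_outer t P) = degree P"
proof (rule antisym)
  show "degree (at_outer t P) \<le> degree P"
    by (rule degree_le) (simp add: coeff_at_outer coeff_eq_0)
  show "degree P \<le> degree (at_outer t P)"
    using assms by (intro le_degree) (simp add: coeff_at_outer)
qed

text \<open>The substitute for a greatest common divisor: among the nonzero combinations take \<open>d\<close> of least degree in the outer
  variable.  The remainder of a pseudo-division by \<open>d\<close> is again a combination, hence 0.\<close>

lemma outer_gcd:
  fixes Q :: "'i \<Rightarrow> complex poly poly"
  assumes J: "finite J" and nz: "\<exists>j\<in>J. Q j \<noteq> 0"
  shows "\<exists>d c r k. d \<noteq> 0 \<and> d = (\<Sum>j\<in>J. c j * Q j) \<and> (\<forall>j\<in>J. r j \<noteq> 0 \<and> smult (r j) (Q j) = d * k j)"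
proof -
  define I where "I d \<longleftrightarrow> (\<exists>c. d = (\<Sum>j\<in>J. c j * Q j))" for d
  have I_Q: "I (Q j)" if "j \<in> J" for j
    unfolding I_def using J that
    by (intro exI[of _ "\<lambda>i. if i = j then 1 else 0"]) (simp add: if_distrib[of "\<lambda>x. x * _"] cong: if_cong)
  have I_diff: "I (smult a p - q * s)" if pq: "I p" "I q" for a p q s
  proof -
    obtain c c' where "p = (\<Sum>j\<in>J. c j * Q j)" "q = (\<Sum>j\<in>J. c' j * Q j)" using pq unfolding I_def by blast
    moreover have "smult a x = [:a:] * x" for x by simp
    ultimately have "smult a p - q * s = (\<Sum>j\<in>J. ([:a:] * c j - c' j * s) * Q j)"
      by (simp only: left_diff_distrib right_diff_distrib sum_subtractf sum_distrib_left sum_distrib_right mult_ac)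
    then show ?thesis unfolding I_def by (intro exI[of _ "\<lambda>j. [:a:] * c j - c' j * s"])
  qed
  obtain d where d: "d \<noteq> 0" "I d" and min: "\<And>d'. d' \<noteq> 0 \<Longrightarrow> I d' \<Longrightarrow> degree d \<le> degree d'"
  proof -
    obtain j where "j \<in> J" "Q j \<noteq> 0" using nz by blast
    then show ?thesis
      using ex_has_least_nat[of "\<lambda>d. d \<noteq> 0 \<and> I d" "Q j" degree] I_Q[of j] that by auto
  qed
  have "\<exists>a q. a \<noteq> 0 \<and> smult a (Q j) = d * q" if j: "j \<in> J" for j
  proof -
    obtain a q where aq: "a \<noteq> 0" "smult a (Q j) = d * q + pseudo_mod (Q j) d"
      using pseudo_mod(1)[OF d(1)] by blast
    have "I (pseudo_mod (Q j) d)" using I_diff[OF I_Q[OF j] d(2), of a q] aq(2) by simp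
    then have "pseudo_mod (Q j) d = 0"
      using pseudo_mod(2)[OF d(1), of "Q j"] min by force
    then show ?thesis using aq by auto
  qed
  then obtain r k where "\<And>j. j \<in> J \<Longrightarrow> r j \<noteq> 0 \<and> smult (r j) (Q j) = d * k j" by metis
  then show ?thesis using d unfolding I_def by blast
qed

text \<open>The polynomial \<open>p(t) q(s) - q(t) p(s)\<close> vanishes on the diagonal; the quotient by \<open>s - t\<close> is there
  a Wronskian.\<close>

lemma difference_quotient_poly:
  fixes p q :: "complex poly"
  shows "\<exists>Q. (\<forall>t s. (s - t) * poly (at_outer t Q) s = poly p t * poly q s - poly q t * poly p s) \<and>
    (\<forall>t. poly (at_outer t Q) t = poly p t * poly (pderiv q) t - poly q t * poly (pderiv p) t)"
proof -
  define lft :: "complex poly \<Rightarrow> complex poly poly" where "lft = map_poly (\<lambda>c. [:c:])"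
  define P where "P = smult p (lft q) - smult q (lft p)"
  have lft_X: "poly (lft f) [:0, 1:] = f" for f
    unfolding lft_def by (induction f) (simp_all add: map_poly_pCons)
  have lft_s: "poly (lft f) [:s:] = [:poly f s:]" for f s
    unfolding lft_def by (induction f) (simp_all add: map_poly_pCons)
  have pd: "pderiv (lft f) = lft (pderiv f)" for f
    by (rule poly_eqI) (simp add: lft_def coeff_pderiv coeff_map_poly of_nat_poly)
  have "poly P [:0, 1:] = 0" by (simp add: P_def lft_X mult.commute)
  then obtain Q where Q: "P = [:- [:0, 1:], 1:] * Q"
    by (auto simp: poly_eq_0_iff_dvd dvd_def)
  show ?thesis
  proof (intro exI[of _ Q] conjI allI)
    fix t s
    have "poly (poly P [:s:]) t = poly p t * poly q s - poly q t * poly p s"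
      by (simp add: P_def lft_s)
    moreover have "poly (poly P [:s:]) t = (s - t) * poly (at_outer t Q) s"
      by (simp add: Q at_outer_eq left_diff_distrib)
    ultimately show "(s - t) * poly (at_outer t Q) s = poly p t * poly q s - poly q t * poly p s" by simp
    have "poly (pderiv P) [:0, 1:] = p * pderiv q - q * pderiv p"
      by (simp add: P_def pderiv_diff pderiv_smult pd lft_X)
    moreover have "poly (pderiv P) [:0, 1:] = poly Q [:0, 1:]"
      unfolding Q pderiv_mult poly_add poly_mult by (simp add: pderiv_pCons)
    ultimately show "poly (at_outer t Q) t = poly p t * poly (pderiv q) t - poly q t * poly (pderiv p) t"
      using poly_at_outer[of Q "[:0, 1:]" t] by simp
  qed
qed

context spine
begin

definition same_point :: "complex \<Rightarrow> complex \<Rightarrow> bool" where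
  "same_point t s \<longleftrightarrow> (\<forall>j\<in>{1,2,3,4}. poly (e $ j) t * poly e0 s = poly (e $ j) s * poly e0 t)"

text \<open>Parameters at which not only the point but also the tangent of the spine curve is that of another
  parameter.\<close>

definition bitangents :: "complex set" where
  "bitangents = {t. poly e0 t \<noteq> 0 \<and> (\<exists>s. s \<noteq> t \<and> poly e0 s \<noteq> 0 \<and> same_point t s \<and>
     (\<exists>c. \<forall>j\<in>{1,2,3,4}. poly (w $ j) t = c * poly (w $ j) s))}"

definition double_points :: "complex set" where
  "double_points = {t. poly e0 t \<noteq> 0 \<and> (\<exists>s. s \<noteq> t \<and> poly e0 s \<noteq> 0 \<and> same_point t s)}"

lemma no_common_root: "poly e0 t = 0 \<Longrightarrow> \<exists>j\<in>{1,2,3,4}. poly (e $ j) t \<noteq> 0"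
  using e0_norm[of t] by (auto simp: lorentz_def)

text \<open>The quotients of \<open>e\<^sub>j(t) e\<^sub>0(s) - e\<^sub>0(t) e\<^sub>j(s)\<close> by \<open>s - t\<close> have a common divisor \<open>d\<close> in the sense of
  \<open>outer_gcd\<close>.  If \<open>d\<close> is free of \<open>s\<close>, double points are among its roots.  Otherwise
  almost every \<open>t\<close> has a partner \<open>s\<close>, a root of \<open>d(t, \<cdot>)\<close>, and partners move continuously with \<open>t\<close>.
  As the curve traces the same points from \<open>t\<close> and from \<open>s\<close>, the tangents agree,
  and almost every parameter is a bitangent.\<close>

lemma finite_double_points:
  assumes fin: "finite bitangents"
  shows "finite double_points"
proof -
  let ?J = "{1,2,3,4} :: 5 set"
  have "\<exists>Q. \<forall>j. (\<forall>t s. (s - t) * poly (at_outer t (Q j)) s = poly (e $ j) t * poly e0 s - poly e0 t * poly (e $ j) s) \<and>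
    (\<forall>t. poly (at_outer t (Q j)) t = poly (e $ j) t * poly (pderiv e0) t - poly e0 t * poly (pderiv (e $ j)) t)"
    by (rule choice, rule allI, rule difference_quotient_poly)
  then obtain Q where Q: "\<And>j t s. (s - t) * poly (at_outer t (Q j)) s = poly (e $ j) t * poly e0 s - poly e0 t * poly (e $ j) s"
    and Qd: "\<And>j t. poly (at_outer t (Q j)) t = poly (e $ j) t * poly (pderiv e0) t - poly e0 t * poly (pderiv (e $ j)) t"
    by blast
  have Qw: "poly (at_outer t (Q j)) t = - poly (w $ j) t" for j t
    by (simp add: Qd wvec_def algebra_simps)
  have "\<exists>j\<in>?J. Q j \<noteq> 0"
  proof -
    obtain j where "j \<in> ?J" "poly (w $ j) 0 \<noteq> 0" using immersed by blast
    then show ?thesis using Qw[of 0 j] by (intro bexI[of _ j]) (auto simp: at_outer_def)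
  qed
  then obtain d c r k where d: "d \<noteq> 0" "d = (\<Sum>j\<in>?J. c j * Q j)"
    and r: "\<And>j. j \<in> ?J \<Longrightarrow> r j \<noteq> 0 \<and> smult (r j) (Q j) = d * k j"
    using outer_gcd[of ?J Q] by auto
  have lc: "lead_coeff d \<noteq> 0" using d(1) leading_coeff_0_iff by blast
  have common_d: "poly (at_outer t d) s = 0" if "t \<noteq> s" "same_point t s" for t s
  proof -
    have "poly (at_outer t (Q j)) s = 0" if "j \<in> ?J" for j
      using Q[of s t j] \<open>t \<noteq> s\<close> \<open>same_point t s\<close> that unfolding same_point_def
      by (auto simp: mult.commute)
    then have "poly (poly (Q j) [:s:]) t = 0" if "j \<in> ?J" for j using that by (simp add: at_outer_eq)
    then show ?thesis unfolding at_outer_eq d(2) by (simp add: poly_sum poly_mult)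
  qed
  show ?thesis
  proof (cases "degree d = 0")
    case True
    then obtain a where a: "d = [:a:]" by (auto elim: degree_eq_zeroE)
    then have "a \<noteq> 0" using d by auto
    have "double_points \<subseteq> {t. poly a t = 0}"
    proof
      fix t assume "t \<in> double_points"
      then obtain s where "s \<noteq> t" "same_point t s" unfolding double_points_def by blast
      then have "poly (at_outer t d) s = 0" by (intro common_d) auto
      then show "t \<in> {t. poly a t = 0}" by (simp add: a at_outer_eq)
    qed
    then show ?thesis using poly_roots_finite[OF \<open>a \<noteq> 0\<close>] finite_subset by blast
  next
    case False
    \<comment> \<open>outside \<open>bad\<close> the roots of \<open>d\<close> are partners, and \<open>d\<close> keeps its degree\<close>
    define bad where "bad = bitangents \<union> {t. poly e0 t = 0} \<union> {t. poly (lead_coeff d) t = 0} \<union> (\<Union>j\<in>?J. {t. poly (r j) t = 0})"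
    have "finite bad"
      unfolding bad_def using fin poly_roots_finite[OF e0_nz] poly_roots_finite[OF lc] r
      by (auto intro!: poly_roots_finite)
    then obtain t where t: "t \<notin> bad" using ex_new_if_finite infinite_UNIV_char_0 by blast
    then have te: "poly e0 t \<noteq> 0" and tl: "poly (lead_coeff d) t \<noteq> 0"
      and tr: "\<And>j. j \<in> ?J \<Longrightarrow> poly (r j) t \<noteq> 0" and tb: "t \<notin> bitangents"
      by (auto simp: bad_def)
    have partner: "b \<noteq> a \<and> same_point a b \<and> poly e0 b \<noteq> 0"
      if ab: "poly (at_outer a d) b = 0" and ra: "\<And>j. j \<in> ?J \<Longrightarrow> poly (r j) a \<noteq> 0" and ea: "poly e0 a \<noteq> 0" for a b
    proof -
      have z: "poly (at_outer a (Q j)) b = 0" if j: "j \<in> ?J" for j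
      proof -
        have "poly (poly (smult (r j) (Q j)) [:b:]) a = 0" using r[OF j] ab by (simp add: at_outer_eq)
        then show ?thesis using ra[OF j] by (simp add: at_outer_eq)
      qed
      have "b \<noteq> a"
      proof
        assume "b = a"
        then have "poly (w $ j) a = 0" if "j \<in> ?J" for j using z[OF that] Qw[of a j] by simp
        then show False using immersed[of a] by blast
      qed
      moreover have sp: "same_point a b"
        unfolding same_point_def
      proof
        fix j assume "j \<in> ?J"
        then show "poly (e $ j) a * poly e0 b = poly (e $ j) b * poly e0 a"
          using z[of j] Q[of b a j] by (simp add: mult.commute)
      qed
      moreover have "poly e0 b \<noteq> 0"
      proof
        assume b0: "poly e0 b = 0"
        then obtain j where j: "j \<in> ?J" "poly (e $ j) b \<noteq> 0" using no_common_root by blast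
        then have "poly (e $ j) a * poly e0 b = poly (e $ j) b * poly e0 a"
          using sp unfolding same_point_def by blast
        then show False using j b0 ea by simp
      qed
      ultimately show ?thesis by blast
    qed
    have "degree (at_outer t d) \<noteq> 0" using degree_at_outer[OF tl] False by simp
    then obtain s where s: "poly (at_outer t d) s = 0"
      using fundamental_theorem_of_algebra[of "at_outer t d"] by (auto simp: constant_degree)
    have ts: "s \<noteq> t" "same_point t s" "poly e0 s \<noteq> 0" using partner[OF s tr te] by auto
    have cont: "((\<lambda>h. poly p (t + h)) \<longlongrightarrow> poly p t) (at 0)" for p :: "complex poly"
      by (intro tendsto_eq_intros) auto
    have ev_nz: "\<forall>\<^sub>F h in at 0. poly p (t + h) \<noteq> 0" if "poly p t \<noteq> 0" for p
      using tendsto_imp_eventually_ne[OF cont that] .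
    have "\<exists>\<sigma>. (\<forall>\<^sub>F h in at 0. poly (at_outer (t + h) d) (\<sigma> h) = 0) \<and> (\<sigma> \<longlongrightarrow> s) (at 0)"
    proof (rule root_tendsto[where d = "degree d" and L = "poly (lead_coeff d) t"])
      show "\<forall>\<^sub>F h in at 0. degree (at_outer (t + h) d) = degree d"
        using ev_nz[OF tl] by eventually_elim (rule degree_at_outer)
      show "((\<lambda>h. coeff (at_outer (t + h) d) (degree d)) \<longlongrightarrow> poly (lead_coeff d) t) (at 0)"
        unfolding coeff_at_outer by (rule cont)
      show "((\<lambda>h. poly (at_outer (t + h) d) s) \<longlongrightarrow> 0) (at 0)"
        using cont[of "poly d [:s:]"] s by (simp add: at_outer_eq)
    qed (use False tl in auto)
    then obtain \<sigma> where \<sigma>: "\<forall>\<^sub>F h in at 0. poly (at_outer (t + h) d) (\<sigma> h) = 0" "(\<sigma> \<longlongrightarrow> s) (at 0)" by blast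
    have "\<forall>\<^sub>F h in at 0. \<forall>j\<in>?J. poly (r j) (t + h) \<noteq> 0"
      by (intro eventually_ball_finite ballI ev_nz tr) auto
    then have ev: "\<forall>\<^sub>F h in at 0. same_point (t + h) (\<sigma> h) \<and> poly e0 (\<sigma> h) \<noteq> 0 \<and> poly e0 (t + h) \<noteq> 0"
      using \<sigma>(1) ev_nz[OF te] by eventually_elim (use partner in blast)
    define f where "f j z = poly (e $ j) z / poly e0 z" for j z
    define f' where "f' j z = poly (w $ j) z / (poly e0 z)\<^sup>2" for j z
    have der: "(f j has_field_derivative f' j z) (at z)" if "poly e0 z \<noteq> 0" for j z
    proof -
      have "((\<lambda>z. poly (e $ j) z / poly e0 z) has_field_derivative
         (poly (pderiv (e $ j)) z * poly e0 z - poly (e $ j) z * poly (pderiv e0) z) / (poly e0 z * poly e0 z)) (at z)"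
        by (intro DERIV_divide poly_DERIV that)
      then show ?thesis by (simp add: f_def[abs_def] f'_def wvec_def power2_eq_square)
    qed
    have f_eq: "f j a = f j b" if "same_point a b" "poly e0 a \<noteq> 0" "poly e0 b \<noteq> 0" "j \<in> ?J" for j a b
      using bspec[OF that(1)[unfolded same_point_def] that(4)] that(2,3)
      unfolding f_def by (simp add: frac_eq_eq)
    define A where "A j h = f j (t + h) - f j t" for j h
    have A_\<sigma>: "\<forall>\<^sub>F h in at 0. A j h = f j (\<sigma> h) - f j s" if "j \<in> ?J" for j
      using ev by eventually_elim (use f_eq[OF ts(2) te ts(3) that] f_eq[OF _ _ _ that] in \<open>simp add: A_def\<close>)
    have lim1: "((\<lambda>h. A j h / h) \<longlongrightarrow> f' j t) (at 0)" for j
      using der[OF te, of j] unfolding DERIV_def A_def by simp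
    obtain i where i: "i \<in> ?J" "poly (w $ i) t \<noteq> 0" using immersed by blast
    have ev_ne: "\<forall>\<^sub>F h in at 0. \<sigma> h \<noteq> s"
    proof -
      have "f' i t \<noteq> 0" using i te by (simp add: f'_def)
      then have "\<forall>\<^sub>F h in at 0. A i h / h \<noteq> 0" using tendsto_imp_eventually_ne[OF lim1] by blast
      then show ?thesis using A_\<sigma>[OF i(1)] by eventually_elim auto
    qed
    have lim2: "((\<lambda>h. A j h / (\<sigma> h - s)) \<longlongrightarrow> f' j s) (at 0)" if j: "j \<in> ?J" for j
    proof -
      have "((\<lambda>z. (f j z - f j s) / (z - s)) \<longlongrightarrow> f' j s) (at s)"
        using der[OF ts(3), of j] unfolding has_field_derivative_iff .
      moreover have "filterlim \<sigma> (at s) (at 0)" using \<sigma>(2) ev_ne by (simp add: filterlim_at)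
      ultimately have "((\<lambda>h. (f j (\<sigma> h) - f j s) / (\<sigma> h - s)) \<longlongrightarrow> f' j s) (at 0)"
        by (rule filterlim_compose)
      then show ?thesis
        by (rule Lim_transform_eventually) (use A_\<sigma>[OF j] in eventually_elim, simp)
    qed
    \<comment> \<open>both products of difference quotients are equal for every \<open>h\<close>, because \<open>A\<close> has two expressions\<close>
    have cross: "f' j t * f' l s = f' l t * f' j s" if "j \<in> ?J" "l \<in> ?J" for j l
    proof (rule tendsto_unique)
      show "((\<lambda>h. (A j h / h) * (A l h / (\<sigma> h - s))) \<longlongrightarrow> f' j t * f' l s) (at 0)"
        by (intro tendsto_mult lim1 lim2 that)
      have "((\<lambda>h. (A l h / h) * (A j h / (\<sigma> h - s))) \<longlongrightarrow> f' l t * f' j s) (at 0)"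
        by (intro tendsto_mult lim1 lim2 that)
      then show "((\<lambda>h. (A j h / h) * (A l h / (\<sigma> h - s))) \<longlongrightarrow> f' l t * f' j s) (at 0)"
        by (simp add: mult.commute)
    qed simp
    obtain l where l: "l \<in> ?J" "poly (w $ l) s \<noteq> 0" using immersed by blast
    have "poly (w $ j) t = (poly (w $ l) t / poly (w $ l) s) * poly (w $ j) s" if "j \<in> ?J" for j
      using cross[OF that l(1)] te ts(3) l(2) by (simp add: f'_def field_simps)
    then have "t \<in> bitangents" unfolding bitangents_def using te ts by blast
    then show ?thesis using tb by blast
  qed
qed

section \<open>Distinct critical values\<close>

lemma W_line: "W (a + z *s b) = W a + smult z (W b)"
proof (rule poly_eqI_poly)
  fix t show "poly (W (a + z *s b)) t = poly (W a + smult z (W b)) t"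
    by (simp add: W_def om_def algebra_simps)
qed

text \<open>In a pencil \<open>W a + z W b\<close> without base points, a multiple root is a zero of the
  Wronskian of \<open>W a\<close> and \<open>W b\<close>, and it determines \<open>z\<close>; so only finitely many \<open>z\<close> are excluded.\<close>

lemma generic_squarefree:
  assumes T: "finite T"
  shows "\<exists>y. y $ 0 \<noteq> 0 \<and> kap y \<noteq> 0 \<and> (\<forall>t\<in>T. poly (W y) t \<noteq> 0) \<and>
    (\<forall>t. poly (W y) t = 0 \<longrightarrow> poly (pderiv (W y)) t \<noteq> 0)"
proof -
  have pW: "polyfun (\<lambda>y. poly (W y) t)" for t
    by (rule polyfam_poly[where K = "3 * N - 2"]) (auto intro: degree_W)
  have avoid: "\<exists>y. y $ 0 \<noteq> 0 \<and> kap y \<noteq> 0 \<and> (\<forall>t\<in>A. poly (W y) t \<noteq> 0)" if A: "finite A" for A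
  proof -
    obtain x where x: "\<forall>t\<in>A. poly (W x) t \<noteq> 0"
      using polyfun_finite_prod_nonzero[of A "\<lambda>t y. poly (W y) t", OF A pW W_base_point_free] by auto
    obtain z where z: "kap z * z $ 0 \<noteq> 0" using kap_y0_nonzero by blast
    have 1: "polyfun (\<lambda>y. kap y * y $ 0)" "polyfun (\<lambda>y. \<Prod>t\<in>A. poly (W y) t)"
      by (intro polyfun_intros polyfun_kap pW)+
    have "(\<Prod>t\<in>A. poly (W x) t) \<noteq> 0" using x that by auto
    from polyfun_no_zero_divisors[OF 1 z this] that show ?thesis by auto
  qed
  obtain a where a: "a $ 0 \<noteq> 0" "kap a \<noteq> 0" "\<forall>t\<in>T. poly (W a) t \<noteq> 0" using avoid[OF T] by blast
  obtain b where b: "\<And>t. poly (W a) t = 0 \<Longrightarrow> poly (W b) t \<noteq> 0"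
    using avoid[OF poly_roots_finite[OF W_nz[OF a(2)]]] by blast
  define R where "R = pderiv (W a) * W b - W a * pderiv (W b)"
  have "R \<noteq> 0"
  proof
    assume "R = 0"
    then have "W a dvd pderiv (W a) * W b" by (simp add: R_def)
    moreover have "coprime (W a) (W b)" by (rule coprime_complex_polyI) (use b in auto)
    ultimately have dv: "W a dvd pderiv (W a)" by (simp add: coprime_dvd_mult_left_iff)
    have deg: "degree (W a) > 0" using degree_W_exact[OF a(2)] N by simp
    then have "pderiv (W a) \<noteq> 0" by (simp add: pderiv_eq_0_iff)
    then have "degree (W a) \<le> degree (pderiv (W a))" using dvd_imp_degree_le[OF dv] by blast
    then show False using deg by (simp add: degree_pderiv)
  qed
  \<comment> \<open>the only \<open>z\<close> for which \<open>t\<close> is a root of \<open>W (a + z b)\<close>\<close>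
  let ?q = "\<lambda>t. - poly (W a) t / poly (W b) t"
  define bad where "bad = ?q ` {t. poly R t = 0} \<union> ?q ` T \<union> {- kap a / kap b, - (a $ 0) / b $ 0}"
  have "finite bad" unfolding bad_def using T poly_roots_finite[OF \<open>R \<noteq> 0\<close>] by auto
  then obtain z where z: "z \<notin> bad" using ex_new_if_finite infinite_UNIV_char_0 by blast
  have qI: "z = - u / v" if "u + z * v = 0" "v \<noteq> 0" for u v
    using that by (simp add: field_simps eq_neg_iff_add_eq_0)
  have Wz: "poly (W (a + z *s b)) t = poly (W a) t + z * poly (W b) t" for t by (simp add: W_line)
  have Wz_b: "poly (W b) t \<noteq> 0" if "poly (W (a + z *s b)) t = 0" for t
    using that b[of t] by (auto simp: Wz)
  show ?thesis
  proof (intro exI[of _ "a + z *s b"] conjI ballI allI impI)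
    show "(a + z *s b) $ 0 \<noteq> 0"
    proof
      assume "(a + z *s b) $ 0 = 0"
      then have "a $ 0 + z * b $ 0 = 0" by simp
      then show False using qI[of "a $ 0" "b $ 0"] a(1) z by (cases "b $ 0 = 0") (auto simp: bad_def)
    qed
    show "kap (a + z *s b) \<noteq> 0"
    proof
      assume "kap (a + z *s b) = 0"
      then have "kap a + z * kap b = 0" by (simp add: kap_def W_line)
      then show False using qI[of "kap a" "kap b"] a(2) z by (cases "kap b = 0") (auto simp: bad_def)
    qed
    fix t
    { assume t: "t \<in> T"
      show "poly (W (a + z *s b)) t \<noteq> 0"
      proof
        assume 0: "poly (W (a + z *s b)) t = 0"
        then have "z = ?q t" using qI[OF _ Wz_b[OF 0]] by (simp add: Wz)
        then show False using z t by (auto simp: bad_def)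
      qed }
    { assume 0: "poly (W (a + z *s b)) t = 0"
      show "poly (pderiv (W (a + z *s b))) t \<noteq> 0"
      proof
        assume 1: "poly (pderiv (W (a + z *s b))) t = 0"
        have e0: "poly (W a) t = - z * poly (W b) t" using 0 by (simp add: Wz eq_neg_iff_add_eq_0)
        have e1: "poly (pderiv (W a)) t = - z * poly (pderiv (W b)) t"
          using 1 by (simp add: W_line pderiv_add pderiv_smult eq_neg_iff_add_eq_0)
        have "poly R t = 0" by (simp add: R_def e0 e1)
        moreover have "z = ?q t" using qI[OF _ Wz_b[OF 0]] 0 by (simp add: Wz)
        ultimately show False using z by (auto simp: bad_def)
      qed }
  qed
qed

text \<open>The value of \<open>u\<close> for which \<open>t\<close> is a root of \<open>g (with_u u y)\<close>.\<close>

definition cval :: "complex ^ 5 \<Rightarrow> complex \<Rightarrow> complex" where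
  "cval y t = 2 * poly (g (with_u 0 y)) t / (poly e0 t)\<^sup>2"

lemma cval_line: "cval (a + z *s b) t = cval a t + z * cval b t"
proof -
  have "poly (g (with_u 0 (a + z *s b))) t = poly (g (with_u 0 a)) t + z * poly (g (with_u 0 b)) t"
    by (simp add: g_def lam_def algebra_simps)
  then show ?thesis by (simp add: cval_def ring_distribs add_divide_distrib)
qed

lemma D_critical_value:
  assumes "poly (W y) t = 0" "poly e0 t \<noteq> 0"
  shows "D (with_u (cval y t) y) = 0"
proof -
  let ?g = "g (with_u (cval y t) y)"
  have g0: "poly ?g t = 0"
    using assms(2) by (subst g_with_u) (simp add: cval_def)
  moreover have "poly (pderiv ?g) t = 0"
    using W_eq[of "with_u (cval y t) y"] assms g0 by simp
  ultimately show ?thesis unfolding D_eq_0_iff by blast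
qed

text \<open>So the roots of \<open>W y\<close> are the critical points of \<open>cval y\<close>.\<close>

lemma cval_DERIV:
  assumes "poly e0 t \<noteq> 0"
  shows "(cval y has_field_derivative 2 * poly (W y) t / (poly e0 t) ^ 3) (at t)"
proof -
  let ?h = "g (with_u 0 y)"
  have W: "W y = pderiv ?h * e0 - smult 2 (?h * pderiv e0)" using W_eq[of "with_u 0 y"] by simp
  have "((\<lambda>z. poly (smult 2 ?h) z / poly (e0\<^sup>2) z) has_field_derivative
     (poly (pderiv (smult 2 ?h)) t * poly (e0\<^sup>2) t - poly (smult 2 ?h) t * poly (pderiv (e0\<^sup>2)) t) /
       (poly (e0\<^sup>2) t * poly (e0\<^sup>2) t)) (at t)"
    by (intro DERIV_divide poly_DERIV) (use assms in simp)
  also have "(poly (pderiv (smult 2 ?h)) t * poly (e0\<^sup>2) t - poly (smult 2 ?h) t * poly (pderiv (e0\<^sup>2)) t) /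
       (poly (e0\<^sup>2) t * poly (e0\<^sup>2) t) = 2 * poly (W y) t / (poly e0 t) ^ 3"
    using assms unfolding W
    by (simp add: pderiv_smult power2_eq_square pderiv_mult field_simps power3_eq_cube)
  also have "(\<lambda>z. poly (smult 2 ?h) z / poly (e0\<^sup>2) z) = cval y" by (simp add: cval_def fun_eq_iff)
  finally show ?thesis .
qed

lemma cval_separates:
  assumes "t \<notin> double_points" "poly e0 t \<noteq> 0" "poly e0 s \<noteq> 0" "s \<noteq> t"
  shows "\<exists>v. cval v t \<noteq> cval v s"
proof -
  have "\<not> same_point t s" using assms unfolding double_points_def by blast
  then obtain j where j: "j \<in> {1,2,3,4}" "poly (e $ j) t * poly e0 s \<noteq> poly (e $ j) s * poly e0 t"
    unfolding same_point_def by blast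
  have "\<exists>c. c \<noteq> 0 \<and> (\<forall>z. poly e0 z \<noteq> 0 \<longrightarrow> cval (axis j 1) z = c * (poly (e $ j) z / poly e0 z))"
    by (rule exI[of _ "if j = 4 then -2 else 2"])
       (use j(1) in \<open>auto simp: cval_def g_def lam_def axis_def power2_eq_square\<close>)
  then obtain c where c: "c \<noteq> 0" "\<And>z. poly e0 z \<noteq> 0 \<Longrightarrow> cval (axis j 1) z = c * (poly (e $ j) z / poly e0 z)"
    by blast
  have "cval (axis j 1) t \<noteq> cval (axis j 1) s"
    using c(1) j(2) assms(2,3) by (simp add: c(2) frac_eq_eq)
  then show ?thesis by blast
qed

text \<open>The envelope principle.  The critical point moves by \<open>O(h)\<close> as it is a simple root of \<open>W y\<close>; as \<open>cval y\<close> is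
  stationary there, this displacement does not contribute to the first order.\<close>

lemma cval_perturbed:
  assumes k: "kap y \<noteq> 0" and t: "poly (W y) t = 0" "poly (pderiv (W y)) t \<noteq> 0" and e: "poly e0 t \<noteq> 0"
  shows "\<exists>\<tau>. (\<forall>\<^sub>F h in at 0. poly (W (y + h *s v)) (\<tau> h) = 0 \<and> poly e0 (\<tau> h) \<noteq> 0) \<and>
    ((\<lambda>h. (cval (y + h *s v) (\<tau> h) - cval y t) / h) \<longlongrightarrow> cval v t) (at 0)"
proof -
  have lim0: "((\<lambda>h. kap y + h * kap v) \<longlongrightarrow> kap y) (at 0)" by (auto intro!: tendsto_eq_intros)
  have kl: "kap (y + h *s v) = kap y + h * kap v" for h by (simp add: kap_def W_line)
  have "\<exists>\<tau>. (\<forall>\<^sub>F h in at 0. poly (W (y + h *s v)) (\<tau> h) = 0) \<and> (\<tau> \<longlongrightarrow> t) (at 0)"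
  proof (rule root_tendsto[where d = "3 * N - 2" and L = "kap y"])
    show "\<forall>\<^sub>F h in at 0. degree (W (y + h *s v)) = 3 * N - 2"
      using tendsto_imp_eventually_ne[OF lim0 k] by eventually_elim (rule degree_W_exact, simp add: kl)
    show "((\<lambda>h. coeff (W (y + h *s v)) (3 * N - 2)) \<longlongrightarrow> kap y) (at 0)"
      using lim0 by (simp add: kap_def W_line)
    show "((\<lambda>h. poly (W (y + h *s v)) t) \<longlongrightarrow> 0) (at 0)"
      unfolding W_line using t by (auto intro!: tendsto_eq_intros)
  qed (use k N in auto)
  then obtain \<tau> where \<tau>: "\<forall>\<^sub>F h in at 0. poly (W (y + h *s v)) (\<tau> h) = 0" "(\<tau> \<longlongrightarrow> t) (at 0)" by blast
  have compose: "((\<lambda>h. f (\<tau> h)) \<longlongrightarrow> f t) (at 0)" if "isCont f t" for f :: "complex \<Rightarrow> complex"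
    using isCont_tendsto_compose[OF that \<tau>(2)] .
  \<comment> \<open>Caratheodory's form of the derivative needs no exception where \<open>\<tau> h = t\<close>\<close>
  obtain q1 where q1: "\<And>z. cval y z - cval y t = q1 z * (z - t)" "isCont q1 t" "q1 t = 0"
    using cval_DERIV[OF e, of y] t unfolding CARAT_DERIV by auto
  obtain q2 where q2: "\<And>z. poly (W y) z - poly (W y) t = q2 z * (z - t)" "isCont q2 t" "q2 t = poly (pderiv (W y)) t"
    using poly_DERIV[of "W y" t] unfolding CARAT_DERIV by auto
  have cont_v: "isCont (cval v) t" using DERIV_isCont[OF cval_DERIV[OF e]] .
  have ev_e: "\<forall>\<^sub>F h in at 0. poly e0 (\<tau> h) \<noteq> 0"
    using tendsto_imp_eventually_ne[OF compose[of "poly e0"] e] by simp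
  have "q2 t \<noteq> 0" using q2(3) t by simp
  then have ev_q: "\<forall>\<^sub>F h in at 0. q2 (\<tau> h) \<noteq> 0"
    using tendsto_imp_eventually_ne[OF compose[OF q2(2)]] by blast
  have "((\<lambda>h. - q1 (\<tau> h) * poly (W v) (\<tau> h) / q2 (\<tau> h) + cval v (\<tau> h)) \<longlongrightarrow>
      - q1 t * poly (W v) t / q2 t + cval v t) (at 0)"
    by (intro tendsto_add tendsto_divide tendsto_mult tendsto_minus compose q1 q2 cont_v)
       (use \<open>q2 t \<noteq> 0\<close> in auto)
  then have lim: "((\<lambda>h. - q1 (\<tau> h) * poly (W v) (\<tau> h) / q2 (\<tau> h) + cval v (\<tau> h)) \<longlongrightarrow> cval v t) (at 0)"
    by (simp add: q1)
  have "\<forall>\<^sub>F h in at 0. - q1 (\<tau> h) * poly (W v) (\<tau> h) / q2 (\<tau> h) + cval v (\<tau> h) = (cval (y + h *s v) (\<tau> h) - cval y t) / h"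
    using ev_q \<tau>(1) eventually_neq_at_within[of 0 0 UNIV]
  proof eventually_elim
    case (elim h)
    have "poly (W y) (\<tau> h) = - (h * poly (W v) (\<tau> h))"
      using elim by (simp add: W_line eq_neg_iff_add_eq_0)
    then have "q2 (\<tau> h) * (\<tau> h - t) = - (h * poly (W v) (\<tau> h))" using q2(1)[of "\<tau> h"] t by simp
    then have "\<tau> h - t = - (h * poly (W v) (\<tau> h)) / q2 (\<tau> h)" using elim by (simp add: field_simps)
    then have "cval y (\<tau> h) - cval y t = h * (- q1 (\<tau> h) * poly (W v) (\<tau> h) / q2 (\<tau> h))"
      using q1(1)[of "\<tau> h"] by simp
    then have "cval (y + h *s v) (\<tau> h) - cval y t = h * (- q1 (\<tau> h) * poly (W v) (\<tau> h) / q2 (\<tau> h) + cval v (\<tau> h))"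
      unfolding cval_line by (simp add: algebra_simps)
    then show ?case using elim by simp
  qed
  then have "((\<lambda>h. (cval (y + h *s v) (\<tau> h) - cval y t) / h) \<longlongrightarrow> cval v t) (at 0)"
    by (rule Lim_transform_eventually[OF lim])
  then show ?thesis using \<tau>(1) ev_e
    by (intro exI[of _ \<tau>]) (auto intro: eventually_conj)
qed

text \<open>With \<open>v\<close> separating the points of the spine curve at the critical points, the critical values of
  \<open>y + h v\<close> are distinct for small \<open>h\<close>: equal ones move apart by \<open>cval_perturbed\<close>, distinct ones stay so.\<close>

lemma generic_distinct_critical_values:
  assumes fin: "finite bitangents"
  shows "\<exists>y. y $ 0 \<noteq> 0 \<and> card {u. poly (Du y) u = 0} = 3 * N - 2"
proof -
  obtain y where y: "y $ 0 \<noteq> 0" "kap y \<noteq> 0" "\<And>t. t \<in> double_points \<Longrightarrow> poly (W y) t \<noteq> 0"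
    and sf: "\<And>t. poly (W y) t = 0 \<Longrightarrow> poly (pderiv (W y)) t \<noteq> 0"
    using generic_squarefree[OF finite_double_points[OF fin]] by blast
  define R where "R = {t. poly (W y) t = 0}"
  have finR: "finite R" unfolding R_def by (rule poly_roots_finite[OF W_nz[OF y(2)]])
  have cardR: "card R = 3 * N - 2"
    unfolding R_def using card_roots_squarefree[OF W_nz[OF y(2)] sf] degree_W_exact[OF y(2)] by simp
  have eR: "poly e0 t \<noteq> 0" if "t \<in> R" for t
  proof
    assume "poly e0 t = 0"
    then have "poly eta t = 0" using that y(1) by (simp add: R_def W_def)
    then show False using eta_at_root[OF \<open>poly e0 t = 0\<close>] e0_norm[OF \<open>poly e0 t = 0\<close>] e0_simple[OF \<open>poly e0 t = 0\<close>]
      by (simp add: gam_def)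
  qed
  define Pr where "Pr = {p \<in> R \<times> R. fst p \<noteq> snd p}"
  have "finite Pr" unfolding Pr_def using finR by auto
  have pcv: "polyfun (\<lambda>v. cval v t)" for t
  proof -
    have "polyfun (\<lambda>v. 2 / (poly e0 t)\<^sup>2 * (poly e0 t * poly (lam v) t - v $ 0 * (poly gam t / 2)))"
      by (intro polyfun_intros polyfam_poly[where K = N] degree_lam polyfam_lam)
    then show ?thesis by (simp add: cval_def g_def)
  qed
  have "\<exists>v. \<forall>p\<in>Pr. cval v (fst p) - cval v (snd p) \<noteq> 0"
  proof (rule polyfun_finite_prod_nonzero[OF \<open>finite Pr\<close>])
    show "polyfun (\<lambda>v. cval v (fst p) - cval v (snd p))" for p by (intro polyfun_intros pcv)
    fix p assume p: "p \<in> Pr"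
    then have "fst p \<notin> double_points" using y(3) by (auto simp: Pr_def R_def)
    then show "\<exists>v. cval v (fst p) - cval v (snd p) \<noteq> 0"
      using cval_separates[of "fst p" "snd p"] eR p by (auto simp: Pr_def)
  qed
  then obtain v where v: "\<And>t s. t \<in> R \<Longrightarrow> s \<in> R \<Longrightarrow> t \<noteq> s \<Longrightarrow> cval v t \<noteq> cval v s"
    by (auto simp: Pr_def)
  have "\<forall>t\<in>R. \<exists>\<tau>. (\<forall>\<^sub>F h in at 0. poly (W (y + h *s v)) (\<tau> h) = 0 \<and> poly e0 (\<tau> h) \<noteq> 0) \<and>
    ((\<lambda>h. (cval (y + h *s v) (\<tau> h) - cval y t) / h) \<longlongrightarrow> cval v t) (at 0)"
  proof
    fix t assume "t \<in> R"
    then show "\<exists>\<tau>. (\<forall>\<^sub>F h in at 0. poly (W (y + h *s v)) (\<tau> h) = 0 \<and> poly e0 (\<tau> h) \<noteq> 0) \<and>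
      ((\<lambda>h. (cval (y + h *s v) (\<tau> h) - cval y t) / h) \<longlongrightarrow> cval v t) (at 0)"
      using cval_perturbed[OF y(2) _ sf eR] by (simp add: R_def)
  qed
  from bchoice[OF this] obtain \<tau> where \<tau>: "\<And>t. t \<in> R \<Longrightarrow> \<forall>\<^sub>F h in at 0. poly (W (y + h *s v)) (\<tau> t h) = 0 \<and> poly e0 (\<tau> t h) \<noteq> 0"
    and lim: "\<And>t. t \<in> R \<Longrightarrow> ((\<lambda>h. (cval (y + h *s v) (\<tau> t h) - cval y t) / h) \<longlongrightarrow> cval v t) (at 0)"
    by blast
  define c where "c t h = cval (y + h *s v) (\<tau> t h)" for t h
  have c_lim: "((\<lambda>h. c t h) \<longlongrightarrow> cval y t) (at 0)" if "t \<in> R" for t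
  proof -
    have "((\<lambda>h. cval y t + h * ((c t h - cval y t) / h)) \<longlongrightarrow> cval y t + 0 * cval v t) (at 0)"
      using lim[OF that] unfolding c_def by (intro tendsto_intros)
    then have "((\<lambda>h. cval y t + h * ((c t h - cval y t) / h)) \<longlongrightarrow> cval y t) (at 0)" by simp
    then show ?thesis
      by (rule Lim_transform_eventually) (use eventually_neq_at_within[of 0 0 UNIV] in eventually_elim, simp)
  qed
  have sep: "\<forall>\<^sub>F h in at 0. c t h \<noteq> c s h" if ts: "t \<in> R" "s \<in> R" "t \<noteq> s" for t s
  proof (cases "cval y t = cval y s")
    case True
    have "((\<lambda>h. (c t h - cval y t) / h - (c s h - cval y s) / h) \<longlongrightarrow> cval v t - cval v s) (at 0)"
      unfolding c_def by (intro tendsto_diff lim ts)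
    then have "\<forall>\<^sub>F h in at 0. (c t h - cval y t) / h - (c s h - cval y s) / h \<noteq> 0"
      by (rule tendsto_imp_eventually_ne) (use v[OF ts] in simp)
    then show ?thesis by eventually_elim (use True in auto)
  next
    case False
    have "((\<lambda>h. c t h - c s h) \<longlongrightarrow> cval y t - cval y s) (at 0)"
      by (intro tendsto_diff c_lim ts)
    then have "\<forall>\<^sub>F h in at 0. c t h - c s h \<noteq> 0"
      by (rule tendsto_imp_eventually_ne) (use False in simp)
    then show ?thesis by eventually_elim auto
  qed
  have ev1: "\<forall>\<^sub>F h in at 0. \<forall>t\<in>R. \<forall>s\<in>R. t \<noteq> s \<longrightarrow> c t h \<noteq> c s h"
  proof (intro eventually_ball_finite ballI finR)
    fix t s assume "t \<in> R" "s \<in> R"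
    then show "\<forall>\<^sub>F h in at 0. t \<noteq> s \<longrightarrow> c t h \<noteq> c s h" by (cases "t = s") (auto intro: sep)
  qed
  have ev2: "\<forall>\<^sub>F h in at 0. \<forall>t\<in>R. poly (W (y + h *s v)) (\<tau> t h) = 0 \<and> poly e0 (\<tau> t h) \<noteq> 0"
    by (intro eventually_ball_finite ballI finR \<tau>)
  have "((\<lambda>h. y $ 0 + h * v $ 0) \<longlongrightarrow> y $ 0) (at 0)" by (auto intro!: tendsto_eq_intros)
  then have ev3: "\<forall>\<^sub>F h in at 0. y $ 0 + h * v $ 0 \<noteq> 0" by (rule tendsto_imp_eventually_ne) (rule y(1))
  obtain h where h: "\<And>t s. t \<in> R \<Longrightarrow> s \<in> R \<Longrightarrow> t \<noteq> s \<Longrightarrow> c t h \<noteq> c s h"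
    "\<And>t. t \<in> R \<Longrightarrow> poly (W (y + h *s v)) (\<tau> t h) = 0 \<and> poly e0 (\<tau> t h) \<noteq> 0" "y $ 0 + h * v $ 0 \<noteq> 0"
    using eventually_happens[OF eventually_conj[OF ev1 eventually_conj[OF ev2 ev3]]] by auto
  define x where "x = y + h *s v"
  have x0: "x $ 0 \<noteq> 0" using h(3) by (simp add: x_def)
  have Dx: "Du x \<noteq> 0" using coeff_Du_top[of x] lead_const_nz x0 by auto
  have "inj_on (\<lambda>t. c t h) R" using h(1) by (auto simp: inj_on_def)
  then have "3 * N - 2 = card ((\<lambda>t. c t h) ` R)" using cardR by (simp add: card_image)
  also have "\<dots> \<le> card {u. poly (Du x) u = 0}"
  proof (intro card_mono poly_roots_finite Dx subsetI)
    fix u assume "u \<in> (\<lambda>t. c t h) ` R"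
    then obtain t where t: "t \<in> R" "u = c t h" by blast
    have "D (with_u u x) = 0" unfolding t(2) c_def x_def[symmetric]
      by (rule D_critical_value) (use h(2)[OF t(1)] in \<open>auto simp: x_def\<close>)
    then show "u \<in> {u. poly (Du x) u = 0}" by (simp add: D_Du)
  qed
  finally have "3 * N - 2 \<le> card {u. poly (Du x) u = 0}" .
  moreover have "card {u. poly (Du x) u = 0} \<le> 3 * N - 2"
    using card_poly_roots_bound[OF Dx] degree_Du[of x] by linarith
  ultimately show ?thesis using x0 by (intro exI[of _ x]) auto
qed

end

section \<open>Lines, units and division with parameters\<close>

lemma polyfun_line_family:
  assumes "polyfun f"
  shows "\<exists>p. polyfam p \<and> (\<forall>a z. f (a + z *s b) = poly (p a) z)"
  using assms
proof (induction rule: polyfun_induct)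
  case (const c)
  show ?case by (rule exI[of _ "\<lambda>_. [:c:]"]) auto
next
  case (nth i)
  have "polyfam (\<lambda>a. smult (a $ i) 1 + [:0, b $ i:])"
    by (intro polyfam_add polyfam_smult polyfam_const polyfun_nth)
  then show ?case by (intro exI[of _ "\<lambda>a. smult (a $ i) 1 + [:0, b $ i:]"]) auto
next
  case (add f g)
  then obtain p q where "polyfam p" "polyfam q" "\<And>a z. f (a + z *s b) = poly (p a) z"
    "\<And>a z. g (a + z *s b) = poly (q a) z" by blast
  then show ?case by (intro exI[of _ "\<lambda>a. p a + q a"]) auto
next
  case (mult f g)
  then obtain p q where "polyfam p" "polyfam q" "\<And>a z. f (a + z *s b) = poly (p a) z"
    "\<And>a z. g (a + z *s b) = poly (q a) z" by blast
  then show ?case by (intro exI[of _ "\<lambda>a. p a * q a"]) auto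
qed

text \<open>Scaling by \<open>c\<close> and letting \<open>c\<close> tend to 0 compares the line through \<open>a\<close> with the one through 0.\<close>

lemma homogeneous_on_line:
  assumes hom: "\<And>c a. f (c *s a) = c ^ d * f a" and p: "polyfam p" "\<And>a z. f (a + z *s b) = poly (p a) z"
  shows "degree (p a) \<le> d" "coeff (p a) d = f b"
proof -
  have key: "\<exists>r. monom 1 k * r = monom (coeff (p a) k) d \<and> poly r 0 = coeff (p 0) k" for k
  proof -
    obtain r where r: "\<And>c. coeff (p (0 + c *s a)) k = poly r c"
      using polyfun_line[OF polyfam_coeff[OF p(1), of k], of 0 a] by blast
    have "monom 1 k * r = monom (coeff (p a) k) d"
    proof (rule poly_eqI_cofinite[of 0])
      fix c :: complex assume "c \<noteq> 0"
      have "pcompose (p (c *s a)) [:0, c:] = smult (c ^ d) (p a)"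
      proof (rule poly_eqI_poly)
        fix z
        have "c *s a + (z * c) *s b = c *s (a + z *s b)"
          by (simp add: Finite_Cartesian_Product.vec_eq_iff algebra_simps)
        moreover have "poly (pcompose (p (c *s a)) [:0, c:]) z = f (c *s a + (z * c) *s b)"
          by (simp only: p(2)) (simp add: poly_pcompose)
        ultimately show "poly (pcompose (p (c *s a)) [:0, c:]) z = poly (smult (c ^ d) (p a)) z"
          by (simp only: hom) (simp add: p(2))
      qed
      then have "c ^ k * coeff (p (c *s a)) k = c ^ d * coeff (p a) k"
        by (metis coeff_pcompose_linear coeff_smult)
      then show "poly (monom 1 k * r) c = poly (monom (coeff (p a) k) d) c"
        using r[of c] by (simp add: poly_monom mult.commute)
    qed
    then show ?thesis using r[of 0] by (intro exI[of _ r]) simp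
  qed
  show "degree (p a) \<le> d"
  proof (rule degree_le, intro allI impI)
    fix k assume "d < k"
    obtain r where "monom 1 k * r = monom (coeff (p a) k) d" using key by blast
    then have "coeff (monom 1 k * r) d = coeff (p a) k" by simp
    then show "coeff (p a) k = 0" using \<open>d < k\<close> by (simp add: coeff_monom_mult)
  qed
  obtain r where r: "monom 1 d * r = monom (coeff (p a) d) d" "poly r 0 = coeff (p 0) d" using key by blast
  have "coeff (monom 1 d * r) d = coeff (p a) d" using r(1) by simp
  then have "coeff r 0 = coeff (p a) d" by (simp add: coeff_monom_mult)
  moreover have "p 0 = monom (f b) d"
    by (rule poly_eqI_poly) (simp add: p(2)[symmetric] hom poly_monom mult.commute)
  ultimately show "coeff (p a) d = f b" using r(2) by (simp add: poly_0_coeff_0)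
qed

lemma polyfun_unit_const:
  assumes "polyfun a" "polyfun b" "\<And>x. a x * b x = 1"
  shows "a x = a y"
proof -
  obtain p where p: "\<And>z. a (x + z *s (y - x)) = poly p z" using polyfun_line[OF assms(1)] by blast
  obtain q where q: "\<And>z. b (x + z *s (y - x)) = poly q z" using polyfun_line[OF assms(2)] by blast
  have "p * q = 1" by (rule poly_eqI_poly) (simp add: p[symmetric] q[symmetric] assms(3))
  then have "p dvd 1" by (metis dvd_triv_left)
  then obtain c where "p = [:c:]" by (auto simp: is_unit_poly_iff)
  then show ?thesis using p[of 0] p[of 1] by simp
qed

lemma pseudo_division_family:
  assumes q: "polyfam q" "\<And>y. degree (q y) \<le> d" and d: "d > 0"
    and p: "polyfam p" "\<And>y. degree (p y) \<le> K"
  shows "\<exists>m S r L. polyfam S \<and> (\<forall>y. degree (S y) \<le> L) \<and> polyfam r \<and> (\<forall>y. degree (r y) < d) \<and>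
    (\<forall>y. smult (coeff (q y) d ^ m) (p y) = q y * S y + r y)"
  using p
proof (induction K arbitrary: p)
  case 0
  then show ?case using d
    by (intro exI[of _ 0] exI[of _ "\<lambda>_. 0"] exI[of _ p] exI[of _ 0]) auto
next
  case (Suc K)
  show ?case
  proof (cases "Suc K < d")
    case True
    then show ?thesis using Suc.prems
      by (intro exI[of _ 0] exI[of _ "\<lambda>_. 0"] exI[of _ p] exI[of _ 0]) (auto intro: le_less_trans)
  next
    case False
    define c where "c y = smult (coeff (p y) (Suc K)) (monom 1 (Suc K - d))" for y
    define p' where "p' y = smult (coeff (q y) d) (p y) - c y * q y" for y
    have c: "polyfam c" unfolding c_def by (intro polyfam_smult polyfam_coeff Suc.prems polyfam_const)
    have p': "polyfam p'" unfolding p'_def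
      by (intro polyfam_diff polyfam_smult polyfam_coeff polyfam_mult c q(1) Suc.prems)
    have "degree (p' y) \<le> K" for y
    proof (rule degree_le, intro allI impI)
      fix k assume "K < k"
      have dc: "degree (c y) \<le> Suc K - d"
        unfolding c_def by (rule order.trans[OF degree_smult_le degree_monom_le])
      have sum: "Suc K = (Suc K - d) + d" using False by simp
      show "coeff (p' y) k = 0"
      proof (cases "k = Suc K")
        case True
        have "coeff (c y * q y) (Suc K) = coeff (c y) (Suc K - d) * coeff (q y) d"
          by (subst sum, rule coeff_mult_top[OF dc q(2)])
        moreover have "coeff (c y) (Suc K - d) = coeff (p y) (Suc K)" by (simp add: c_def)
        ultimately show ?thesis unfolding p'_def True by simp
      next
        case False
        then have "k > Suc K" using \<open>K < k\<close> by simp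
        moreover have "degree (c y * q y) \<le> Suc K"
          using degree_mult_le[of "c y" "q y"] dc q(2)[of y] sum by linarith
        ultimately show ?thesis using Suc.prems(2)[of y] by (simp add: p'_def coeff_eq_0)
      qed
    qed
    from Suc.IH[OF p' this] obtain m S r L where IH: "polyfam S" "\<And>y. degree (S y) \<le> L" "polyfam r"
      "\<And>y. degree (r y) < d" "\<And>y. smult (coeff (q y) d ^ m) (p' y) = q y * S y + r y" by blast
    define S' where "S' y = S y + smult (coeff (q y) d ^ m) (c y)" for y
    have "polyfam S'" unfolding S'_def
      by (intro polyfam_add polyfam_smult polyfun_power polyfam_coeff IH c q(1))
    moreover have "degree (S' y) \<le> max L (Suc K)" for y
    proof -
      have "degree (c y) \<le> Suc K"
        unfolding c_def by (rule order.trans[OF degree_smult_le order.trans[OF degree_monom_le]]) simp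
      then show ?thesis unfolding S'_def using IH(2)[of y]
        by (intro degree_add_le order.trans[OF degree_smult_le]) auto
    qed
    moreover have "smult (coeff (q y) d ^ Suc m) (p y) = q y * S' y + r y" for y
    proof -
      have "smult (coeff (q y) d ^ Suc m) (p y) = smult (coeff (q y) d ^ m) (p' y + c y * q y)"
        by (simp add: p'_def mult.commute)
      also have "\<dots> = q y * S y + r y + smult (coeff (q y) d ^ m) (c y * q y)"
        by (simp only: smult_add_right IH(5))
      finally show ?thesis by (simp add: S'_def algebra_simps)
    qed
    ultimately show ?thesis using IH(3,4)
      by (intro exI[of _ "Suc m"] exI[of _ S'] exI[of _ r] exI[of _ "max L (Suc K)"]) blast
  qed
qed

section \<open>The ideal of the discriminant\<close>

context spine
begin

lemma om_wronskian: "om y = pderiv (lam y) * e0 - lam y * pderiv e0"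
  by (rule poly_eqI_poly)
     (simp add: om_def lam_def wvec_def pderiv_add pderiv_diff pderiv_smult algebra_simps)

text \<open>For \<open>y\<^sub>0 = 0\<close> the form \<open>g\<close> is \<open>e\<^sub>0 (lam - (u/2) e\<^sub>0)\<close>.  A multiple root of the second factor is a root of
  the Wronskian \<open>om\<close> and determines \<open>u\<close>, so that \<open>g\<close> is squarefree for almost all \<open>u\<close>.\<close>

lemma D_nonzero: "\<exists>x. x $ Some 0 = 0 \<and> D x \<noteq> 0"
proof -
  let ?f = "\<lambda>a y. case a of None \<Rightarrow> kap' y | Some t \<Rightarrow> poly (lam y) t"
  have "\<exists>y. \<forall>a\<in>insert None (Some ` {t. poly e0 t = 0}). ?f a y \<noteq> 0"
  proof (rule polyfun_finite_prod_nonzero)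
    show "finite (insert None (Some ` {t. poly e0 t = 0}))"
      using poly_roots_finite[OF e0_nz] by simp
    show "polyfun (?f a)" for a
      by (cases a) (auto intro!: polyfam_poly[where K = N] degree_lam)
    show "\<exists>y. ?f a y \<noteq> 0" if a: "a \<in> insert None (Some ` {t. poly e0 t = 0})" for a
    proof (cases a)
      case None
      then show ?thesis using rho_nonzero by auto
    next
      case (Some t)
      then obtain j where j: "j \<in> {1,2,3,4}" "poly (e $ j) t \<noteq> 0" using a no_common_root by auto
      then have "poly (lam (axis j 1)) t \<noteq> 0" by (auto simp: lam_def axis_def)
      then show ?thesis using Some by auto
    qed
  qed
  then obtain y1 where y1: "kap' y1 \<noteq> 0" "\<And>t. poly e0 t = 0 \<Longrightarrow> poly (lam y1) t \<noteq> 0" by auto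
  define y where "y = zero_at 0 y1"
  have "lam y = lam y1" by (simp add: y_def lam_def zero_at_nth)
  moreover have "om y = om y1" by (simp add: y_def)
  ultimately have y: "y $ 0 = 0" "om y \<noteq> 0" "\<And>t. poly e0 t = 0 \<Longrightarrow> poly (lam y) t \<noteq> 0"
    using y1 om_nz[OF y1(1)] by (auto simp: y_def zero_at_nth)
  define bad where "bad = insert (coeff (lam y) N / coeff e0 N) ((\<lambda>t. poly (lam y) t / poly e0 t) ` {t. poly (om y) t = 0})"
  have "finite bad" unfolding bad_def using poly_roots_finite[OF y(2)] by simp
  then obtain z where z: "z \<notin> bad" using ex_new_if_finite infinite_UNIV_char_0 by blast
  define x where "x = with_u (2 * z) y"
  define q where "q = lam y - smult z e0"
  have g: "g x = e0 * q"
    using y(1) by (simp add: x_def g_def q_def power2_eq_square algebra_simps)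
  have "D x \<noteq> 0"
  proof
    assume "D x = 0"
    then consider t where "poly (g x) t = 0" "poly (pderiv (g x)) t = 0" | "coeff (g x) (2 * N) = 0"
      unfolding D_eq_0_iff by blast
    then show False
    proof cases
      case 1
      have e: "poly e0 t \<noteq> 0"
      proof
        assume e: "poly e0 t = 0"
        then have "poly (pderiv e0) t * poly (lam y) t = 0"
          using 1(2) by (auto simp: g pderiv_mult q_def)
        then show False using e0_simple[OF e] y(3)[OF e] by simp
      qed
      then have q0: "poly q t = 0" using 1(1) by (simp add: g)
      then have "poly (pderiv q) t = 0" using 1(2) e by (simp add: g pderiv_mult)
      then have l: "poly (lam y) t = z * poly e0 t" "poly (pderiv (lam y)) t = z * poly (pderiv e0) t"
        using q0 by (simp_all add: q_def pderiv_diff pderiv_smult)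
      have "poly (om y) t = 0" unfolding om_wronskian by (simp add: l)
      moreover have "z = poly (lam y) t / poly e0 t" using l e by simp
      ultimately show False using z by (auto simp: bad_def)
    next
      case 2
      have "degree q \<le> N" unfolding q_def using degree_lam degree_e0
        by (intro degree_diff_le order.trans[OF degree_smult_le]) auto
      then have "coeff (g x) (2 * N) = coeff e0 N * (coeff (lam y) N - z * coeff e0 N)"
        using coeff_mult_top[of e0 N q N] degree_e0 by (simp add: g q_def mult_2)
      then have "z = coeff (lam y) N / coeff e0 N" using 2 coeff_e0 by (simp add: field_simps)
      then show False using z by (simp add: bad_def)
    qed
  qed
  then show ?thesis using y(1) by (intro exI[of _ x]) (simp add: x_def)
qed

lemma with_u_nz: "y $ 0 \<noteq> 0 \<Longrightarrow> with_u u y \<noteq> 0"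
  by (metis with_u_nth(2) zero_index)

text \<open>Dividing by \<open>Du\<close> with powers of its leading coefficient \<open>lead_const y\<^sub>0\<^sup>N\<close> as denominators, the remainder has for
  generic \<open>y\<close> all the \<open>3N - 2\<close> distinct roots of \<open>Du y\<close> and is therefore 0.  The power of \<open>y\<^sub>0\<close> can be
  cancelled since \<open>D\<close> does not vanish on \<open>y\<^sub>0 = 0\<close>.\<close>

lemma D_generates_ideal:
  assumes fin: "finite bitangents" and P: "polyfun P" and van: "\<And>x. x \<noteq> 0 \<Longrightarrow> D x = 0 \<Longrightarrow> P x = 0"
  shows "\<exists>S. polyfun S \<and> (\<forall>x. P x = D x * S x)"
proof -
  define d where "d = 3 * N - 2"
  have d: "d > 0" using N by (simp add: d_def)
  obtain p K where p: "polyfam p" "\<And>y. degree (p y) \<le> K" "\<And>x. P x = poly (p (Phi x)) (x $ None)"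
    using polyfun_expand_None[OF P] by blast
  obtain m S r L where S: "polyfam S" "\<And>y. degree (S y) \<le> L" and r: "polyfam r" "\<And>y. degree (r y) < d"
    and div: "\<And>y. smult (coeff (Du y) d ^ m) (p y) = Du y * S y + r y"
    using pseudo_division_family[OF polyfam_Du degree_Du[folded d_def] d p(1,2)] by blast
  \<comment> \<open>the discriminant in \<open>u\<close>: a polynomial, so that squarefreeness at one \<open>y\<close> gives it for generic \<open>y\<close>\<close>
  define \<delta> where "\<delta> y = res d (d - 1) (Du y) (pderiv (Du y))" for y
  have p\<delta>: "polyfun \<delta>" unfolding \<delta>_def by (intro polyfun_res polyfam_Du polyfam_pderiv)
  have deg: "degree (Du y) = d" "Du y \<noteq> 0" if "y $ 0 \<noteq> 0" for y
  proof -
    have "coeff (Du y) d \<noteq> 0" using coeff_Du_top[of y] lead_const_nz that by (simp add: d_def)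
    then show "degree (Du y) = d" "Du y \<noteq> 0" using degree_Du[of y] le_degree[of "Du y" d] by (auto simp: d_def)
  qed
  have \<delta>_iff: "\<delta> y \<noteq> 0 \<longleftrightarrow> (\<forall>t. poly (Du y) t = 0 \<longrightarrow> poly (pderiv (Du y)) t \<noteq> 0)" if y: "y $ 0 \<noteq> 0" for y
  proof -
    have "\<delta> y = lead_coeff (Du y) ^ (d - 1) * rprod (Du y) (pderiv (Du y))"
      unfolding \<delta>_def by (rule res_eq_rprod) (simp_all add: deg[OF y] degree_pderiv)
    then show ?thesis using rprod_eq_0_iff[OF deg(2)[OF y]] deg(2)[OF y] by auto
  qed
  obtain y1 where y1: "y1 $ 0 \<noteq> 0" "card {u. poly (Du y1) u = 0} = d"
    using generic_distinct_critical_values[OF fin] by (auto simp: d_def)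
  have \<delta>1: "\<delta> y1 \<noteq> 0"
  proof (subst \<delta>_iff[OF y1(1)], intro allI impI notI)
    fix t assume t: "poly (Du y1) t = 0" "poly (pderiv (Du y1)) t = 0"
    then obtain q where q: "Du y1 = [:-t, 1:] * q" by (auto simp: poly_eq_0_iff_dvd dvd_def)
    have "pderiv (Du y1) = [:-t, 1:] * pderiv q + q"
      unfolding q pderiv_mult by (simp add: pderiv_pCons)
    then have "poly q t = 0" using t(2) by simp
    then have "{u. poly (Du y1) u = 0} = {u. poly q u = 0}" by (auto simp: q)
    moreover have "q \<noteq> 0" using q deg(2)[OF y1(1)] by auto
    moreover have "degree q = d - 1"
      using deg(1)[OF y1(1)] \<open>q \<noteq> 0\<close> unfolding q by (subst (asm) degree_mult_eq) auto
    ultimately show False using card_poly_roots_bound[of q] y1(2) d by auto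
  qed
  have r0: "r y = 0" if y: "y $ 0 \<noteq> 0" "\<delta> y \<noteq> 0" for y
  proof (rule ccontr)
    assume ne: "r y \<noteq> 0"
    have "card {u. poly (Du y) u = 0} = d"
      using card_roots_squarefree[OF deg(2)[OF y(1)]] \<delta>_iff[OF y(1)] y(2) deg(1)[OF y(1)] by simp
    moreover have "{u. poly (Du y) u = 0} \<subseteq> {u. poly (r y) u = 0}"
    proof
      fix u assume "u \<in> {u. poly (Du y) u = 0}"
      then have u: "poly (Du y) u = 0" by simp
      then have "P (with_u u y) = 0"
        using van[OF with_u_nz[OF y(1)]] by (simp add: D_Du)
      then have "poly (p y) u = 0" by (simp add: p(3))
      then show "u \<in> {u. poly (r y) u = 0}"
        using arg_cong[OF div[of y], of "\<lambda>q. poly q u"] u by simp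
    qed
    ultimately have "d \<le> card {u. poly (r y) u = 0}"
      using card_mono[OF poly_roots_finite[OF ne]] by metis
    then show False using card_poly_roots_bound[OF ne] r(2)[of y] by linarith
  qed
  have r_zero: "r y = 0" for y
  proof (rule poly_eqI)
    fix k
    obtain v where v: "\<delta> v * v $ 0 \<noteq> 0" using y1(1) \<delta>1 by (intro that[of y1]) simp
    show "coeff (r y) k = coeff 0 k"
    proof (rule polyfun_eq_generic[where f = "\<lambda>y. coeff (r y) k" and h = "\<lambda>y. \<delta> y * y $ 0", OF _ _ _ v])
      show "polyfun (\<lambda>y. \<delta> y * y $ 0)" by (intro polyfun_intros p\<delta>)
    qed (use r(1) r0 in auto)
  qed
  define S' where "S' x = poly (S (Phi x)) (x $ None)" for x
  have pS': "polyfun S'"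
  proof -
    have "polyfam (\<lambda>x :: complex ^ (5 option). S (Phi x))"
      unfolding polyfam_def
    proof
      fix k
      show "polyfun (\<lambda>x :: complex ^ (5 option). coeff (S (Phi x)) k)"
        by (rule polyfun_compose[OF polyfam_coeff[OF S(1)]]) (simp add: Phi_def)
    qed
    then show ?thesis unfolding S'_def by (intro polyfam_poly[where K = L] S(2) polyfun_nth)
  qed
  have eq: "S' x * D x = (x $ Some 0) ^ (N * m) * (lead_const ^ m * P x)" for x
    using arg_cong[OF div[of "Phi x"], of "\<lambda>q. poly q (x $ None)"] coeff_Du_top[of "Phi x"]
    by (simp add: r_zero S'_def D_Du p(3) d_def power_mult_distrib power_mult Phi_def mult_ac)
  obtain z where z: "D z \<noteq> 0" "z $ Some 0 = 0" using D_nonzero by blast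
  have "polyfun (\<lambda>x. lead_const ^ m * P x)" by (intro polyfun_intros P)
  from polyfun_divide_coordinate[OF pS' polyfun_D this z eq]
  obtain h where h: "polyfun h" "\<And>x. h x * D x = lead_const ^ m * P x" by blast
  show ?thesis
  proof (intro exI[of _ "\<lambda>x. inverse (lead_const ^ m) * h x"] conjI allI)
    show "polyfun (\<lambda>x. inverse (lead_const ^ m) * h x)" by (intro polyfun_intros h)
    show "P x = D x * (inverse (lead_const ^ m) * h x)" for x
      using h(2)[of x] lead_const_nz by (simp add: field_simps)
  qed
qed

text \<open>Let \<open>y\<^sub>0 = 0\<close> and choose \<open>v\<close> in this hyperplane with \<open>F v\<close> nonzero.  By homogeneity \<open>F\<close> has constant degree
  and leading coefficient on the lines of direction \<open>v\<close>, so the root \<open>y\<close> on the line through \<open>y\<close> follows when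
  the line is moved out of the hyperplane.\<close>

lemma F_closure:
  assumes y: "F y = 0" and P: "polyfun P" and van: "\<And>z. z $ 0 \<noteq> 0 \<Longrightarrow> F z = 0 \<Longrightarrow> P z = 0"
  shows "P y = 0"
proof (cases "y $ 0 = 0")
  case True
  obtain v where v: "v $ 0 = 0" "F v \<noteq> 0" using F_nonzero by blast
  let ?a = "axis 0 1 :: complex ^ 5" and ?d = "6 * N - 4"
  obtain p where p: "polyfam p" "\<And>a z. F (a + z *s v) = poly (p a) z"
    using polyfun_line_family[OF polyfun_F, of v] by blast
  note top = homogeneous_on_line[OF F_scale p]
  obtain f where f: "\<And>h. F (y + h *s ?a) = poly f h" using polyfun_line[OF polyfun_F] by blast
  have deg: "degree (p a) = ?d" for a
    using top(1)[of a] le_degree[of "p a" ?d] top(2)[of a] v(2) by simp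
  have "\<exists>\<tau>. (\<forall>\<^sub>F h in at 0. poly (p (y + h *s ?a)) (\<tau> h) = 0) \<and> (\<tau> \<longlongrightarrow> 0) (at 0)"
  proof (rule root_tendsto[where d = ?d and L = "F v"])
    have "((\<lambda>h. poly f h) \<longlongrightarrow> poly f 0) (at 0)" by (intro tendsto_intros)
    moreover have "poly f 0 = 0" using f[of 0] y by simp
    moreover have "poly (p (y + h *s ?a)) 0 = poly f h" for h
      using p(2)[of "y + h *s ?a" 0] f[of h] by simp
    ultimately show "((\<lambda>h. poly (p (y + h *s ?a)) 0) \<longlongrightarrow> 0) (at 0)" by simp
  qed (use deg top(2) v N in auto)
  then obtain \<tau> where \<tau>: "\<forall>\<^sub>F h in at 0. poly (p (y + h *s ?a)) (\<tau> h) = 0" "(\<tau> \<longlongrightarrow> 0) (at 0)" by blast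
  have "((\<lambda>h. y + h *s ?a + \<tau> h *s v) \<longlongrightarrow> y) (at 0)"
  proof (rule vec_tendstoI)
    fix i
    have "((\<lambda>h. y $ i + h * ?a $ i + \<tau> h * v $ i) \<longlongrightarrow> y $ i + 0 * ?a $ i + 0 * v $ i) (at 0)"
      by (intro tendsto_intros \<tau>(2))
    then show "((\<lambda>h. (y + h *s ?a + \<tau> h *s v) $ i) \<longlongrightarrow> y $ i) (at 0)" by simp
  qed
  then have lim: "((\<lambda>h. P (y + h *s ?a + \<tau> h *s v)) \<longlongrightarrow> P y) (at 0)" by (rule polyfun_tendsto[OF P])
  have "\<forall>\<^sub>F h in at 0. P (y + h *s ?a + \<tau> h *s v) = 0"
    using \<tau>(1) eventually_neq_at_within[of 0 0 UNIV]
  proof eventually_elim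
    case (elim h)
    have "(y + h *s ?a + \<tau> h *s v) $ 0 \<noteq> 0" using elim True v(1) by (simp add: axis_def)
    moreover have "F (y + h *s ?a + \<tau> h *s v) = 0" using elim by (simp only: p(2))
    ultimately show ?case by (rule van)
  qed
  then have "((\<lambda>h. P (y + h *s ?a + \<tau> h *s v)) \<longlongrightarrow> 0) (at 0)" by (rule tendsto_eventually)
  then show ?thesis using lim by (intro tendsto_unique[OF _ lim]) auto
qed (use y van in auto)

section \<open>The tangent lines of the lifted curve\<close>

text \<open>The vector \<open>E\<close> of the lifted curve with complex coefficients; \<open>plk\<close> are the coordinates of its Pluecker curve.\<close>

definition EE :: "5 option \<Rightarrow> complex poly" where
  "EE k = (case k of None \<Rightarrow> smult (- 1 / 2) (e0\<^sup>2)
    | Some j \<Rightarrow> if j = 0 then smult (- 1 / 2) gam else if j = 4 then - (e0 * e $ 4) else e0 * e $ j)"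

definition plk :: "5 option \<Rightarrow> 5 option \<Rightarrow> complex poly" where
  "plk j k = EE j * pderiv (EE k) - EE k * pderiv (EE j)"

end

lemma exhaust_5: "(j :: 5) = 0 \<or> j = 1 \<or> j = 2 \<or> j = 3 \<or> j = 4"
proof (induct j)
  case (of_int z)
  then have "0 \<le> z" "z < 5" by simp_all
  then have "z = 0 \<or> z = 1 \<or> z = 2 \<or> z = 3 \<or> z = 4" by arith
  then show ?case by auto
qed

lemma UNIV_5_option: "(UNIV :: 5 option set) = {None, Some 0, Some 1, Some 2, Some 3, Some 4}"
proof -
  have "k \<in> {None, Some 0, Some 1, Some 2, Some 3, Some 4}" for k :: "5 option"
    by (cases k) (use exhaust_5 in auto)
  then show ?thesis by blast
qed

context spine
begin

lemma g_sum: "g x = (\<Sum>k\<in>UNIV. smult (x $ k) (EE k))"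
  by (simp add: UNIV_5_option EE_def g_def lam_def Phi_def algebra_simps)

text \<open>The vector \<open>e\<^sub>0 E' - 2 e\<^sub>0' E\<close>, a multiple of the derivative of \<open>E/e\<^sub>0\<^sup>2\<close>.\<close>

definition VV :: "5 option \<Rightarrow> complex poly" where
  "VV k = (case k of None \<Rightarrow> 0 | Some j \<Rightarrow> if j = 0 then - eta else if j = 4 then - (e0 * w $ 4) else e0 * w $ j)"

lemma VV_eq: "e0 * pderiv (EE k) - smult 2 (pderiv e0 * EE k) = VV k"
proof (rule poly_eqI_poly)
  fix t
  show "poly (e0 * pderiv (EE k) - smult 2 (pderiv e0 * EE k)) t = poly (VV k) t"
    by (cases k) (auto simp: VV_def EE_def wvec_def eta_def gam_def lorentz_def pderiv_mult pderiv_smult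
        pderiv_minus pderiv_add pderiv_diff power2_eq_square algebra_simps)
qed

lemma plk_VV: "e0 * plk j k = EE j * VV k - EE k * VV j"
  by (simp add: plk_def VV_eq[symmetric] algebra_simps)

lemma plk_None: "j \<in> {1,2,3,4} \<Longrightarrow> plk None (Some j) = smult (1/2) (e0\<^sup>2 * w $ j) \<or> plk None (Some j) = smult (-1/2) (e0\<^sup>2 * w $ j)"
proof -
  assume "j \<in> {1,2,3,4}"
  then have "e0 * plk None (Some j) = e0 * smult (1/2) (e0\<^sup>2 * w $ j) \<or> e0 * plk None (Some j) = e0 * smult (-1/2) (e0\<^sup>2 * w $ j)"
    by (auto simp: plk_VV VV_def EE_def mult_ac)
  then show ?thesis using mult_left_cancel[OF e0_nz] by blast
qed

text \<open>With \<open>plk_top_nonzero\<close>: the Pluecker coordinates have no common zero, of formal degree \<open>4N - 2\<close>, on the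
  projective line.  So \<open>E'\<close> and its companion \<open>2N E - t E'\<close> span the fibre of the module at every parameter.\<close>

lemma plk_nonzero: "\<exists>j k. poly (plk j k) t \<noteq> 0"
proof (cases "poly e0 t = 0")
  case False
  obtain j where j: "j \<in> {1,2,3,4}" "poly (w $ j) t \<noteq> 0" using immersed by blast
  then show ?thesis using plk_None[OF j(1)] False by (intro exI[of _ None] exI[of _ "Some j"]) auto
next
  case True
  obtain j where j: "j \<in> {1,2,3,4}" "poly (e $ j) t \<noteq> 0" using no_common_root[OF True] by blast
  have "poly (plk (Some 0) (Some j)) t \<noteq> 0"
    using j True e0_norm[OF True] e0_simple[OF True]
    by (auto simp: plk_def EE_def gam_def pderiv_mult pderiv_minus pderiv_smult)
  then show ?thesis by blast
qed

lemma plk_top_nonzero: "\<exists>j k. coeff (plk j k) (4 * N - 2) \<noteq> 0"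
proof -
  obtain j where j: "j \<in> {1,2,3,4}" "coeff (w $ j) (2 * N - 2) \<noteq> 0" using immersed_infinity by blast
  have "4 * N - 2 = (N + N) + (2 * N - 2)" using N by simp
  then have "coeff (e0\<^sup>2 * w $ j) (4 * N - 2) = (coeff e0 N)\<^sup>2 * coeff (w $ j) (2 * N - 2)"
    using coeff_mult_top[of "e0\<^sup>2" "N + N" "w $ j" "2 * N - 2"] coeff_mult_top[of e0 N e0 N]
      degree_mult_le[of e0 e0] degree_e0 degree_w[of j] by (simp add: power2_eq_square)
  then show ?thesis using plk_None[OF j(1)] j(2) coeff_e0
    by (intro exI[of _ None] exI[of _ "Some j"]) auto
qed

lemma degree_EE: "degree (EE k) \<le> 2 * N"
proof -
  have "degree (e0\<^sup>2) \<le> 2 * N" "degree (e0 * e $ j) \<le> 2 * N" for j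
    using degree_mult_le[of e0 e0] degree_mult_le[of e0 "e $ j"] degree_e0 degree_e[of j]
    by (simp_all add: power2_eq_square)
  then show ?thesis
    unfolding EE_def using degree_gam by (auto split: option.split intro: order.trans[OF degree_smult_le])
qed

lemma plk_bitangent:
  assumes ts: "poly e0 t \<noteq> 0" "poly e0 s \<noteq> 0" "same_point t s"
    and c: "\<And>j. j \<in> {1,2,3,4} \<Longrightarrow> poly (w $ j) t = c * poly (w $ j) s"
  shows "\<exists>\<mu>. \<forall>j k. poly (plk j k) t = \<mu> * poly (plk j k) s"
proof -
  define \<nu> where "\<nu> = poly e0 t / poly e0 s"
  have e0: "poly e0 t = \<nu> * poly e0 s" using ts by (simp add: \<nu>_def)
  have ej: "poly (e $ j) t = \<nu> * poly (e $ j) s" if "j \<in> {1,2,3,4}" for j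
    using bspec[OF ts(3)[unfolded same_point_def] that] ts by (simp add: \<nu>_def field_simps)
  have ej': "poly (e $ j) t = \<nu> * poly (e $ j) s" and c': "poly (w $ j) t = c * poly (w $ j) s" if "j \<noteq> 0" for j
    using exhaust_5[of j] that ej[of j] c[of j] by auto
  have E: "poly (EE k) t = \<nu>\<^sup>2 * poly (EE k) s" for k
    by (cases k) (auto simp: EE_def e0 ej' gam_def lorentz_def power2_eq_square algebra_simps)
  have V: "poly (VV k) t = \<nu> * c * poly (VV k) s" for k
    by (cases k) (auto simp: VV_def e0 ej' c' eta_def lorentz_def algebra_simps)
  have "\<nu> \<noteq> 0" using ts by (simp add: \<nu>_def)
  have "poly (plk j k) t = (\<nu>\<^sup>2 * c) * poly (plk j k) s" for j k
  proof -
    have "poly e0 t * poly (plk j k) t = poly (EE j) t * poly (VV k) t - poly (EE k) t * poly (VV j) t"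
      using arg_cong[OF plk_VV[of j k], of "\<lambda>p. poly p t"] by simp
    also have "\<dots> = \<nu> ^ 3 * c * (poly (EE j) s * poly (VV k) s - poly (EE k) s * poly (VV j) s)"
      by (simp add: E V algebra_simps power2_eq_square power3_eq_cube)
    also have "\<dots> = \<nu> ^ 3 * c * (poly e0 s * poly (plk j k) s)"
      using arg_cong[OF plk_VV[of j k], of "\<lambda>p. poly p s"] by simp
    also have "\<dots> = poly e0 t * ((\<nu>\<^sup>2 * c) * poly (plk j k) s)"
      by (simp add: e0 power2_eq_square power3_eq_cube)
    finally show ?thesis using ts by simp
  qed
  then show ?thesis by blast
qed

end

section \<open>Homogenizations and their common zeros\<close>

definition cpoly :: "real poly \<Rightarrow> complex poly" where "cpoly = map_poly complex_of_real"

lemma coeff_cpoly [simp]: "coeff (cpoly p) k = complex_of_real (coeff p k)"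
  by (simp add: cpoly_def coeff_map_poly)

lemma degree_cpoly [simp]: "degree (cpoly p) = degree p"
  unfolding cpoly_def by (rule degree_map_poly) simp

lemma cpoly_add: "cpoly (p + q) = cpoly p + cpoly q" by (rule poly_eqI) simp
lemma cpoly_diff: "cpoly (p - q) = cpoly p - cpoly q" by (rule poly_eqI) simp
lemma cpoly_uminus: "cpoly (- p) = - cpoly p" by (rule poly_eqI) simp
lemma cpoly_mult: "cpoly (p * q) = cpoly p * cpoly q" by (rule poly_eqI) (simp add: coeff_mult)
lemma cpoly_smult: "cpoly (smult c p) = smult (complex_of_real c) (cpoly p)" by (rule poly_eqI) simp
lemma cpoly_pderiv: "cpoly (pderiv p) = pderiv (cpoly p)" by (rule poly_eqI) (simp add: coeff_pderiv)
lemma cpoly_0 [simp]: "cpoly 0 = 0" by (rule poly_eqI) simp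
lemma cpoly_eq_0_iff [simp]: "cpoly p = 0 \<longleftrightarrow> p = 0"
  by (auto simp: poly_eq_iff)
lemma cpoly_power2: "cpoly (p\<^sup>2) = (cpoly p)\<^sup>2" by (simp add: power2_eq_square cpoly_mult)

lemma cpoly_pCons: "cpoly (pCons a p) = pCons (complex_of_real a) (cpoly p)"
  by (simp add: cpoly_def map_poly_pCons)

lemmas cpoly_hom = cpoly_add cpoly_diff cpoly_uminus cpoly_mult cpoly_smult cpoly_pderiv cpoly_power2

lemma poly_outer_homogenize: "poly (poly (homogenize d p) [:s:]) t = (\<Sum>i\<le>d. coeff p i * t ^ i * s ^ (d - i))"
proof -
  have "[:s:] ^ k = [:s ^ k:]" for k by (induction k) (simp_all add: one_pCons)
  then show ?thesis
    unfolding homogenize_def by (simp add: poly_sum poly_monom mult_ac)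
qed

lemma sum_homogenized:
  fixes p :: "'a::field poly"
  assumes "degree p \<le> d" "s \<noteq> 0"
  shows "(\<Sum>i\<le>d. coeff p i * t ^ i * s ^ (d - i)) = s ^ d * poly p (t / s)"
proof -
  have "s ^ d * poly p (t / s) = (\<Sum>i\<le>d. s ^ d * (coeff p i * (t / s) ^ i))"
    unfolding poly_eq_sum[OF assms(1)] by (rule sum_distrib_left)
  also have "\<dots> = (\<Sum>i\<le>d. coeff p i * t ^ i * s ^ (d - i))"
  proof (intro sum.cong refl)
    fix i assume "i \<in> {..d}"
    then have "s ^ d = s ^ (d - i) * s ^ i" by (simp only: power_add[symmetric] le_add_diff_inverse2 atMost_iff)
    then show "s ^ d * (coeff p i * (t / s) ^ i) = coeff p i * t ^ i * s ^ (d - i)"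
      using assms(2) by (simp only: power_divide) simp
  qed
  finally show ?thesis by simp
qed

lemma homogenize_mult:
  assumes "degree m \<le> a" "degree k \<le> b"
  shows "homogenize (a + b) (m * k) = homogenize a m * homogenize b k"
proof -
  have ev: "poly (poly (homogenize d p) [:s:]) t = s ^ d * poly p (t / s)" if "s \<noteq> 0" "degree p \<le> d" for d p s t
    using sum_homogenized[OF that(2,1)] by (simp only: poly_outer_homogenize)
  define P where "P = homogenize (a + b) (m * k) - homogenize a m * homogenize b k"
  have "poly P [:s:] = 0" if s: "s \<noteq> 0" for s :: real
  proof -
    have "poly (poly P [:s:]) t = 0" for t
      using order.trans[OF degree_mult_le[of m k] add_mono[OF assms]] assms
      by (simp add: P_def ev[OF s] power_add)
    then show ?thesis using poly_all_0_iff_0 by blast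
  qed
  then have "(\<lambda>s. [:s:]) ` (UNIV - {0}) \<subseteq> {x. poly P x = 0}" by auto
  moreover have "infinite ((\<lambda>s. [:s:]) ` (UNIV - {0 :: real}))"
    by (subst finite_image_iff) (auto simp: inj_on_def infinite_UNIV_char_0)
  ultimately have "P = 0" using poly_roots_finite[of P] finite_subset by blast
  then show ?thesis by (simp add: P_def)
qed

lemma homogenize_at_0: "poly (homogenize d p) 0 = monom (coeff p d) d"
proof -
  have "poly (homogenize d p) 0 = (\<Sum>i\<le>d. if i = d then monom (coeff p d) d else 0)"
    unfolding homogenize_def poly_sum poly_monom by (intro sum.cong) (auto simp: power_0_left)
  then show ?thesis by simp
qed

text \<open>Among the nonzero real polynomials vanishing at \<open>t\<close>, one of which is quadratic, take one of
  least degree.\<close>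

lemma real_minimal_polynomial:
  fixes t :: complex
  shows "\<exists>m :: real poly. degree m > 0 \<and> (\<forall>p. poly (cpoly p) t = 0 \<longrightarrow> m dvd p)"
proof -
  have "cpoly [:(Re t)\<^sup>2 + (Im t)\<^sup>2, - 2 * Re t, 1:] = [:complex_of_real ((Re t)\<^sup>2 + (Im t)\<^sup>2), complex_of_real (- 2 * Re t), 1:]"
    by (simp add: cpoly_def map_poly_pCons)
  moreover have "poly [:complex_of_real ((Re t)\<^sup>2 + (Im t)\<^sup>2), complex_of_real (- 2 * Re t), 1:] t = 0"
    by (simp add: complex_eq_iff power2_eq_square algebra_simps)
  ultimately have q: "[:(Re t)\<^sup>2 + (Im t)\<^sup>2, - 2 * Re t, 1:] \<noteq> 0 \<and> poly (cpoly [:(Re t)\<^sup>2 + (Im t)\<^sup>2, - 2 * Re t, 1:]) t = 0"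
    by simp
  obtain m where m: "m \<noteq> 0" "poly (cpoly m) t = 0"
    and min: "\<And>p. p \<noteq> 0 \<Longrightarrow> poly (cpoly p) t = 0 \<Longrightarrow> degree m \<le> degree p"
    using ex_has_least_nat[of "\<lambda>p. p \<noteq> 0 \<and> poly (cpoly p) t = 0", OF q, of degree] by auto
  have "degree m > 0"
  proof (rule ccontr)
    assume "\<not> degree m > 0"
    then obtain c where "m = [:c:]" by (auto elim: degree_eq_zeroE)
    then show False using m by (simp add: cpoly_def map_poly_pCons)
  qed
  moreover have "m dvd p" if p: "poly (cpoly p) t = 0" for p
  proof -
    have "cpoly p = cpoly (p div m) * cpoly m + cpoly (p mod m)"
      by (simp add: cpoly_mult[symmetric] cpoly_add[symmetric])
    then have "poly (cpoly (p mod m)) t = 0" using p m(2) by simp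
    then have "p mod m = 0" using min[of "p mod m"] degree_mod_less[OF m(1), of p] by force
    then show ?thesis by (simp add: mod_eq_0_iff_dvd)
  qed
  ultimately show ?thesis by blast
qed

lemma homogenize_common_factor:
  assumes m: "degree m > 0"
  shows "\<not> homogenize (degree m) m dvd 1"
proof
  assume "homogenize (degree m) m dvd 1"
  then obtain c where c: "homogenize (degree m) m = [:c:]" "c dvd 1" by (auto simp: is_unit_poly_iff)
  then have "c = monom (lead_coeff m) (degree m)" using homogenize_at_0[of "degree m" m] by simp
  moreover have "degree c = 0" using c(2) by (auto simp: is_unit_poly_iff)
  ultimately have "degree (monom (lead_coeff m) (degree m)) = 0" by simp
  moreover have "degree (monom (lead_coeff m) (degree m)) = degree m"
    by (rule degree_monom_eq) (use m in auto)
  ultimately show False using m by linarith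
qed

lemma homogenize_dvd:
  assumes "m dvd p" "degree p \<le> d" "degree m > 0"
  shows "homogenize (degree m) m dvd homogenize d p"
proof (cases "p = 0")
  case False
  obtain k where k: "p = m * k" using assms(1) by blast
  then have "degree p = degree m + degree k" using False by (simp add: degree_mult_eq)
  then have d: "d = degree m + (d - degree m)" "degree k \<le> d - degree m" using assms(2) by auto
  have "homogenize d p = homogenize (degree m) m * homogenize (d - degree m) k"
    unfolding k by (subst d(1), rule homogenize_mult) (use d in auto)
  then show ?thesis by simp
qed (simp add: homogenize_def)

text \<open>Each polynomial comes with the formal degree of its homogenization.\<close>

definition coprime_forms :: "(real poly \<times> nat) set \<Rightarrow> bool" where
  "coprime_forms A \<longleftrightarrow> (\<forall>h. (\<forall>(p, d)\<in>A. h dvd homogenize d p) \<longrightarrow> h dvd 1)"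

text \<open>A common complex zero would make the homogenization of its real minimal polynomial a common divisor.\<close>

lemma coprime_forms_finite:
  assumes cop: "coprime_forms A" and deg: "\<forall>(p, d)\<in>A. degree p \<le> d"
  shows "\<exists>(p, d)\<in>A. poly (cpoly p) t \<noteq> 0"
proof (rule ccontr)
  assume "\<not> ?thesis"
  then have z: "poly (cpoly p) t = 0" if "(p, d) \<in> A" for p d using that by auto
  obtain m :: "real poly" where m: "degree m > 0" "\<And>p. poly (cpoly p) t = 0 \<Longrightarrow> m dvd p"
    using real_minimal_polynomial by blast
  have "\<forall>(p, d)\<in>A. homogenize (degree m) m dvd homogenize d p"
    using m z deg by (auto intro!: homogenize_dvd)
  then have "homogenize (degree m) m dvd 1" using cop unfolding coprime_forms_def by blast
  then show False using homogenize_common_factor[OF m(1)] by blast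
qed

text \<open>A common zero at infinity would make the homogenizing variable a common divisor.\<close>

lemma coprime_forms_infinity:
  assumes cop: "coprime_forms A"
  shows "\<exists>(p, d)\<in>A. coeff p d \<noteq> 0"
proof (rule ccontr)
  assume "\<not> ?thesis"
  then have z: "coeff p d = 0" if "(p, d) \<in> A" for p d using that by auto
  have "[:- 0, 1:] dvd homogenize d p" if "(p, d) \<in> A" for p d
    using z[OF that] homogenize_at_0[of d p] by (simp only: poly_eq_0_iff_dvd[symmetric]) simp
  then have "\<forall>(p, d)\<in>A. [:- 0, 1 :: real poly:] dvd homogenize d p" by blast
  then have "[:- 0, 1 :: real poly:] dvd 1" using cop unfolding coprime_forms_def by blast
  then show False by (auto simp: is_unit_poly_iff)
qed

section \<open>Evaluation of homogenizations\<close>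

lemma heval_affine:
  assumes "degree p \<le> d" "q $ 2 \<noteq> 0"
  shows "heval d p q = (q $ 2) ^ d * poly (cpoly p) (q $ 1 / q $ 2)"
  using sum_homogenized[of "cpoly p" d "q $ 2" "q $ 1"] assms by (simp add: heval_def)

lemma heval_infinity:
  assumes "q $ 2 = 0"
  shows "heval d p q = coeff p d * (q $ 1) ^ d"
proof -
  have "heval d p q = (\<Sum>i\<le>d. if i = d then complex_of_real (coeff p d) * (q $ 1) ^ d else 0)"
    unfolding heval_def by (intro sum.cong) (use assms in \<open>auto simp: power_0_left\<close>)
  then show ?thesis by simp
qed

lemma degree_le_vec_degree: "degree (C $ i) \<le> vec_degree C"
  unfolding vec_degree_def by (rule Max_ge) auto

lemma vec_degree_eqI:
  assumes "\<And>i. degree (C $ i) \<le> d" "coeff (C $ j) d \<noteq> 0"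
  shows "vec_degree C = d"
  unfolding vec_degree_def
  by (rule Max_eqI) (use assms le_degree[OF assms(2)] in \<open>auto intro!: image_eqI[of _ _ j] antisym\<close>)

lemma q2_cases:
  assumes "(q :: complex ^ 2) \<noteq> 0"
  shows "q $ 2 \<noteq> 0 \<or> (q $ 2 = 0 \<and> q $ 1 \<noteq> 0)"
  using assms by (auto simp: Finite_Cartesian_Product.vec_eq_iff forall_2)

lemma vec_heval_sum_affine:
  assumes "q $ 2 \<noteq> 0"
  shows "(\<Sum>k\<in>UNIV. vec_heval C q $ k * x $ k) =
    (q $ 2) ^ vec_degree C * (\<Sum>k\<in>UNIV. poly (cpoly (C $ k)) (q $ 1 / q $ 2) * x $ k)"
  by (simp add: vec_heval_def heval_affine[OF degree_le_vec_degree assms] sum_distrib_left mult_ac)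

lemma vec_heval_sum_infinity:
  assumes "q $ 2 = 0"
  shows "(\<Sum>k\<in>UNIV. vec_heval C q $ k * x $ k) =
    (q $ 1) ^ vec_degree C * (\<Sum>k\<in>UNIV. complex_of_real (coeff (C $ k) (vec_degree C)) * x $ k)"
  by (simp add: vec_heval_def heval_infinity[OF assms] sum_distrib_left mult_ac)

section \<open>The dual variety is the zero set of the discriminant\<close>

text \<open>The vanishing minors say that \<open>C\<close> is a combination of the independent vectors \<open>E\<close> and \<open>G\<close>.\<close>

lemma rank_two_annihilator:
  fixes C E G :: "'k \<Rightarrow> complex"
  assumes minors: "\<And>k. C i * (E j * G k - E k * G j) - C j * (E i * G k - E k * G i) + C k * (E i * G j - E j * G i) = 0"
    and nz: "E i * G j - E j * G i \<noteq> 0"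
    and x: "(\<Sum>k\<in>K. E k * x k) = 0" "(\<Sum>k\<in>K. G k * x k) = 0"
  shows "(\<Sum>k\<in>K. C k * x k) = 0"
proof -
  have "(E i * G j - E j * G i) * (C k * x k) =
     C j * (E i * (G k * x k) - G i * (E k * x k)) - C i * (E j * (G k * x k) - G j * (E k * x k))" for k
    using arg_cong[OF minors[of k], of "\<lambda>z. z * x k"] by (simp add: algebra_simps)
  then have "(E i * G j - E j * G i) * (\<Sum>k\<in>K. C k * x k) =
     C j * (E i * (\<Sum>k\<in>K. G k * x k) - G i * (\<Sum>k\<in>K. E k * x k)) - C i * (E j * (\<Sum>k\<in>K. G k * x k) - G j * (\<Sum>k\<in>K. E k * x k))"
    by (simp add: sum_distrib_left sum_subtractf right_diff_distrib)
  then show ?thesis using x nz by simp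
qed

text \<open>The curve with its real coefficients, which the module of the dual variety refers to.\<close>

locale real_spine =
  fixes re :: "real poly ^ 5" and N :: nat and e :: "complex poly ^ 5"
  assumes e_def: "e = (\<chi> i. cpoly (re $ i))" and spine: "spine e N"

sublocale real_spine \<subseteq> spine e N by (rule spine)

context real_spine
begin

lemma e_nth: "e $ i = cpoly (re $ i)" by (simp add: e_def)

lemma EE_cpoly: "EE k = cpoly (E_vec re $ k)"
  by (cases k) (auto simp: EE_def E_vec_def gam_def lorentz_def e_nth cpoly_hom)

lemma EE'_cpoly: "pderiv (EE k) = cpoly (E_vec' re $ k)"
  by (simp add: EE_cpoly E_vec'_def cpoly_pderiv)

lemma g_eval: "poly (g x) t = (\<Sum>k\<in>UNIV. poly (EE k) t * x $ k)"
  by (simp add: g_sum poly_sum mult.commute)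

lemma pderiv_setsum: "pderiv (sum f A) = (\<Sum>a\<in>A. pderiv (f a))"
  by (induction A rule: infinite_finite_induct) (simp_all add: pderiv_add)

lemma g'_eval: "poly (pderiv (g x)) t = (\<Sum>k\<in>UNIV. poly (pderiv (EE k)) t * x $ k)"
  by (simp add: g_sum pderiv_setsum pderiv_smult poly_sum mult.commute)

lemma g_coeff: "coeff (g x) n = (\<Sum>k\<in>UNIV. coeff (EE k) n * x $ k)"
  by (simp add: g_sum coeff_sum mult.commute)

text \<open>The second generator at infinity: its coefficients in degree \<open>2N - 1\<close> are those of \<open>E\<close>, while those of
  \<open>E'\<close> are multiples of the top coefficients of \<open>E\<close>.\<close>

definition BB :: "5 option \<Rightarrow> complex poly" where
  "BB k = smult (of_nat (2 * N)) (EE k) - [:0, 1:] * pderiv (EE k)"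

lemma coeff_BB: "coeff (BB k) n = (of_nat (2 * N) - of_nat n) * coeff (EE k) n"
  unfolding BB_def by (cases n) (simp_all add: coeff_pderiv algebra_simps)

lemma degree_BB: "degree (BB k) \<le> 2 * N - 1"
proof (rule degree_le, intro allI impI)
  fix n assume "2 * N - 1 < n"
  then have "n = 2 * N \<or> n > degree (EE k)" using degree_EE[of k] by linarith
  then show "coeff (BB k) n = 0" unfolding coeff_BB by (auto simp: coeff_eq_0)
qed

lemma degree_EE': "degree (pderiv (EE k)) \<le> 2 * N - 1"
  using degree_EE[of k] by (simp add: degree_pderiv)

lemma coeff_EE'_top: "coeff (pderiv (EE k)) (2 * N - 1) = of_nat (2 * N) * coeff (EE k) (2 * N)"
  using N by (simp add: coeff_pderiv)

lemma coeff_BB_top: "coeff (BB k) (2 * N - 1) = coeff (EE k) (2 * N - 1)"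
  unfolding coeff_BB using N by (simp add: of_nat_diff)

lemma plk_BB: "BB j * pderiv (EE k) - BB k * pderiv (EE j) = smult (of_nat (2 * N)) (plk j k)"
  by (simp add: BB_def plk_def algebra_simps smult_diff_right)

lemma degree_plk: "degree (plk j k) \<le> 4 * N - 2"
proof -
  have "degree (BB j * pderiv (EE k)) \<le> 4 * N - 2" for j k
    using degree_mult_le[of "BB j" "pderiv (EE k)"] degree_BB[of j] degree_EE'[of k] N by linarith
  then have "degree (BB j * pderiv (EE k) - BB k * pderiv (EE j)) \<le> 4 * N - 2"
    by (intro degree_diff_le)
  then show ?thesis unfolding plk_BB using N by simp
qed

lemma coeff_plk_top:
  "coeff (plk j k) (4 * N - 2) = coeff (EE j) (2 * N - 1) * coeff (EE k) (2 * N) - coeff (EE k) (2 * N - 1) * coeff (EE j) (2 * N)"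
proof -
  have s: "4 * N - 2 = (2 * N - 1) + (2 * N - 1)" using N by simp
  have top: "coeff (BB j * pderiv (EE k)) (4 * N - 2) = coeff (EE j) (2 * N - 1) * (of_nat (2 * N) * coeff (EE k) (2 * N))" for j k
    unfolding s using coeff_mult_top[OF degree_BB degree_EE', of j k] by (simp only: coeff_BB_top coeff_EE'_top)
  have "of_nat (2 * N) * coeff (plk j k) (4 * N - 2) = coeff (BB j * pderiv (EE k) - BB k * pderiv (EE j)) (4 * N - 2)"
    unfolding plk_BB by simp
  also have "\<dots> = of_nat (2 * N) * (coeff (EE j) (2 * N - 1) * coeff (EE k) (2 * N) - coeff (EE k) (2 * N - 1) * coeff (EE j) (2 * N))"
    unfolding coeff_diff top by (simp add: algebra_simps)
  finally show ?thesis using N by simp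
qed

text \<open>This replaces a description of the module by generators: homogenized, the minors confine every element of the
  module to the span of the two generators at each parameter.\<close>

lemma M_mod_minors:
  assumes C: "C \<in> M_mod re"
  shows "cpoly (C $ i) * plk j k - cpoly (C $ j) * plk i k + cpoly (C $ k) * plk i j = 0"
proof -
  obtain a b where ab: "\<And>k. to_fract (C $ k) = a * to_fract (E_vec re $ k) + b * to_fract (E_vec' re $ k)"
    using C unfolding M_mod_def by blast
  define E where "E k = E_vec re $ k" for k
  define E' where "E' k = E_vec' re $ k" for k
  have "to_fract (C $ i * (E j * E' k - E k * E' j) - C $ j * (E i * E' k - E k * E' i) + C $ k * (E i * E' j - E j * E' i)) = 0"
    by (simp add: ab E_def E'_def algebra_simps)
  then have "C $ i * (E j * E' k - E k * E' j) - C $ j * (E i * E' k - E k * E' i) + C $ k * (E i * E' j - E j * E' i) = 0"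
    by (simp only: to_fract_eq_0_iff)
  then have "cpoly (C $ i * (E j * E' k - E k * E' j) - C $ j * (E i * E' k - E k * E' i) + C $ k * (E i * E' j - E j * E' i)) = 0"
    by simp
  then show ?thesis
    by (simp add: cpoly_hom plk_def EE_cpoly E_def E'_def E_vec'_def)
qed

lemma L_space_D:
  assumes D0: "D x = 0"
  shows "\<exists>q. q \<noteq> 0 \<and> x \<in> L_space (M_mod re) q"
proof -
  from D0 consider t where "poly (g x) t = 0" "poly (pderiv (g x)) t = 0"
    | "coeff (g x) (2 * N) = 0" "coeff (g x) (2 * N - 1) = 0"
    unfolding D_eq_0_iff by blast
  then show ?thesis
  proof cases
    case 1
    define q :: "complex ^ 2" where "q = (\<chi> i. if i = 1 then t else 1)"
    have q: "q $ 1 = t" "q $ 2 = 1" by (simp_all add: q_def)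
    then have "q \<noteq> 0" by (metis one_neq_zero zero_index)
    moreover have "x \<in> L_space (M_mod re) q"
      unfolding L_space_def
    proof (intro CollectI ballI)
      fix C assume C: "C \<in> M_mod re"
      obtain i j where ij: "poly (plk i j) t \<noteq> 0" using plk_nonzero by blast
      have "(\<Sum>k\<in>UNIV. poly (cpoly (C $ k)) t * x $ k) = 0"
      proof (rule rank_two_annihilator[where E = "\<lambda>k. poly (EE k) t" and G = "\<lambda>k. poly (pderiv (EE k)) t" and i = i and j = j])
        fix k
        show "poly (cpoly (C $ i)) t * (poly (EE j) t * poly (pderiv (EE k)) t - poly (EE k) t * poly (pderiv (EE j)) t) -
          poly (cpoly (C $ j)) t * (poly (EE i) t * poly (pderiv (EE k)) t - poly (EE k) t * poly (pderiv (EE i)) t) +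
          poly (cpoly (C $ k)) t * (poly (EE i) t * poly (pderiv (EE j)) t - poly (EE j) t * poly (pderiv (EE i)) t) = 0"
          using arg_cong[OF M_mod_minors[OF C, of i j k], of "\<lambda>p. poly p t"] by (simp add: plk_def)
      qed (use 1 ij in \<open>simp_all add: g_eval g'_eval plk_def\<close>)
      then show "(\<Sum>k\<in>UNIV. vec_heval C q $ k * x $ k) = 0"
        by (subst vec_heval_sum_affine) (simp_all add: q)
    qed
    ultimately show ?thesis by blast
  next
    case 2
    define q :: "complex ^ 2" where "q = (\<chi> i. if i = 1 then 1 else 0)"
    have q: "q $ 1 = 1" "q $ 2 = 0" by (simp_all add: q_def)
    then have "q \<noteq> 0" by (metis one_neq_zero zero_index)
    moreover have "x \<in> L_space (M_mod re) q"
      unfolding L_space_def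
    proof (intro CollectI ballI)
      fix C assume C: "C \<in> M_mod re"
      define m where "m = vec_degree C"
      have dC: "degree (cpoly (C $ k)) \<le> m" for k by (simp add: m_def degree_le_vec_degree)
      obtain i j where ij: "coeff (plk i j) (4 * N - 2) \<noteq> 0" using plk_top_nonzero by blast
      have "(\<Sum>k\<in>UNIV. coeff (cpoly (C $ k)) m * x $ k) = 0"
      proof (rule rank_two_annihilator[where E = "\<lambda>k. coeff (EE k) (2 * N - 1)" and G = "\<lambda>k. coeff (EE k) (2 * N)" and i = i and j = j])
        fix k
        have "coeff (cpoly (C $ i) * plk j k - cpoly (C $ j) * plk i k + cpoly (C $ k) * plk i j) (m + (4 * N - 2)) = 0"
          unfolding M_mod_minors[OF C] by simp
        then show "coeff (cpoly (C $ i)) m * (coeff (EE j) (2 * N - 1) * coeff (EE k) (2 * N) - coeff (EE k) (2 * N - 1) * coeff (EE j) (2 * N)) -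
           coeff (cpoly (C $ j)) m * (coeff (EE i) (2 * N - 1) * coeff (EE k) (2 * N) - coeff (EE k) (2 * N - 1) * coeff (EE i) (2 * N)) +
           coeff (cpoly (C $ k)) m * (coeff (EE i) (2 * N - 1) * coeff (EE j) (2 * N) - coeff (EE j) (2 * N - 1) * coeff (EE i) (2 * N)) = 0"
          by (simp only: coeff_add coeff_diff coeff_mult_top[OF dC degree_plk] coeff_plk_top)
      qed (use 2 ij in \<open>simp_all add: g_coeff coeff_plk_top\<close>)
      then show "(\<Sum>k\<in>UNIV. vec_heval C q $ k * x $ k) = 0"
        by (subst vec_heval_sum_infinity) (simp_all add: q m_def)
    qed
    ultimately show ?thesis by blast
  qed
qed

lemma D_L_space:
  assumes q: "q \<noteq> 0" and x: "x \<in> L_space (M_mod re) q"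
  shows "D x = 0"
proof -
  define B :: "real poly ^ (5 option)" where
    "B = (\<chi> k. smult (of_nat (2 * N)) (E_vec re $ k) - [:0, 1:] * E_vec' re $ k)"
  have B_nth: "cpoly (B $ k) = BB k" for k
    by (simp add: B_def BB_def EE_cpoly E_vec'_def cpoly_hom cpoly_pCons)
  have B_M: "B \<in> M_mod re"
    unfolding M_mod_def
  proof (rule CollectI, rule exI[of _ "to_fract [:of_nat (2 * N):]"], rule exI[of _ "to_fract (- [:0, 1:])"], rule allI)
    fix k
    have "B $ k = [:of_nat (2 * N):] * E_vec re $ k + (- [:0, 1:]) * E_vec' re $ k"
      by (simp add: B_def)
    then show "to_fract (B $ k) = to_fract [:of_nat (2 * N):] * to_fract (E_vec re $ k) + to_fract (- [:0, 1:]) * to_fract (E_vec' re $ k)"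
      by (simp only: to_fract_add to_fract_mult)
  qed
  have E_M: "E_vec' re \<in> M_mod re"
    unfolding M_mod_def by (intro CollectI exI[of _ 0] exI[of _ 1]) simp
  have sE: "(\<Sum>k\<in>UNIV. vec_heval (E_vec' re) q $ k * x $ k) = 0"
    and sB: "(\<Sum>k\<in>UNIV. vec_heval B q $ k * x $ k) = 0"
    using x E_M B_M unfolding L_space_def by auto
  consider "q $ 2 \<noteq> 0" | "q $ 2 = 0" "q $ 1 \<noteq> 0" using q2_cases[OF q] by blast
  then show ?thesis
  proof cases
    case 1
    define t where "t = q $ 1 / q $ 2"
    have "poly (pderiv (g x)) t = 0"
      using sE 1 unfolding vec_heval_sum_affine[OF 1] t_def[symmetric] by (simp add: g'_eval EE'_cpoly)
    moreover have "(\<Sum>k\<in>UNIV. poly (BB k) t * x $ k) = 0"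
      using sB 1 unfolding vec_heval_sum_affine[OF 1] t_def[symmetric] by (simp add: B_nth)
    moreover have "(\<Sum>k\<in>UNIV. poly (BB k) t * x $ k) = of_nat (2 * N) * poly (g x) t - t * poly (pderiv (g x)) t"
      unfolding g_eval g'_eval by (simp add: BB_def algebra_simps sum_subtractf sum_distrib_left)
    ultimately have "poly (g x) t = 0" "poly (pderiv (g x)) t = 0" using N by auto
    then show ?thesis unfolding D_eq_0_iff by blast
  next
    case 2
    have coefE: "complex_of_real (coeff (E_vec' re $ k) n) = coeff (pderiv (EE k)) n" for k n by (simp add: EE'_cpoly)
    have coefB: "complex_of_real (coeff (B $ k) n) = coeff (BB k) n" for k n by (simp add: B_nth[symmetric])
    have dE: "degree (E_vec' re $ k) \<le> 2 * N - 1" for k using degree_EE'[of k] by (simp add: EE'_cpoly)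
    have dB: "degree (B $ k) \<le> 2 * N - 1" for k using degree_BB[of k] by (simp add: B_nth[symmetric])
    obtain j k where jk: "coeff (plk j k) (4 * N - 2) \<noteq> 0" using plk_top_nonzero by blast
    obtain a where a: "coeff (EE a) (2 * N) \<noteq> 0" using jk unfolding coeff_plk_top by (metis diff_self mult_zero_right)
    obtain b where b: "coeff (EE b) (2 * N - 1) \<noteq> 0" using jk unfolding coeff_plk_top by (metis diff_self mult_zero_left)
    have vE: "vec_degree (E_vec' re) = 2 * N - 1"
    proof (rule vec_degree_eqI[OF dE])
      have "complex_of_real (coeff (E_vec' re $ a) (2 * N - 1)) \<noteq> 0"
        unfolding coefE coeff_EE'_top using a N by simp
      then show "coeff (E_vec' re $ a) (2 * N - 1) \<noteq> 0" by simp
    qed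
    have vB: "vec_degree B = 2 * N - 1"
    proof (rule vec_degree_eqI[OF dB])
      have "complex_of_real (coeff (B $ b) (2 * N - 1)) \<noteq> 0"
        unfolding coefB coeff_BB_top using b by simp
      then show "coeff (B $ b) (2 * N - 1) \<noteq> 0" by simp
    qed
    have "(\<Sum>k\<in>UNIV. of_nat (2 * N) * coeff (EE k) (2 * N) * x $ k) = 0"
      using sE 2 unfolding vec_heval_sum_infinity[OF 2(1)] vE coefE coeff_EE'_top by simp
    then have "of_nat (2 * N) * coeff (g x) (2 * N) = 0"
      unfolding g_coeff by (simp add: sum_distrib_left mult.assoc)
    moreover have "coeff (g x) (2 * N - 1) = 0"
      using sB 2 unfolding vec_heval_sum_infinity[OF 2(1)] vB coefB coeff_BB_top g_coeff by simp
    ultimately have "coeff (g x) (2 * N) = 0" "coeff (g x) (2 * N - 1) = 0" using N by auto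
    then show ?thesis unfolding D_eq_0_iff by blast
  qed
qed

lemma dual_variety_eq: "dual_variety re = {x. x \<noteq> 0 \<and> D x = 0}"
  unfolding dual_variety_def using L_space_D D_L_space by blast

section \<open>Tangent lines at distinct parameters are distinct\<close>

lemma plucker_plk: "cpoly (plucker re $ k) = plk (fst k) (snd k)"
  by (simp add: plucker_def plk_def EE_cpoly E_vec'_def cpoly_hom)

lemma span_scale: "(c :: complex) \<noteq> 0 \<Longrightarrow> vec.span {c *s v} = vec.span {v}"
proof -
  assume c: "c \<noteq> 0"
  have "range (\<lambda>k. k *s (c *s v)) = range (\<lambda>k. k *s v)"
  proof
    show "range (\<lambda>k. k *s (c *s v)) \<subseteq> range (\<lambda>k. k *s v)" by (auto simp: vector_smult_assoc)
    have "k *s v = (k / c) *s (c *s v)" for k using c by (simp add: vector_smult_assoc)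
    then show "range (\<lambda>k. k *s v) \<subseteq> range (\<lambda>k. k *s (c *s v))" by (metis image_subsetI rangeI)
  qed
  then show ?thesis by (simp add: vec.span_singleton)
qed

text \<open>The parameter of a bitangent shares its Pluecker point with another one, so this point lies in the finite
  exceptional set \<open>Z\<close>.  If there were infinitely many, one point would have an infinite fibre, the Pluecker curve
  would be this single point, and \<open>Z\<close> could not be a proper subset.\<close>

lemma finite_bitangents:
  assumes pd: "plucker_degree_one re"
  shows "finite bitangents"
proof (rule ccontr)
  assume inf: "infinite bitangents"
  let ?h = "vec_heval (plucker re)"
  define dom where "dom = {q. q \<noteq> 0 \<and> ?h q \<noteq> 0}"
  define pt where "pt = (\<lambda>q. vec.span {?h q})"
  have "\<exists>Z. finite Z \<and> Z \<subset> pt ` dom \<and>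
      (\<forall>p \<in> pt ` dom - Z. card {vec.span {q} | q. q \<in> dom \<and> pt q = p} = 1)"
    using pd by (simp only: plucker_degree_one_def Let_def dom_def pt_def)
  then obtain Z where Z0: "finite Z \<and> Z \<subset> pt ` dom \<and>
      (\<forall>p \<in> pt ` dom - Z. card {vec.span {q} | q. q \<in> dom \<and> pt q = p} = 1)" ..
  have Z: "finite Z" "Z \<subset> pt ` dom" using Z0 by simp_all
  have Z3: "card {vec.span {q} | q. q \<in> dom \<and> pt q = p} = 1" if "p \<in> pt ` dom - Z" for p
    using Z0 that by (elim conjE) (rule bspec)
  define Q :: "complex \<Rightarrow> complex ^ 2" where "Q t = (\<chi> i. if i = 1 then t else 1)" for t
  have Q: "Q t $ 1 = t" "Q t $ 2 = 1" for t by (simp_all add: Q_def)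
  have hQ: "?h (Q t) $ k = poly (plk (fst k) (snd k)) t" for t k
    using heval_affine[OF degree_le_vec_degree[of "plucker re" k], of "Q t"]
    by (simp add: vec_heval_def Q plucker_plk)
  have Q_dom: "Q t \<in> dom" for t
  proof -
    have "Q t \<noteq> 0" using Q(2)[of t] by (metis one_neq_zero zero_index)
    moreover obtain j k where "poly (plk j k) t \<noteq> 0" using plk_nonzero by blast
    then have "?h (Q t) $ (j, k) \<noteq> 0" by (simp add: hQ)
    then have "?h (Q t) \<noteq> 0" by (metis zero_index)
    ultimately show ?thesis by (simp add: dom_def)
  qed
  have in_Z: "pt (Q t) \<in> Z" if t: "t \<in> bitangents" for t
  proof (rule ccontr)
    assume nZ: "pt (Q t) \<notin> Z"
    obtain s c where s: "s \<noteq> t" "poly e0 t \<noteq> 0" "poly e0 s \<noteq> 0" "same_point t s"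
      "\<forall>j\<in>{1,2,3,4}. poly (w $ j) t = c * poly (w $ j) s"
      using t unfolding bitangents_def by blast
    obtain \<mu> where \<mu>: "\<And>j k. poly (plk j k) t = \<mu> * poly (plk j k) s"
      using plk_bitangent[OF s(2-4)] s(5) by blast
    have "\<mu> \<noteq> 0" using plk_nonzero[of t] \<mu> by auto
    have "?h (Q t) = \<mu> *s ?h (Q s)"
      by (simp add: Finite_Cartesian_Product.vec_eq_iff hQ \<mu>)
    then have pteq: "pt (Q s) = pt (Q t)" using span_scale[OF \<open>\<mu> \<noteq> 0\<close>, of "?h (Q s)"] by (simp add: pt_def)
    have "card {vec.span {q} | q. q \<in> dom \<and> pt q = pt (Q t)} = 1" by (rule Z3) (use nZ Q_dom in blast)
    then obtain l where l: "{vec.span {q} | q. q \<in> dom \<and> pt q = pt (Q t)} = {l}" by (auto simp: card_1_singleton_iff)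
    have "vec.span {Q t} \<in> {vec.span {q} | q. q \<in> dom \<and> pt q = pt (Q t)}"
      "vec.span {Q s} \<in> {vec.span {q} | q. q \<in> dom \<and> pt q = pt (Q t)}" using Q_dom pteq by blast+
    then have "vec.span {Q t} = vec.span {Q s}" unfolding l by simp
    then have "Q t \<in> vec.span {Q s}" using vec.span_base[of "Q t" "{Q t}"] by simp
    then obtain k where k: "Q t = k *s Q s" by (auto simp: vec.span_singleton)
    have "Q t $ 2 = (k *s Q s) $ 2" "Q t $ 1 = (k *s Q s) $ 1" using k by simp_all
    then show False using s(1) by (simp add: Q)
  qed
  have "\<exists>p\<in>Z. infinite {t \<in> bitangents. pt (Q t) = p}"
  proof (rule ccontr)
    assume "\<not> ?thesis"
    then have "finite (\<Union>p\<in>Z. {t \<in> bitangents. pt (Q t) = p})" using Z(1) by blast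
    moreover have "bitangents \<subseteq> (\<Union>p\<in>Z. {t \<in> bitangents. pt (Q t) = p})" using in_Z by auto
    ultimately show False using inf finite_subset by blast
  qed
  then obtain p where p: "p \<in> Z" "infinite {t \<in> bitangents. pt (Q t) = p}" by blast
  define A where "A = {t \<in> bitangents. pt (Q t) = p}"
  have "A \<noteq> {}" using p(2) unfolding A_def by (metis finite.emptyI)
  then obtain t0 where t0: "pt (Q t0) = p" by (auto simp: A_def)
  define v where "v = ?h (Q t0)"
  have vne: "v \<noteq> 0" using Q_dom[of t0] by (simp add: v_def dom_def)
  have proportional: "smult (v $ b) (cpoly (plucker re $ a)) = smult (v $ a) (cpoly (plucker re $ b))" for a b
  proof -
    let ?P = "smult (v $ b) (cpoly (plucker re $ a)) - smult (v $ a) (cpoly (plucker re $ b))"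
    have "A \<subseteq> {t. poly ?P t = 0}"
    proof
      fix t assume "t \<in> A"
      then have "vec.span {?h (Q t)} = vec.span {v}" using t0 by (simp add: A_def pt_def v_def)
      then have "?h (Q t) \<in> vec.span {v}" using vec.span_base[of "?h (Q t)" "{?h (Q t)}"] by simp
      then obtain k where k: "?h (Q t) = k *s v" by (auto simp: vec.span_singleton)
      have "poly (cpoly (plucker re $ i)) t = k * v $ i" for i
        using hQ[of t i] unfolding k by (simp add: plucker_plk)
      then show "t \<in> {t. poly ?P t = 0}" by simp
    qed
    then have "?P = 0" using p(2) poly_roots_finite[of ?P] finite_subset unfolding A_def by blast
    then show ?thesis by simp
  qed
  obtain b where b: "v $ b \<noteq> 0" using vne by (auto simp: Finite_Cartesian_Product.vec_eq_iff)
  have all_p: "pt q = p" if q: "q \<in> dom" for q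
  proof -
    have eq: "v $ b * ?h q $ a = v $ a * ?h q $ b" for a
    proof -
      have "v $ b * coeff (cpoly (plucker re $ a)) i = v $ a * coeff (cpoly (plucker re $ b)) i" for i
        using arg_cong[OF proportional[of b a], of "\<lambda>P. coeff P i"] by simp
      then have "v $ b * complex_of_real (coeff (plucker re $ a) i) = v $ a * complex_of_real (coeff (plucker re $ b) i)" for i
        by simp
      then show ?thesis
        unfolding vec_heval_def heval_def by (simp add: sum_distrib_left mult.assoc[symmetric])
    qed
    define k where "k = ?h q $ b / v $ b"
    have "?h q $ a = k * v $ a" for a using eq[of a] b by (simp add: k_def field_simps)
    then have hq: "?h q = k *s v" by (simp add: Finite_Cartesian_Product.vec_eq_iff)
    then have "k \<noteq> 0" using q by (auto simp: dom_def)
    then show ?thesis using span_scale[of k v] t0 by (simp add: pt_def hq v_def)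
  qed
  then have "pt ` dom \<subseteq> {p}" by blast
  then show False using Z(2) p(1) by blast
qed

end

section \<open>The equation of the Gamma-hypersurface\<close>

context real_spine
begin

definition DP :: "5 option mpoly" where "DP = (SOME P. \<forall>x. D x = meval P x)"

lemma DP: "meval DP x = D x"
proof -
  have "\<exists>P. \<forall>x. D x = meval P x" using polyfun_D unfolding polyfun_def by blast
  then have "\<forall>x. D x = meval DP x" unfolding DP_def by (rule someI_ex)
  then show ?thesis by simp
qed

definition FP :: "5 mpoly" where "FP = (SOME P. \<forall>x. F x = meval P x)"

lemma FP: "meval FP x = F x"
proof -
  have "\<exists>P. \<forall>x. F x = meval P x" using polyfun_F unfolding polyfun_def by blast
  then have "\<forall>x. F x = meval FP x" unfolding FP_def by (rule someI_ex)
  then show ?thesis by simp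
qed

lemma implicit_equation_DP:
  assumes fin: "finite bitangents"
  shows "implicit_equation DP (dual_variety re)"
  unfolding implicit_equation_def
proof (intro conjI allI)
  show "DP \<noteq> 0" using D_nonzero DP by (metis meval_0)
  fix P
  show "(\<forall>x\<in>dual_variety re. meval P x = 0) \<longleftrightarrow> DP dvd P"
  proof
    assume "\<forall>x\<in>dual_variety re. meval P x = 0"
    then have "\<exists>S. polyfun S \<and> (\<forall>x. meval P x = D x * S x)"
      by (intro D_generates_ideal[OF fin]) (auto simp: dual_variety_eq)
    then show "DP dvd P" by (simp add: mpoly_dvd_iff DP)
  next
    assume "DP dvd P"
    then show "\<forall>x\<in>dual_variety re. meval P x = 0"
      by (auto simp: mpoly_dvd_iff DP dual_variety_eq)
  qed
qed

text \<open>Two generators of the same ideal divide each other, and a polynomial with a polynomial inverse is constant.\<close>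

lemma implicit_equation_unique:
  assumes fin: "finite bitangents" and G: "implicit_equation G (dual_variety re)"
  shows "\<exists>c. c \<noteq> 0 \<and> (\<forall>x. meval G x = c * D x)"
proof -
  have "DP dvd G" "G dvd DP"
    using implicit_equation_DP[OF fin] G unfolding implicit_equation_def by (metis dvd_refl)+
  then obtain A B where A: "polyfun A" "\<And>x. meval G x = D x * A x" and B: "polyfun B" "\<And>x. D x = meval G x * B x"
    unfolding mpoly_dvd_iff DP by blast
  obtain z where z: "D z \<noteq> 0" using D_nonzero by blast
  have AB: "A x * B x = 1" for x
  proof (rule polyfun_eq_generic[where h = D and z = z])
    show "polyfun (\<lambda>x. A x * B x)" by (intro polyfun_intros A B)
    fix x assume "D x \<noteq> 0"
    moreover have "D x * (A x * B x) = D x * 1"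
      using B(2)[of x] unfolding A(2) by (simp only: mult.assoc mult_1_right)
    ultimately show "A x * B x = 1" by (metis mult_left_cancel)
  qed (use z in auto)
  have "A x = A 0" for x by (rule polyfun_unit_const[OF A(1) B(1) AB])
  then show ?thesis using A(2) AB[of 0]
    by (intro exI[of _ "A 0"]) (metis mult.commute mult_zero_left zero_neq_one)
qed

lemma eliminates_u_iff:
  assumes G: "\<And>x. meval G x = c * D x"
  shows "eliminates_u G \<kappa> P \<longleftrightarrow> (\<forall>y. y $ 0 \<noteq> 0 \<longrightarrow> (y $ 0) ^ (2 * N - 2) * meval P y = (y $ 0) powi \<kappa> * (c * F y))"
proof -
  have "(\<chi> k. case k of None \<Rightarrow> lorentz y y / y $ 0 | Some j \<Rightarrow> y $ j) = lift y" for y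
    by (simp add: lift_def with_u_def)
  then have "eliminates_u G \<kappa> P \<longleftrightarrow> (\<forall>y. y $ 0 \<noteq> 0 \<longrightarrow> meval P y = (y $ 0) powi \<kappa> * (c * D (lift y)))"
    unfolding eliminates_u_def by (simp add: G)
  also have "\<dots> \<longleftrightarrow> (\<forall>y. y $ 0 \<noteq> 0 \<longrightarrow> (y $ 0) ^ (2 * N - 2) * meval P y = (y $ 0) powi \<kappa> * (c * F y))"
  proof (intro all_cong1 imp_cong refl)
    fix y :: "complex ^ 5" assume y: "y $ 0 \<noteq> 0"
    have "(y $ 0) powi \<kappa> * (c * ((y $ 0) ^ (2 * N - 2) * D (lift y))) =
        (y $ 0) ^ (2 * N - 2) * ((y $ 0) powi \<kappa> * (c * D (lift y)))"
      by (simp only: mult_ac)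
    then show "(meval P y = (y $ 0) powi \<kappa> * (c * D (lift y))) =
        ((y $ 0) ^ (2 * N - 2) * meval P y = (y $ 0) powi \<kappa> * (c * F y))"
      unfolding F_D[OF y] by (simp only: mult_cancel_left) (simp add: y)
  qed
  finally show ?thesis .
qed

text \<open>A smaller exponent would make \<open>F\<close> divisible by \<open>y\<^sub>0\<close>.\<close>

lemma eliminates_u_least:
  assumes G: "\<And>x. meval G x = c * D x" and c: "c \<noteq> 0" and el: "eliminates_u G \<kappa> P"
  shows "int (2 * N - 2) \<le> \<kappa>"
proof (rule ccontr)
  assume less: "\<not> int (2 * N - 2) \<le> \<kappa>"
  define m where "m = nat (int (2 * N - 2) - \<kappa>)"
  have m: "m > 0" "int (2 * N - 2) = \<kappa> + int m" using less by (auto simp: m_def)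
  obtain v where v: "v $ 0 = 0" "F v \<noteq> 0" using F_nonzero by blast
  have "c * F v = (v $ 0) ^ m * meval P v"
  proof (rule polyfun_eq_generic[where h = "\<lambda>y. y $ 0" and z = "axis 0 1"])
    show "polyfun (\<lambda>y. c * F y)" "polyfun (\<lambda>y. (y $ 0) ^ m * meval P y)"
      by (intro polyfun_intros polyfun_F polyfun_meval)+
    fix y :: "complex ^ 5" assume y: "y $ 0 \<noteq> 0"
    have "(y $ 0) powi \<kappa> * (c * F y) = (y $ 0) ^ (2 * N - 2) * meval P y"
      using el y unfolding eliminates_u_iff[OF G] by simp
    also have "(y $ 0) ^ (2 * N - 2) = (y $ 0) powi (\<kappa> + int m)"
      unfolding m(2)[symmetric] by (simp only: power_int_of_nat)
    also have "\<dots> = (y $ 0) powi \<kappa> * (y $ 0) ^ m"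
      using y by (simp add: power_int_add)
    finally have "(y $ 0) powi \<kappa> * (c * F y) = (y $ 0) powi \<kappa> * ((y $ 0) ^ m * meval P y)"
      by (simp add: mult.assoc)
    moreover have "(y $ 0) powi \<kappa> \<noteq> 0" using y by simp
    ultimately show "c * F y = (y $ 0) ^ m * meval P y" by (metis mult_left_cancel)
  qed (auto simp: axis_def)
  then show False using v c m(1) by (simp add: zero_power)
qed

lemma eliminates_u_exact:
  assumes G: "\<And>x. meval G x = c * D x"
  shows "eliminates_u G (int (2 * N - 2)) P \<longleftrightarrow> (\<forall>y. meval P y = c * F y)"
proof
  assume el: "eliminates_u G (int (2 * N - 2)) P"
  show "\<forall>y. meval P y = c * F y"
  proof
    fix y
    show "meval P y = c * F y"
    proof (rule polyfun_eq_generic[where h = "\<lambda>y. y $ 0" and z = "axis 0 1"])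
      show "polyfun (\<lambda>y. c * F y)" by (intro polyfun_intros polyfun_F)
      fix y :: "complex ^ 5" assume y: "y $ 0 \<noteq> 0"
      have "(y $ 0) ^ (2 * N - 2) * meval P y = (y $ 0) ^ (2 * N - 2) * (c * F y)"
        using el y unfolding eliminates_u_iff[OF G] power_int_of_nat by simp
      then show "meval P y = c * F y" using y by simp
    qed (auto simp: axis_def)
  qed
next
  assume "\<forall>y. meval P y = c * F y"
  then show "eliminates_u G (int (2 * N - 2)) P"
    unfolding eliminates_u_iff[OF G] power_int_of_nat by simp
qed

lemma gamma_equation_FP:
  assumes fin: "finite bitangents"
  shows "gamma_equation re FP"
  unfolding gamma_equation_def
proof (intro exI[of _ DP] exI[of _ "int (2 * N - 2)"] conjI allI impI)
  have G: "meval DP x = 1 * D x" for x by (simp add: DP)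
  show "implicit_equation DP (dual_variety re)" by (rule implicit_equation_DP[OF fin])
  show "eliminates_u DP (int (2 * N - 2)) FP" unfolding eliminates_u_exact[OF G] by (simp add: FP)
  show "int (2 * N - 2) \<le> \<kappa>'" if "eliminates_u DP \<kappa>' F'" for \<kappa>' F'
    using eliminates_u_least[OF G _ that] by simp
qed

lemma gamma_equation_unique:
  assumes fin: "finite bitangents" and P: "gamma_equation re P"
  shows "\<exists>c. c \<noteq> 0 \<and> (\<forall>y. meval P y = c * F y)"
proof -
  obtain G \<kappa> where G: "implicit_equation G (dual_variety re)" and el: "eliminates_u G \<kappa> P"
    and min: "\<And>\<kappa>' F'. eliminates_u G \<kappa>' F' \<Longrightarrow> \<kappa> \<le> \<kappa>'"
    using P unfolding gamma_equation_def by blast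
  obtain c where c: "c \<noteq> 0" "\<And>x. meval G x = c * D x" using implicit_equation_unique[OF fin G] by blast
  have "polyfun (\<lambda>y. c * F y)" by (intro polyfun_intros polyfun_F)
  then obtain P' where "\<And>y. c * F y = meval P' y" unfolding polyfun_def by blast
  then have "eliminates_u G (int (2 * N - 2)) P'" unfolding eliminates_u_exact[OF c(2)] by simp
  then have "\<kappa> \<le> int (2 * N - 2)" by (rule min)
  moreover have "int (2 * N - 2) \<le> \<kappa>" by (rule eliminates_u_least[OF c(2) c(1) el])
  ultimately have "\<kappa> = int (2 * N - 2)" by simp
  then have "\<forall>y. meval P y = c * F y" using el eliminates_u_exact[OF c(2)] by simp
  then show ?thesis using c(1) by blast
qed

lemma gamma_points:
  "{Phi x | x. x \<in> dual_variety re \<inter> lie_quadric \<and> Phi x \<noteq> 0} \<subseteq> {y. F y = 0}"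
  "y $ 0 \<noteq> 0 \<Longrightarrow> F y = 0 \<Longrightarrow> y \<in> {Phi x | x. x \<in> dual_variety re \<inter> lie_quadric \<and> Phi x \<noteq> 0}"
proof -
  show "{Phi x | x. x \<in> dual_variety re \<inter> lie_quadric \<and> Phi x \<noteq> 0} \<subseteq> {y. F y = 0}"
  proof clarify
    fix x assume x: "x \<in> dual_variety re" "x \<in> lie_quadric"
    have D0: "D x = 0" using x by (simp add: dual_variety_eq)
    have q: "x $ None * x $ Some 0 = lorentz (Phi x) (Phi x)" using x by (simp add: lie_quadric_def)
    show "F (Phi x) = 0"
    proof (cases "x $ Some 0 = 0")
      case True
      then show ?thesis using F_at_quadric_infinity[OF D0] q by simp
    next
      case False
      have P0: "Phi x $ 0 = x $ Some 0" by (simp add: Phi_def)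
      have "lift (Phi x) = with_u (x $ None) (Phi x)"
        unfolding lift_def P0 q[symmetric] using False by simp
      then have "lift (Phi x) = x" by (simp add: with_u_Phi)
      then show ?thesis using F_D[of "Phi x"] False D0 by (simp add: P0)
    qed
  qed
next
  assume y: "y $ 0 \<noteq> 0" "F y = 0"
  then have "D (lift y) = 0" using F_D by simp
  moreover have "lift y \<noteq> 0" unfolding lift_def by (rule with_u_nz[OF y(1)])
  moreover have "y \<noteq> 0" using y(1) by auto
  moreover have "Phi (lift y) = y" by (simp add: lift_def)
  moreover have "lift y \<in> lie_quadric"
    using y(1) \<open>lift y \<noteq> 0\<close> by (simp add: lie_quadric_def lift_def)
  ultimately show "y \<in> {Phi x | x. x \<in> dual_variety re \<inter> lie_quadric \<and> Phi x \<noteq> 0}"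
    by (intro CollectI exI[of _ "lift y"]) (simp add: dual_variety_eq)
qed

lemma gamma_hypersurface_eq:
  assumes c: "c \<noteq> 0" and P: "\<And>y. meval P y = c * F y"
  shows "gamma_hypersurface re = zero_locus P"
proof -
  let ?X = "{Phi x | x. x \<in> dual_variety re \<inter> lie_quadric \<and> Phi x \<noteq> 0}"
  show ?thesis
    unfolding gamma_hypersurface_def zariski_closure_def zero_locus_def
  proof (intro Collect_cong conj_cong refl)
    fix y :: "complex ^ 5"
    show "(\<forall>Q. (\<forall>y\<in>?X. meval Q y = 0) \<longrightarrow> meval Q y = 0) \<longleftrightarrow> meval P y = 0"
    proof
      assume "\<forall>Q. (\<forall>y\<in>?X. meval Q y = 0) \<longrightarrow> meval Q y = 0"
      moreover have "\<forall>y\<in>?X. meval P y = 0" using gamma_points(1) by (auto simp: P)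
      ultimately show "meval P y = 0" by blast
    next
      assume "meval P y = 0"
      then have y: "F y = 0" using c by (simp add: P)
      show "\<forall>Q. (\<forall>y\<in>?X. meval Q y = 0) \<longrightarrow> meval Q y = 0"
      proof (intro allI impI)
        fix Q assume Q: "\<forall>y\<in>?X. meval Q y = 0"
        show "meval Q y = 0"
          by (rule F_closure[OF y polyfun_meval]) (use Q gamma_points(2) in blast)
      qed
    qed
  qed
qed

lemma total_degree_gamma:
  assumes c: "c \<noteq> 0" and P: "\<And>y. meval P y = c * F y"
  shows "total_degree P = 6 * N - 4"
proof (rule total_degree_homogeneous)
  show "meval P (a *s x) = a ^ (6 * N - 4) * meval P x" for a x
    by (simp add: P F_scale)
  show "P \<noteq> 0" using F_nonzero c P by (metis meval_0 mult_eq_0_iff)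
qed

end

section \<open>Spine curves of general type\<close>

text \<open>Two generic conditions on hyperplanes can be met by the same hyperplane.\<close>

lemma has_curve_degree_unique:
  assumes "has_curve_degree X d" "has_curve_degree X d'"
  shows "d = d'"
proof -
  obtain H H' where H: "H \<noteq> 0" "\<And>h. meval H h \<noteq> 0 \<Longrightarrow> card {vec.span {x} | x. x \<in> X \<and> (\<Sum>i\<in>UNIV. h $ i * x $ i) = 0} = d"
    and H': "H' \<noteq> 0" "\<And>h. meval H' h \<noteq> 0 \<Longrightarrow> card {vec.span {x} | x. x \<in> X \<and> (\<Sum>i\<in>UNIV. h $ i * x $ i) = 0} = d'"
    using assms unfolding has_curve_degree_def Let_def by blast
  obtain x y where "meval H x \<noteq> 0" "meval H' y \<noteq> 0" using H(1) H'(1) mpoly_nonzero_iff by blast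
  then obtain z where "meval H z \<noteq> 0" "meval H' z \<noteq> 0"
    using polyfun_no_zero_divisors[OF polyfun_meval polyfun_meval] by blast
  then show ?thesis using H(2) H'(2) by blast
qed

lemma homogenize_0 [simp]: "homogenize d 0 = 0"
  by (simp add: homogenize_def)

lemma general_type_spine:
  fixes re :: "real poly ^ 5"
  defines "N \<equiv> vec_degree re"
  assumes gt: "general_type re"
  shows "real_spine re N (\<chi> i. cpoly (re $ i))" "degree (re $ 0) = N"
proof -
  let ?J = "{1,2,3,4} :: 5 set" and ?e0 = "re $ 0"
  have c1: "Gcd ((\<lambda>j. homogenize (2 * N - 2) (w_poly re j)) ` ?J) = 1"
    and c2: "gcd (homogenize N ?e0) (homogenize (N - 1) (pderiv ?e0)) = 1"
    and c3: "gcd (homogenize N ?e0) (homogenize (2 * N) (lorentz re re)) = 1"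
    using gt unfolding general_type_def N_def Let_def by auto
  have deg: "degree (re $ i) \<le> N" for i unfolding N_def by (rule degree_le_vec_degree)
  \<comment> \<open>constant polynomials have zero Wronskians, and the greatest common divisor of these is 0\<close>
  have N: "N \<ge> 1"
  proof (rule ccontr)
    assume "\<not> N \<ge> 1"
    then have "degree (re $ i) = 0" for i using deg[of i] by simp
    then have "w_poly re j = 0" for j by (simp add: w_poly_def pderiv_eq_0_iff[THEN iffD2])
    then show False using c1 by simp
  qed
  define A1 where "A1 = (\<lambda>j. (w_poly re j, 2 * N - 2)) ` ?J"
  define A2 where "A2 = {(?e0, N), (pderiv ?e0, N - 1)}"
  define A3 where "A3 = {(?e0, N), (lorentz re re, 2 * N)}"
  have cop1: "coprime_forms A1"
    unfolding coprime_forms_def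
  proof (intro allI impI)
    fix h assume h: "\<forall>(p, d)\<in>A1. h dvd homogenize d p"
    have "h dvd Gcd ((\<lambda>j. homogenize (2 * N - 2) (w_poly re j)) ` ?J)"
      by (rule Gcd_greatest) (use h in \<open>auto simp: A1_def\<close>)
    then show "h dvd 1" unfolding c1 .
  qed
  have cop2: "coprime_forms A2"
    unfolding coprime_forms_def
  proof (intro allI impI)
    fix h assume h: "\<forall>(p, d)\<in>A2. h dvd homogenize d p"
    have "h dvd gcd (homogenize N ?e0) (homogenize (N - 1) (pderiv ?e0))"
      by (rule gcd_greatest) (use h in \<open>auto simp: A2_def\<close>)
    then show "h dvd 1" unfolding c2 .
  qed
  have cop3: "coprime_forms A3"
    unfolding coprime_forms_def
  proof (intro allI impI)
    fix h assume h: "\<forall>(p, d)\<in>A3. h dvd homogenize d p"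
    have "h dvd gcd (homogenize N ?e0) (homogenize (2 * N) (lorentz re re))"
      by (rule gcd_greatest) (use h in \<open>auto simp: A3_def\<close>)
    then show "h dvd 1" unfolding c3 .
  qed
  have deg1: "\<forall>(p, d)\<in>A1. degree p \<le> d"
    using degree_wronskian_le[OF deg deg[of 0] N] by (auto simp: A1_def w_poly_def)
  have deg2: "\<forall>(p, d)\<in>A2. degree p \<le> d"
    using deg[of 0] by (auto simp: A2_def degree_pderiv)
  have deg3: "\<forall>(p, d)\<in>A3. degree p \<le> d"
    using deg[of 0] degree_lorentz_le[of re N re N] deg by (auto simp: A3_def)
  \<comment> \<open>if \<open>e\<^sub>0\<close> had degree less than \<open>N\<close>, then both forms of the second condition would vanish at infinity\<close>
  have "\<exists>(p, d)\<in>A2. coeff p d \<noteq> 0" by (rule coprime_forms_infinity[OF cop2])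
  then have "coeff ?e0 N \<noteq> 0"
    using N by (auto simp: A2_def coeff_pderiv)
  then show d0: "degree ?e0 = N" using le_degree[of ?e0 N] deg[of 0] by simp
  have w: "wvec (\<chi> i. cpoly (re $ i)) $ j = cpoly (w_poly re j)" for j
    by (simp add: wvec_def w_poly_def cpoly_hom)
  have l: "lorentz (\<chi> i. cpoly (re $ i)) (\<chi> i. cpoly (re $ i)) = cpoly (lorentz re re)"
    by (simp add: lorentz_def cpoly_hom)
  have "spine (\<chi> i. cpoly (re $ i)) N"
  proof
    show "1 \<le> N" by (rule N)
    show "degree ((\<chi> i. cpoly (re $ i)) $ 0) = N" by (simp add: d0)
    show "degree ((\<chi> i. cpoly (re $ i)) $ i) \<le> N" for i by (simp add: deg)
    fix t
    show "poly (pderiv ((\<chi> i. cpoly (re $ i)) $ 0)) t \<noteq> 0" if "poly ((\<chi> i. cpoly (re $ i)) $ 0) t = 0"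
      using coprime_forms_finite[OF cop2 deg2, where t = t] that by (auto simp: A2_def cpoly_pderiv)
    show "poly (lorentz (\<chi> i. cpoly (re $ i)) (\<chi> i. cpoly (re $ i))) t \<noteq> 0" if "poly ((\<chi> i. cpoly (re $ i)) $ 0) t = 0"
      using coprime_forms_finite[OF cop3 deg3, where t = t] that by (auto simp: A3_def l)
    show "\<exists>j\<in>?J. poly (wvec (\<chi> i. cpoly (re $ i)) $ j) t \<noteq> 0"
      using coprime_forms_finite[OF cop1 deg1, where t = t] by (auto simp: A1_def w)
    show "\<exists>j\<in>?J. coeff (wvec (\<chi> i. cpoly (re $ i)) $ j) (2 * N - 2) \<noteq> 0"
      using coprime_forms_infinity[OF cop1] by (auto simp: A1_def w)
  qed
  then show "real_spine re N (\<chi> i. cpoly (re $ i))" by (intro real_spine.intro refl)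
qed

theorem theorem24:
  fixes e :: "real poly ^ 5" and n :: nat
  assumes "Gcd (range (\<lambda>i. e $ i)) = 1"
    and "general_type e"
    and "has_curve_degree (spine_curve e) n"
  shows "(\<exists>F. gamma_equation e F) \<and>
    (\<forall>F. gamma_equation e F \<longrightarrow>
       gamma_hypersurface e = zero_locus F \<and>
       int (total_degree F) = 6 * int n - 4)"
proof -
  define N where "N = vec_degree e"
  interpret real_spine e N "\<chi> i. cpoly (e $ i)"
    unfolding N_def by (rule general_type_spine(1)[OF assms(2)])
  have "has_curve_degree (spine_curve e) (degree (e $ 0))" and pd: "plucker_degree_one e"
    using assms(2) unfolding general_type_def Let_def by auto
  then have n: "n = N"
    using has_curve_degree_unique[OF assms(3)] general_type_spine(2)[OF assms(2)] by (simp add: N_def)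
  have fin: "finite bitangents" by (rule finite_bitangents[OF pd])
  show ?thesis
  proof (intro conjI allI impI)
    show "\<exists>F. gamma_equation e F" using gamma_equation_FP[OF fin] by blast
    fix P assume "gamma_equation e P"
    then obtain c where c: "c \<noteq> 0" "\<And>y. meval P y = c * F y" using gamma_equation_unique[OF fin] by blast
    show "gamma_hypersurface e = zero_locus P" by (rule gamma_hypersurface_eq[OF c])
    show "int (total_degree P) = 6 * int n - 4"
      using total_degree_gamma[OF c] N n by simp
  qed
qed

end
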